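(* Let $a,b,c>0$ with $a^2+b^2=c^2$, let $\alpha=\ln(c/a)$, $\beta=\ln(2c/b)$, $\mu=\max(\alpha,\beta)$. Assume that $z=\alpha/\beta$ is irrational and that $\theta=\tan^{-1}(a/b)$ is an irrational multiple of $\pi$. Let $f$ be a continuous function on $X$, and let $\{S_n\}$ be a sequence of supertiles of increasing size. Let $$d\nu=\frac{e^{2s}\bigl(a^2h(\alpha-s)+b^2h(\beta-s)\bigr)}{2c^2}\,d\Omega\,ds,\qquad d\rho=\frac{2c^2e^{-2s}}{a^2\alpha+b^2\beta}\,d\nu$$ be measures on $X$, where $h(x)=1$ if $x\ge0$ and $h(x)=0$ otherwise. Then $$\lim_{n\to\infty}\langle f,S_n\rangle=\int_Xf\,d\nu,\qquad\lim_{n\to\infty}\langle f,S_n\rangle'=\int_Xf\,d\rho.$$ These limits also apply if $f$ is the characteristic function of a rectangle in $X$.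
   Context: A tile is a right triangle with an ordered triple of vertices $(A,C,B)$, with right angle at $C$ and angle $\theta$ at $A$, so that $|AC|:|CB|:|AB|=b:a:c$. Subdivision rule: let $F$ be the foot of the perpendicular from $C$ to $AB$, and let $M,N,K$ be the midpoints of $AC$, $AF$, $FC$. The tile $(A,C,B)$ is divided into the five daughter tiles $(A,N,M)$, $(M,K,C)$, $(M,K,F)$, $(F,N,M)$ (each smaller than the parent by the linear factor $b/(2c)=e^{-\beta}$) and $(C,F,B)$ (smaller by the linear factor $a/c=e^{-\alpha}$). A tile has size $s$ if its hypotenuse is $ce^{-s}$. For $t\ge0$ and a finite collection $S$ of tiles with sizes in $[0,\mu)$, $e^{tL}(S)$ is the collection (with all sizes in $[0,\mu)$) obtained by expanding $S$ by the linear factor $e^t$ and then repeatedly subdividing the largest triangle until all triangles have non-negative size parameter. A sequence of supertiles of increasing size means $S_n=e^{t_nL}(\tau_n)$ with $t_n\to\infty$, where each $\tau_n$ is a single tile with size in $[0,\mu)$ and arbitrary orientation. The orientation of a tile $(A,C,B)$ is $\Omega=(\pm,\phi)$, where $\pm$ is the handedness of the triangle and $\phi\in\mathbb R/2\pi\mathbb Z$ is the direction of the vector from $A$ to $C$. The space of orientations is two copies of the circle with Haar measure $d\Omega=d\phi/4\pi$. The space of tiles up to translation is $X=\{+,-\}\times S^1\times[0,\mu)$ (two copies of $S^1\times[0,\mu)$). A rectangle in $X$ is a product of an interval in $S^1$ and an interval in $[0,\mu)$ in one of the two copies. For a function $f$ on $X$ and a finite collection $S$ of tiles, $\langle f,S\rangle$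 is the average of $f$ over the tiles of $S$ with each tile given equal weight, and $\langle f,S\rangle'$ is the average with each tile weighted proportionally to its area.
   Formalization: The continuous function f on X is additionally assumed bounded; since X contains the half-open factor [0,μ), the claim fails for unbounded f such as (μ-s)^(-1/2), for suitably chosen supertiles S_n. *)

theory Defs
  imports "HOL-Analysis.Analysis"
begin

definition size_alpha :: "real \<Rightarrow> real \<Rightarrow> real" where
  "size_alpha a c = ln (c / a)"

definition size_beta :: "real \<Rightarrow> real \<Rightarrow> real" where
  "size_beta b c = ln (2 * c / b)"

definition size_mu :: "real \<Rightarrow> real \<Rightarrow> real \<Rightarrow> real" where
  "size_mu a b c = max (size_alpha a c) (size_beta b c)"


text \<open>A tile is the ordered triple \<open>(A, C, B)\<close> of its vertices in the complex plane.\<close>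

type_synonym tile = "complex \<times> complex \<times> complex"

definition is_tile :: "real \<Rightarrow> real \<Rightarrow> real \<Rightarrow> tile \<Rightarrow> bool" where
  "is_tile a b c = (\<lambda>(A, C, B).
     orthogonal (A - C) (B - C) \<and>
     (\<exists>r>0. dist A C = r * b \<and> dist C B = r * a \<and> dist A B = r * c))"

text \<open>The hypotenuse is \<open>c * exp (- s)\<close> exactly for \<open>s = tile_size c T\<close>; larger tiles
  have smaller size parameter.\<close>

definition tile_size :: "real \<Rightarrow> tile \<Rightarrow> real" where
  "tile_size c = (\<lambda>(A, C, B). ln (c / dist A B))"

definition tile_area :: "tile \<Rightarrow> real" where
  "tile_area = (\<lambda>(A, C, B). dist A C * dist C B / 2)"

definition perp_foot :: "complex \<Rightarrow> complex \<Rightarrow> complex \<Rightarrow> complex" where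
  "perp_foot A B C = A + (((C - A) \<bullet> (B - A)) / ((B - A) \<bullet> (B - A))) *\<^sub>R (B - A)"

definition daughters :: "tile \<Rightarrow> tile multiset" where
  "daughters = (\<lambda>(A, C, B).
     let F = perp_foot A B C; M = midpoint A C; N = midpoint A F; K = midpoint F C
     in {# (A, N, M), (M, K, C), (M, K, F), (F, N, M), (C, F, B) #})"

definition expand_tile :: "real \<Rightarrow> tile \<Rightarrow> tile" where
  "expand_tile t = (\<lambda>(A, C, B). (exp t *\<^sub>R A, exp t *\<^sub>R C, exp t *\<^sub>R B))"

inductive subdivide_largest :: "real \<Rightarrow> tile multiset \<Rightarrow> tile multiset \<Rightarrow> bool" for c where
  "tile_size c T < 0 \<Longrightarrow> (\<forall>U\<in>#R. tile_size c T \<le> tile_size c U)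
   \<Longrightarrow> subdivide_largest c (add_mset T R) (daughters T + R)"

text \<open>\<open>inflates_to c t S S'\<close> means that \<open>S'\<close> is the collection obtained from \<open>S\<close> by the flow
  for time \<open>t\<close>. Ties between equally large tiles may be broken in any way; the result exists and
  does not depend on these choices, see \<open>inflates_to_ex1\<close> below.\<close>

definition inflates_to :: "real \<Rightarrow> real \<Rightarrow> tile multiset \<Rightarrow> tile multiset \<Rightarrow> bool" where
  "inflates_to c t S S' \<longleftrightarrow>
     (subdivide_largest c)\<^sup>*\<^sup>* (image_mset (expand_tile t) S) S' \<and> (\<forall>T\<in>#S'. 0 \<le> tile_size c T)"

lemma is_tileE:
  assumes "is_tile a b c T" and "0 < c"
  obtains A C B r where "T = (A, C, B)" "0 < r" "dist A C = r * b" "dist C B = r * a"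
    "dist A B = r * c" "tile_size c T = - ln r" "orthogonal (A - C) (B - C)"
proof -
  obtain A C B where T: "T = (A, C, B)" by (cases T)
  with assms obtain r where "0 < r" "dist A C = r * b" "dist C B = r * a"
    "dist A B = r * c" "orthogonal (A - C) (B - C)"
    by (auto simp: is_tile_def)
  moreover from this have "c / dist A B = inverse r"
    using assms by (simp add: field_simps)
  with \<open>0 < r\<close> have "tile_size c T = - ln r"
    by (simp add: T tile_size_def ln_inverse)
  ultimately show ?thesis using T that by blast
qed

lemma is_tile_expand:
  assumes "is_tile a b c T" and "0 < c"
  shows "is_tile a b c (expand_tile t T)"
proof -
  from is_tileE [OF assms] obtain A C B r where T: "T = (A, C, B)" "0 < r" "dist A C = r * b"
    "dist C B = r * a" "dist A B = r * c" "orthogonal (A - C) (B - C)" by metis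
  have "dist (exp t *\<^sub>R X) (exp t *\<^sub>R Y) = exp t * dist X Y" for X Y :: complex
    by (simp add: dist_norm flip: scaleR_diff_right)
  moreover have "orthogonal (exp t *\<^sub>R A - exp t *\<^sub>R C) (exp t *\<^sub>R B - exp t *\<^sub>R C)"
    using T(6) by (simp add: orthogonal_def flip: scaleR_diff_right)
  ultimately show ?thesis
    using T by (auto simp: is_tile_def expand_tile_def intro!: exI [of _ "exp t * r"])
qed

text \<open>In terms of \<open>u = C - A\<close> and \<open>v = B - A\<close>, all vertices of the daughters are \<open>A\<close> plus
  combinations of \<open>u\<close> and \<open>v\<close>.\<close>

lemma is_tile_comb:
  fixes u v :: complex
  assumes pos: "0 < a" "0 < b" "0 < c" "0 < r" "0 < q" and abc: "a\<^sup>2 + b\<^sup>2 = c\<^sup>2"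
    and u: "u \<bullet> u = r\<^sup>2 * b\<^sup>2" "u \<bullet> v = r\<^sup>2 * b\<^sup>2" "v \<bullet> v = r\<^sup>2 * c\<^sup>2"
    and P: "P = A + x1 *\<^sub>R u + y1 *\<^sub>R v" and Q: "Q = A + x2 *\<^sub>R u + y2 *\<^sub>R v"
    and R: "R = A + x3 *\<^sub>R u + y3 *\<^sub>R v"
    and k: "b\<^sup>2 = k * c\<^sup>2" and q: "q\<^sup>2 = p"
    and PQ: "((x1 - x2)\<^sup>2 + 2 * (x1 - x2) * (y1 - y2)) * k + (y1 - y2)\<^sup>2 = p * k"
    and QR: "((x2 - x3)\<^sup>2 + 2 * (x2 - x3) * (y2 - y3)) * k + (y2 - y3)\<^sup>2 = p * (1 - k)"
    and PR: "((x1 - x3)\<^sup>2 + 2 * (x1 - x3) * (y1 - y3)) * k + (y1 - y3)\<^sup>2 = p"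
  shows "is_tile a b c (P, Q, R)" and "tile_size c (P, Q, R) = - ln r - ln q"
proof -
  have nrm: "norm (x *\<^sub>R u + y *\<^sub>R v) = r * q * d"
    if xy: "(x\<^sup>2 + 2 * x * y) * k + y\<^sup>2 = p * l" and dl: "d\<^sup>2 = l * c\<^sup>2" "0 < d" for x y d l
  proof (rule power2_eq_imp_eq)
    have "(norm (x *\<^sub>R u + y *\<^sub>R v))\<^sup>2 = x\<^sup>2 * (u \<bullet> u) + 2 * x * y * (u \<bullet> v) + y\<^sup>2 * (v \<bullet> v)"
      unfolding power2_norm_eq_inner
      by (simp add: inner_add_left inner_add_right inner_commute power2_eq_square algebra_simps)
    also have "\<dots> = r\<^sup>2 * c\<^sup>2 * ((x\<^sup>2 + 2 * x * y) * k + y\<^sup>2)"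
      by (simp add: u k algebra_simps)
    finally show "(norm (x *\<^sub>R u + y *\<^sub>R v))\<^sup>2 = (r * q * d)\<^sup>2"
      by (simp add: xy dl q power_mult_distrib)
  qed (use dl pos in auto)
  have a2: "a\<^sup>2 = (1 - k) * c\<^sup>2" using abc k by (simp add: algebra_simps)
  have diff: "P - Q = (x1 - x2) *\<^sub>R u + (y1 - y2) *\<^sub>R v" "Q - R = (x2 - x3) *\<^sub>R u + (y2 - y3) *\<^sub>R v"
    "P - R = (x1 - x3) *\<^sub>R u + (y1 - y3) *\<^sub>R v"
    by (simp_all add: P Q R algebra_simps)
  have dists: "dist P Q = r * q * b" "dist Q R = r * q * a" "dist P R = r * q * c"
    unfolding dist_norm diff using nrm [OF PQ k] nrm [OF QR a2] nrm [of _ _ 1 c] PR pos by auto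
  have "P - R = (P - Q) - (R - Q)" by simp
  then have "(norm (P - R))\<^sup>2 = (norm (P - Q))\<^sup>2 + (norm (R - Q))\<^sup>2 - 2 * ((P - Q) \<bullet> (R - Q))"
    by (simp add: power2_norm_eq_inner inner_diff_left inner_diff_right inner_commute)
  moreover have "(norm (P - R))\<^sup>2 = (norm (P - Q))\<^sup>2 + (norm (R - Q))\<^sup>2"
  proof -
    have "(r * q * c)\<^sup>2 = (r * q)\<^sup>2 * (a\<^sup>2 + b\<^sup>2)" by (simp add: abc power_mult_distrib)
    then show ?thesis
      using dists by (simp add: dist_norm norm_minus_commute [of R Q] power_mult_distrib algebra_simps)
  qed
  ultimately have "orthogonal (P - Q) (R - Q)" by (simp add: orthogonal_def)
  then show "is_tile a b c (P, Q, R)"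
    using dists pos by (auto simp: is_tile_def intro!: exI [of _ "r * q"])
  have "c / dist P R = inverse (r * q)" using dists(3) pos by (simp add: field_simps)
  then show "tile_size c (P, Q, R) = - ln r - ln q"
    using pos by (simp add: tile_size_def ln_inverse ln_mult del: inverse_mult_distrib)
qed

lemma daughters_props:
  assumes pos: "0 < a" "0 < b" "0 < c" and abc: "a\<^sup>2 + b\<^sup>2 = c\<^sup>2"
    and T: "is_tile a b c T" and D: "D \<in># daughters T"
  shows "is_tile a b c D"
    and "tile_size c D = tile_size c T + size_alpha a c \<or> tile_size c D = tile_size c T + size_beta b c"
proof -
  from is_tileE [OF T \<open>0 < c\<close>] obtain A C B r where r: "T = (A, C, B)" "0 < r" "dist A C = r * b"
    "dist C B = r * a" "dist A B = r * c" "tile_size c T = - ln r" "orthogonal (A - C) (B - C)"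
    by metis
  define u v k where "u = C - A" and "v = B - A" and "k = b\<^sup>2 / c\<^sup>2"
  have CB: "C = A + u" "B = A + v" by (simp_all add: u_def v_def)
  have uv: "u \<bullet> u = r\<^sup>2 * b\<^sup>2" "u \<bullet> v = r\<^sup>2 * b\<^sup>2" "v \<bullet> v = r\<^sup>2 * c\<^sup>2"
  proof -
    show 1: "u \<bullet> u = r\<^sup>2 * b\<^sup>2" "v \<bullet> v = r\<^sup>2 * c\<^sup>2"
      using r(3,5) by (simp_all add: CB dist_norm power_mult_distrib flip: power2_norm_eq_inner)
    have "- u \<bullet> (v - u) = 0" using r(7) by (simp add: CB orthogonal_def)
    then have "u \<bullet> v = u \<bullet> u" by (simp add: inner_diff_right)
    with 1 show "u \<bullet> v = r\<^sup>2 * b\<^sup>2" by simp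
  qed
  define F where "F = perp_foot A B C"
  have F: "F = A + k *\<^sub>R v"
    using r(2) pos by (simp add: F_def perp_foot_def k_def CB uv)
  define M N K where "M = midpoint A C" and "N = midpoint A F" and "K = midpoint F C"
  have mid: "midpoint A (A + x) = A + (1/2) *\<^sub>R x" "midpoint (A + x) (A + y) = A + (1/2) *\<^sub>R (x + y)"
    for x y by (simp_all add: midpoint_def scaleR_conv_of_real field_simps)
  have pts: "A = A + 0 *\<^sub>R u + 0 *\<^sub>R v" "C = A + 1 *\<^sub>R u + 0 *\<^sub>R v" "B = A + 0 *\<^sub>R u + 1 *\<^sub>R v"
    "F = A + 0 *\<^sub>R u + k *\<^sub>R v" "M = A + (1/2) *\<^sub>R u + 0 *\<^sub>R v" "N = A + 0 *\<^sub>R u + (k/2) *\<^sub>R v"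
    "K = A + (1/2) *\<^sub>R u + (k/2) *\<^sub>R v"
    using F by (simp_all add: CB M_def N_def K_def mid algebra_simps)
  have D5: "D \<in> {(A, N, M), (M, K, C), (M, K, F), (F, N, M), (C, F, B)}"
    using D by (auto simp: r(1) daughters_def Let_def F_def M_def N_def K_def)
  have a2: "a\<^sup>2 = c\<^sup>2 - b\<^sup>2" using abc by simp
  have k: "b\<^sup>2 = k * c\<^sup>2" using pos by (simp add: k_def)
  have qb: "(b / (2 * c))\<^sup>2 = k / 4" using pos by (simp add: k_def power_divide power_mult_distrib)
  have qa: "(a / c)\<^sup>2 = 1 - k" using pos by (simp add: k_def power_divide a2 diff_divide_distrib)
  have beta: "ln (b / (2 * c)) = - size_beta b c" and alpha: "ln (a / c) = - size_alpha a c"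
    using pos by (simp_all add: size_beta_def size_alpha_def ln_div)
  have qpos: "0 < b / (2 * c)" "0 < a / c" using pos by auto
  note comb_beta = is_tile_comb [OF pos r(2) qpos(1) abc uv _ _ _ k qb]
  note comb_alpha = is_tile_comb [OF pos r(2) qpos(2) abc uv _ _ _ k qa]
  define good where "good q X \<longleftrightarrow> is_tile a b c X \<and> tile_size c X = - ln r - ln q" for q X
  have "good (b / (2 * c)) (A, N, M)"
    unfolding good_def
    by (rule conjI [OF comb_beta [OF pts(1) pts(6) pts(5)]])
      (simp_all add: power2_eq_square algebra_simps)
  moreover have "good (b / (2 * c)) (M, K, C)"
    unfolding good_def
    by (rule conjI [OF comb_beta [OF pts(5) pts(7) pts(2)]])
      (simp_all add: power2_eq_square algebra_simps)
  moreover have "good (b / (2 * c)) (M, K, F)"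
    unfolding good_def
    by (rule conjI [OF comb_beta [OF pts(5) pts(7) pts(4)]])
      (simp_all add: power2_eq_square algebra_simps)
  moreover have "good (b / (2 * c)) (F, N, M)"
    unfolding good_def
    by (rule conjI [OF comb_beta [OF pts(4) pts(6) pts(5)]])
      (simp_all add: power2_eq_square algebra_simps)
  moreover have "good (a / c) (C, F, B)"
    unfolding good_def
    by (rule conjI [OF comb_alpha [OF pts(2) pts(4) pts(3)]])
      (simp_all add: power2_eq_square algebra_simps)
  ultimately have "good (b / (2 * c)) D \<or> good (a / c) D"
    using D5 by blast
  then show "is_tile a b c D"
    "tile_size c D = tile_size c T + size_alpha a c \<or> tile_size c D = tile_size c T + size_beta b c"
    unfolding good_def beta alpha r(6) by auto
qed

lemma inflates_to_ex1:
  assumes pos: "0 < a" "0 < b" "0 < c" and abc: "a\<^sup>2 + b\<^sup>2 = c\<^sup>2"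
    and S: "\<forall>T\<in>#S. is_tile a b c T"
  shows "\<exists>!S'. inflates_to c t S S'"
proof -
  define d where "d = min (size_alpha a c) (size_beta b c)"
  have "0 < a\<^sup>2" "0 < b\<^sup>2" using pos by simp_all
  then have "a\<^sup>2 < c\<^sup>2" "b\<^sup>2 < c\<^sup>2" using abc by linarith+
  then have "a < c" "b < c"
    using pos by (auto dest: power_less_imp_less_base)
  then have d: "0 < d"
    using pos by (simp add: d_def size_alpha_def size_beta_def)
  define w where "w T = (6::nat) ^ nat \<lceil>- tile_size c T / d\<rceil>" for T
  define W where "W S = (\<Sum>T\<in>#S. w T)" for S
  define ok where "ok S \<longleftrightarrow> (\<forall>T\<in>#S. is_tile a b c T)" for S
  define nf where "nf S \<longleftrightarrow> (\<forall>T\<in>#S. 0 \<le> tile_size c T)" for S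
  have dsize: "tile_size c T + d \<le> tile_size c D" if "is_tile a b c T" "D \<in># daughters T" for T D
    using daughters_props(2) [OF pos abc that] by (auto simp: d_def)
  have step_ok: "ok S'" if "subdivide_largest c S S'" "ok S" for S S'
    using that by cases (auto simp: ok_def intro: daughters_props(1) [OF pos abc])
  have wdec: "W (daughters T) < w T" if T: "is_tile a b c T" "tile_size c T < 0" for T
  proof -
    define m where "m = nat \<lceil>- tile_size c T / d\<rceil>"
    have "0 < - tile_size c T / d" using T d by (intro divide_pos_pos) simp_all
    then have "0 < \<lceil>- tile_size c T / d\<rceil>" by simp
    then have m: "0 < m" by (simp add: m_def)
    have "w D \<le> 6 ^ (m - 1)" if "D \<in># daughters T" for D
    proof -
      have "- tile_size c D / d \<le> - tile_size c T / d - 1"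
        using dsize [OF T(1) that] d by (simp add: field_simps)
      then have "\<lceil>- tile_size c D / d\<rceil> \<le> \<lceil>- tile_size c T / d\<rceil> - 1"
        by linarith
      then have "nat \<lceil>- tile_size c D / d\<rceil> \<le> m - 1" by (simp add: m_def nat_le_iff)
      then show ?thesis unfolding w_def by (rule power_increasing) simp
    qed
    then have "W (daughters T) \<le> (\<Sum>D\<in>#daughters T. 6 ^ (m - 1))"
      unfolding W_def by (rule sum_mset_mono)
    also have "\<dots> = 5 * 6 ^ (m - 1)"
      by (cases T) (simp add: daughters_def Let_def)
    also have "\<dots> < 6 * 6 ^ (m - 1)" by simp
    also have "\<dots> = w T" using m unfolding w_def m_def [symmetric] by (cases m) simp_all
    finally show ?thesis .
  qed
  have step_W: "W S' < W S" if "subdivide_largest c S S'" "ok S" for S S'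
    using that by cases (use wdec in \<open>auto simp: ok_def W_def\<close>)
  have step_ex: "\<exists>S'. subdivide_largest c S S'" if "\<not> nf S" for S
  proof -
    from that obtain U where U: "U \<in># S" "tile_size c U < 0" by (auto simp: nf_def not_le)
    then have "finite (set_mset S)" "set_mset S \<noteq> {}" by auto
    then obtain T where T: "T \<in># S" and Tmin: "\<And>V. V \<in># S \<Longrightarrow> tile_size c T \<le> tile_size c V"
      by (metis arg_min_if_finite(1) arg_min_least)
    from T obtain R where R: "S = add_mset T R" by (meson multi_member_split)
    have "tile_size c T < 0" using Tmin [OF U(1)] U(2) by simp
    then have "subdivide_largest c (add_mset T R) (daughters T + R)"
      using Tmin by (intro subdivide_largest.intros) (auto simp: R)
    then show ?thesis unfolding R by blast
  qed
  have no_step: "\<not> subdivide_largest c S S'" if "nf S" for S S'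
    using that by (auto simp: nf_def elim!: subdivide_largest.cases)
  have diamond: "S1 = S2 \<or> (\<exists>S3. subdivide_largest c S1 S3 \<and> subdivide_largest c S2 S3)"
    if 1: "subdivide_largest c S S1" and 2: "subdivide_largest c S S2" and ok: "ok S" for S S1 S2
  proof -
    from 1 obtain T R where T: "S = add_mset T R" "S1 = daughters T + R" "tile_size c T < 0"
      "\<forall>U\<in>#R. tile_size c T \<le> tile_size c U" by cases
    from 2 obtain U Q where U: "S = add_mset U Q" "S2 = daughters U + Q" "tile_size c U < 0"
      "\<forall>V\<in>#Q. tile_size c U \<le> tile_size c V" by cases
    show ?thesis
    proof (cases "T = U")
      case True
      then show ?thesis using T U by auto
    next
      case False
      with T(1) U(1) obtain P where P: "R = add_mset U P" "Q = add_mset T P"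
        by (auto simp: add_eq_conv_ex)
      have eq: "tile_size c T = tile_size c U" using T(4) U(4) P by (simp add: antisym)
      have dT: "tile_size c T \<le> tile_size c D" if "D \<in># daughters T" for D
        using dsize [OF _ that] d ok T(1) by (fastforce simp: ok_def)
      have dU: "tile_size c U \<le> tile_size c D" if "D \<in># daughters U" for D
        using dsize [OF _ that] d ok U(1) by (fastforce simp: ok_def)
      have "subdivide_largest c (add_mset U (daughters T + P)) (daughters U + (daughters T + P))"
        using U(3,4) dT eq P by (intro subdivide_largest.intros) auto
      moreover
      have "subdivide_largest c (add_mset T (daughters U + P)) (daughters T + (daughters U + P))"
        using T(3,4) dU eq P by (intro subdivide_largest.intros) auto
      ultimately show ?thesis
        by (auto simp: T U P ac_simps)
    qed
  qed
  have "\<exists>!S'. (subdivide_largest c)\<^sup>*\<^sup>* S S' \<and> nf S'" if "ok S" for S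
    using that
  proof (induction "W S" arbitrary: S rule: less_induct)
    case less
    show ?case
    proof (cases "nf S")
      case True
      then have "S' = S" if "(subdivide_largest c)\<^sup>*\<^sup>* S S'" for S'
        using that no_step by (metis converse_rtranclpE)
      with True show ?thesis by blast
    next
      case False
      then obtain S1 where S1: "subdivide_largest c S S1" using step_ex by blast
      have IH: "\<exists>!S'. (subdivide_largest c)\<^sup>*\<^sup>* S1 S' \<and> nf S'" if "subdivide_largest c S S1" for S1
        using less.hyps [of S1] step_W [OF that less.prems] step_ok [OF that less.prems] by blast
      obtain N where N: "(subdivide_largest c)\<^sup>*\<^sup>* S1 N" "nf N"
        "\<And>N'. (subdivide_largest c)\<^sup>*\<^sup>* S1 N' \<Longrightarrow> nf N' \<Longrightarrow> N' = N"
        using IH [OF S1] by blast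
      show ?thesis
      proof (rule ex1I [of _ N])
        show "(subdivide_largest c)\<^sup>*\<^sup>* S N \<and> nf N"
          using N S1 by (blast intro: converse_rtranclp_into_rtranclp)
      next
        fix N' assume N': "(subdivide_largest c)\<^sup>*\<^sup>* S N' \<and> nf N'"
        with False obtain S2 where S2: "subdivide_largest c S S2" "(subdivide_largest c)\<^sup>*\<^sup>* S2 N'"
          by (metis converse_rtranclpE)
        from diamond [OF S1 S2(1) less.prems] show "N' = N"
        proof
          assume "S1 = S2"
          then show ?thesis using N N' S2 by blast
        next
          assume "\<exists>S3. subdivide_largest c S1 S3 \<and> subdivide_largest c S2 S3"
          then obtain S3 where S3: "subdivide_largest c S1 S3" "subdivide_largest c S2 S3" by blast
          have "ok S1" "ok S3" using S1 S3 less.prems step_ok by blast+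
          moreover have "W S3 < W S"
            using step_W [OF S1 less.prems] step_W [OF S3(1) \<open>ok S1\<close>] by simp
          ultimately obtain N3 where N3: "(subdivide_largest c)\<^sup>*\<^sup>* S3 N3" "nf N3"
            using less.hyps [of S3] by blast
          have "N3 = N"
            using N(3) N3 S3(1) by (blast intro: converse_rtranclp_into_rtranclp)
          moreover have "N3 = N'"
            using IH [OF S2(1)] N3 N' S2(2) S3(2)
            by (blast intro: converse_rtranclp_into_rtranclp)
          ultimately show ?thesis by simp
        qed
      qed
    qed
  qed
  moreover have "ok (image_mset (expand_tile t) S)"
    using S is_tile_expand pos by (auto simp: ok_def)
  ultimately show ?thesis
    unfolding inflates_to_def nf_def by blast
qed

definition supertile_sequence ::
  "real \<Rightarrow> real \<Rightarrow> real \<Rightarrow> (nat \<Rightarrow> tile multiset) \<Rightarrow> bool" where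
  "supertile_sequence a b c S \<longleftrightarrow>
     (\<exists>\<tau> t. (\<forall>n. is_tile a b c (\<tau> n) \<and> tile_size c (\<tau> n) \<in> {0..<size_mu a b c}) \<and>
            (\<forall>n. 0 \<le> t n) \<and> filterlim t at_top sequentially \<and>
            (\<forall>n. inflates_to c (t n) {#\<tau> n#} (S n)))"


text \<open>An orientation \<open>(\<plusminus>, \<phi>)\<close> is encoded as a pair of a truth value (\<open>True\<close> for tiles whose
  vertices \<open>A\<close>, \<open>C\<close>, \<open>B\<close> are in counterclockwise order) and the point \<open>cis \<phi>\<close> of the unit circle,
  which stands for the angle modulo \<open>2 * pi\<close>. The type \<open>bool\<close> carries the discrete topology.\<close>

type_synonym orientation = "bool \<times> complex"

definition tile_orientation :: "tile \<Rightarrow> orientation" where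
  "tile_orientation = (\<lambda>(A, C, B). (0 < Im (cnj (C - A) * (B - A)), sgn (C - A)))"

definition tile_class :: "real \<Rightarrow> tile \<Rightarrow> orientation \<times> real" where
  "tile_class c T = (tile_orientation T, tile_size c T)"

text \<open>As \<open>[0, \<mu>)\<close> is half-open, this space is not compact: weak convergence of measures on it has
  to be tested with bounded continuous functions.\<close>

definition tile_space :: "real \<Rightarrow> real \<Rightarrow> real \<Rightarrow> (orientation \<times> real) set" where
  "tile_space a b c = (UNIV \<times> sphere 0 1) \<times> {0..<size_mu a b c}"

definition is_rectangle ::
  "real \<Rightarrow> real \<Rightarrow> real \<Rightarrow> (orientation \<times> real) set \<Rightarrow> bool" where
  "is_rectangle a b c R \<longleftrightarrow>
     (\<exists>h I J. is_interval (I :: real set) \<and> is_interval (J :: real set) \<and>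
        J \<subseteq> {0..<size_mu a b c} \<and> R = ({h} \<times> cis ` I) \<times> J)"

definition tile_average ::
  "real \<Rightarrow> (orientation \<times> real \<Rightarrow> real) \<Rightarrow> tile multiset \<Rightarrow> real" where
  "tile_average c f S = (\<Sum>T\<in>#S. f (tile_class c T)) / real (size S)"

definition tile_area_average ::
  "real \<Rightarrow> (orientation \<times> real \<Rightarrow> real) \<Rightarrow> tile multiset \<Rightarrow> real" where
  "tile_area_average c f S =
     (\<Sum>T\<in>#S. tile_area T * f (tile_class c T)) / (\<Sum>T\<in>#S. tile_area T)"


text \<open>The measure \<open>d\<phi> / (4 * pi)\<close> on each of the two copies of the circle.\<close>

definition orientation_measure :: "orientation measure" where
  "orientation_measure = count_space UNIV \<Otimes>\<^sub>M
     distr (density lborel (\<lambda>\<phi>. ennreal (indicator {0..<2 * pi} \<phi> / (4 * pi)))) borel cis"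

definition unit_step :: "real \<Rightarrow> real" where
  "unit_step x = (if 0 \<le> x then 1 else 0)"

definition tile_nu :: "real \<Rightarrow> real \<Rightarrow> real \<Rightarrow> (orientation \<times> real) measure" where
  "tile_nu a b c =
     density (restrict_space (orientation_measure \<Otimes>\<^sub>M lborel) (tile_space a b c))
       (\<lambda>(\<Omega>, s). ennreal (exp (2 * s) *
          (a\<^sup>2 * unit_step (size_alpha a c - s) + b\<^sup>2 * unit_step (size_beta b c - s)) / (2 * c\<^sup>2)))"

definition tile_rho :: "real \<Rightarrow> real \<Rightarrow> real \<Rightarrow> (orientation \<times> real) measure" where
  "tile_rho a b c =
     density (tile_nu a b c)
       (\<lambda>(\<Omega>, s). ennreal (2 * c\<^sup>2 * exp (- 2 * s) / (a\<^sup>2 * size_alpha a c + b\<^sup>2 * size_beta b c)))"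

end

(* Weighting tiles by area turns the repeated subdivision of a supertile into a random walk: the
   size parameter grows by alpha with probability a^2/c^2 and by beta with probability b^2/c^2,
   while the orientation is turned by theta or -theta, depending on the handedness, up to a rotation
   by multiples of pi/2 and a flip. Area-weighted averages of f over a supertile are expectations of
   f at the first non-negative size. For functions of the size alone this is the overshoot of a
   two-step walk, and a renewal theorem applies because alpha/beta is irrational. For the functions
   w^k of the direction w (k > 0), averaging over the five daughters contracts, since theta is an
   irrational multiple of pi; the handedness is mixed after a single step of size beta. Products of
   modes and intervals of sizes yield all test functions by the Stone-Weierstrass theorem and
   sandwiching. Averages with equal weights are quotients of area-weighted ones, with the additional
   weight exp (2 s). *)

theory Submission
  imports Defs
begin


text \<open>The walk describes supertiles exactly: replacing a tile of negative size by its
  daughters preserves the area-weighted sum of predicted values, so the order of subdivision is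
  irrelevant. The obstacle in the renewal theorem is that overshoot probabilities jump as functions
  of the start, while the convergence argument for functions harmonic along the walk needs uniform
  continuity. It is applied to an integrated version, and monotonicity recovers the probabilities
  from difference quotients. For the modes, odd k allow cancellation within one step; for even k one
  step alone gives no bound below 1, and two steps have to be combined. Supertiles may have any
  orientation, so every limit is uniform in it. Rotating the parent multiplies a mode by a number of
  modulus 1, which makes uniformity in the direction automatic. As sizes range over a half-open
  interval, a bounded continuous function may oscillate near \<mu>; the sizes close to \<mu> are cut
  off because they carry little mass. Boundaries of rectangles do no harm, since the limit measures
  charge neither single sizes nor single directions.\<close>

section \<open>A renewal theorem for walks with two incommensurable steps\<close>

lemma small_combination:
  fixes x y e :: real
  assumes "0 < x" "0 < y" "x / y \<notin> \<rat>" "0 < e"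
  obtains i j :: nat where "real i * x - real j * y \<noteq> 0" "\<bar>real i * x - real j * y\<bar> < e"
proof -
  obtain N :: nat where N: "y / e < real N" using reals_Archimedean2 by blast
  then have "0 < N" using assms by (metis divide_pos_pos gr0I less_asym of_nat_0)
  \<comment> \<open>Dirichlet's approximation of \<open>x / y\<close>: as N exceeds y / e, the error
    1 / N becomes less than e after multiplication by y.\<close>
  then obtain h k where hk: "0 < k" "k \<le> int N" "\<bar>of_int k * (x / y) - of_int h\<bar> < 1 / real N"
    using Dirichlet_approx[of N "x / y"] by blast
  have "0 < of_int k * (x / y)" using hk assms by simp
  moreover have "1 / real N \<le> 1" using \<open>0 < N\<close> by simp
  ultimately have "- 1 < real_of_int h" using hk(3) by linarith
  then have h: "0 \<le> h" by simp
  have ne: "of_int k * (x / y) - of_int h \<noteq> 0"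
  proof
    assume "of_int k * (x / y) - of_int h = 0"
    then have "x / y = of_int h / of_int k" using hk(1) by (simp add: field_simps)
    then show False using assms(3) by (metis Rats_divide Rats_of_int)
  qed
  have eq: "real (nat k) * x - real (nat h) * y = y * (of_int k * (x / y) - of_int h)"
    using hk(1) h assms by (simp add: field_simps)
  show ?thesis
  proof
    show "real (nat k) * x - real (nat h) * y \<noteq> 0" unfolding eq using ne assms by simp
    have "\<bar>y * (of_int k * (x / y) - of_int h)\<bar> < y * (1 / real N)"
      using mult_strict_left_mono[OF hk(3) assms(2)] assms(2) by (simp only: abs_mult abs_of_pos)
    also have "\<dots> < e" using N assms \<open>0 < N\<close> by (simp add: field_simps)
    finally show "\<bar>real (nat k) * x - real (nat h) * y\<bar> < e" unfolding eq .
  qed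
qed

text \<open>Beyond N * j * y there are N * j copies of y in reserve. Trading j copies of y for i
  copies of x raises the sum by d = i x - j y < e, and at most N \<ge> y / d trades close a gap
  shorter than y.\<close>

lemma combinations_dense_aux:
  fixes x y e :: real
  assumes "0 < x" "0 < y" and d: "0 < real i * x - real j * y" "real i * x - real j * y < e"
  shows "\<exists>X\<ge>0. \<forall>t\<ge>X. \<exists>k l :: nat. \<bar>t - (real k * x + real l * y)\<bar> < e"
proof -
  define d where "d = real i * x - real j * y"
  define N where "N = nat \<lceil>y / d\<rceil>"
  have N: "y / d \<le> real N" unfolding N_def by linarith
  have "\<exists>k l :: nat. \<bar>t - (real k * x + real l * y)\<bar> < e" if t: "real N * j * y \<le> t" for t
  proof -
    define z where "z = t - real N * j * y"
    define m where "m = nat \<lfloor>z / y\<rfloor>"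
    define r where "r = z - m * y"
    define n where "n = nat \<lfloor>r / d\<rfloor>"
    have "0 \<le> z / y" using t assms by (simp add: z_def)
    then have "real m \<le> z / y" "z / y < real m + 1" unfolding m_def by linarith+
    then have r: "0 \<le> r" "r < y" using assms by (simp_all add: r_def field_simps)
    have "0 \<le> r / d" using r d by (simp add: d_def)
    then have n: "real n \<le> r / d" "r / d < real n + 1" unfolding n_def by linarith+
    then have n': "real n * d \<le> r" "r < real n * d + d" using d by (simp_all add: d_def field_simps)
    have "real n < y / d" using n(1) r(2) d by (smt (verit) d_def divide_strict_right_mono)
    then have "n \<le> N" using N by linarith
    have "t - (real (n * i) * x + real ((N - n) * j + m) * y) = r - real n * d"
    proof -
      have "(N - n) * j + n * j = N * j" using \<open>n \<le> N\<close> by (simp flip: distrib_right)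
      then have "real ((N - n) * j) + real n * real j = real N * real j" by (metis of_nat_add of_nat_mult)
      then have "real ((N - n) * j) = real N * real j - real n * real j" by linarith
      then have "real (n * i) * x + real ((N - n) * j + m) * y
          = real n * real i * x + (real N * real j - real n * real j + real m) * y"
        by (simp only: of_nat_add of_nat_mult[of n i])
      then show ?thesis by (simp add: r_def z_def d_def algebra_simps)
    qed
    then have "\<bar>t - (real (n * i) * x + real ((N - n) * j + m) * y)\<bar> < e"
      using n' d by (simp add: d_def)
    then show ?thesis by blast
  qed
  moreover have "0 \<le> real N * j * y" using assms by simp
  ultimately show ?thesis by blast
qed

lemma combinations_dense:
  fixes x y e :: real
  assumes "0 < x" "0 < y" "x / y \<notin> \<rat>" "0 < e"
  shows "\<exists>X\<ge>0. \<forall>t\<ge>X. \<exists>k l :: nat. \<bar>t - (real k * x + real l * y)\<bar> < e"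
proof -
  obtain i j where ij: "real i * x - real j * y \<noteq> 0" "\<bar>real i * x - real j * y\<bar> < e"
    using small_combination[OF assms] .
  show ?thesis
  proof (cases "0 < real i * x - real j * y")
    case True
    then show ?thesis using combinations_dense_aux[of x y i j e] assms ij by auto
  next
    case False
    then have "\<exists>X\<ge>0. \<forall>t\<ge>X. \<exists>k l :: nat. \<bar>t - (real k * y + real l * x)\<bar> < e"
      using combinations_dense_aux[of y x j i e] assms ij by auto
    then show ?thesis by (metis add.commute)
  qed
qed

section \<open>Functions harmonic along the two-step walk\<close>

locale renewal =
  fixes p q \<alpha> \<beta> :: real
  assumes p_pos: "0 < p" and q_pos: "0 < q" and pq: "p + q = 1"
    and \<alpha>_pos: "0 < \<alpha>" and \<beta>_pos: "0 < \<beta>"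
begin

definition "\<mu> = max \<alpha> \<beta>"
definition "\<kappa> = min \<alpha> \<beta>"

lemma \<kappa>: "0 < \<kappa>" "\<kappa> \<le> \<alpha>" "\<kappa> \<le> \<beta>" and \<mu>: "\<alpha> \<le> \<mu>" "\<beta> \<le> \<mu>" "0 < \<mu>"
  using \<alpha>_pos \<beta>_pos by (auto simp: \<mu>_def \<kappa>_def)

text \<open>Both predecessors of x lie at least \<kappa> below x, so finitely many steps lead to
  points up to z.\<close>

lemma walk_induct [case_names base step]:
  assumes base: "\<And>x. x \<le> z \<Longrightarrow> P x" and step: "\<And>x. z < x \<Longrightarrow> P (x - \<alpha>) \<Longrightarrow> P (x - \<beta>) \<Longrightarrow> P x"
  shows "P x"
proof -
  have "x \<le> z + real n * \<kappa> \<Longrightarrow> P x" for n x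
  proof (induction n arbitrary: x)
    case 0
    then show ?case using base by simp
  next
    case (Suc n)
    show ?case
    proof (cases "x \<le> z")
      case False
      then show ?thesis
        using Suc.prems \<kappa> by (intro step[OF _ Suc.IH Suc.IH]) (auto simp: algebra_simps)
    qed (use base in auto)
  qed
  moreover obtain n :: nat where "(x - z) / \<kappa> < real n" using reals_Archimedean2 by blast
  then have "x \<le> z + real n * \<kappa>" using \<kappa> by (simp add: field_simps)
  ultimately show ?thesis by blast
qed

lemma combine: "p * x + q * x = x"
  using pq by (metis distrib_right mult_1)

lemma combine_mono: "x \<le> x' \<Longrightarrow> y \<le> y' \<Longrightarrow> p * x + q * y \<le> p * x' + q * y'"
  using p_pos q_pos by (intro add_mono mult_left_mono) auto

definition harmonic_from :: "real \<Rightarrow> (real \<Rightarrow> real) \<Rightarrow> bool" where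
  "harmonic_from z D \<longleftrightarrow> (\<forall>x>z. D x = p * D (x - \<alpha>) + q * D (x - \<beta>))"

lemma harmonic_fromD: "harmonic_from z D \<Longrightarrow> z < x \<Longrightarrow> D x = p * D (x - \<alpha>) + q * D (x - \<beta>)"
  by (simp add: harmonic_from_def)

text \<open>The comparison principle: averages of ordered values are ordered. A walk from above z
  first enters the half-line up to z within the window of length \<mu> below z, so estimates have to
  be checked on that window only.\<close>

lemma harmonic_le:
  assumes "harmonic_from z D" "harmonic_from z E"
    and base: "\<And>x. z - \<mu> < x \<Longrightarrow> x \<le> z \<Longrightarrow> D x \<le> E x"
    and "z - \<mu> < x"
  shows "D x \<le> E x"
proof -
  have "z - \<mu> < x \<longrightarrow> D x \<le> E x"
  proof (induction x rule: walk_induct[of z])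
    case (base x)
    then show ?case using assms(3) by simp
  next
    case (step x)
    then have "D (x - \<alpha>) \<le> E (x - \<alpha>)" "D (x - \<beta>) \<le> E (x - \<beta>)" using \<mu> by auto
    from combine_mono[OF this] show ?case
      using step(1) harmonic_fromD[OF assms(1)] harmonic_fromD[OF assms(2)] by simp
  qed
  then show ?thesis using assms(4) by blast
qed

lemma harmonic_const [simp]: "harmonic_from z (\<lambda>_. m)"
  by (simp add: harmonic_from_def combine)

lemma harmonic_mono: "harmonic_from z D \<Longrightarrow> z \<le> z' \<Longrightarrow> harmonic_from z' D"
  by (auto simp: harmonic_from_def)

text \<open>At a point where a harmonic function is close to its limit superior, both of its predecessors
  are close to it as well, because the values averaged cannot exceed the supremum by much.\<close>

lemma near_sup_step:
  fixes D D1 D2 :: real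
  assumes eq: "D = p' * D1 + q' * D2" and pq': "p' + q' = 1" "0 < r" "r \<le> p'" "0 \<le> q'"
    and le: "D2 \<le> L + \<eta>" and ge: "L - \<eta> \<le> D" and "0 \<le> \<eta>"
  shows "L - 2 / r * \<eta> \<le> D1"
proof -
  have "q' * D2 \<le> q' * (L + \<eta>)" using le pq' by (intro mult_left_mono) auto
  then have "L - \<eta> - q' * (L + \<eta>) \<le> p' * D1" using eq ge by linarith
  moreover have "L - \<eta> - q' * (L + \<eta>) = p' * L - (1 + q') * \<eta>"
  proof -
    have "p' = 1 - q'" using pq'(1) by linarith
    then show ?thesis by (simp only: left_diff_distrib distrib_right distrib_left mult_1 mult_1_right)
  qed
  moreover have "(1 + q') * \<eta> \<le> 2 * \<eta>" using assms by (intro mult_right_mono) auto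
  ultimately have "p' * L - 2 * \<eta> \<le> p' * D1" by linarith
  moreover have "2 * \<eta> \<le> p' * (2 / r * \<eta>)"
    using mult_right_mono[OF \<open>r \<le> p'\<close>, of "2 / r * \<eta>"] assms by simp
  ultimately have "p' * (L - 2 / r * \<eta>) \<le> p' * D1" by (simp only: right_diff_distrib)
  then show ?thesis using assms by (simp only: mult_le_cancel_left_pos)
qed

text \<open>Iterates the one-step estimate; every step multiplies the defect by at most 2 / min p q.
  The margin \<mu> keeps both predecessors of every point on the way inside the region where the
  upper bound holds.\<close>

lemma harmonic_near_sup:
  assumes D: "harmonic_from z D" and le: "\<And>x. X \<le> x \<Longrightarrow> D x \<le> L + \<delta>" and \<delta>: "0 \<le> \<delta>"
    and x: "z \<le> X" "X + real i * \<alpha> + real j * \<beta> + \<mu> < x" and Dx: "L - \<delta> \<le> D x"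
  shows "L - (2 / min p q) ^ (i + j) * \<delta> \<le> D (x - real i * \<alpha> - real j * \<beta>)"
proof -
  define r where "r = min p q"
  have r: "0 < r" "r \<le> p" "r \<le> q" "r \<le> 1" using p_pos q_pos pq by (auto simp: r_def)
  have grow: "\<delta> \<le> (2 / r) ^ n * \<delta>" for n
  proof -
    have "1 \<le> (2 / r) ^ n" using r by (intro one_le_power) simp
    from mult_right_mono[OF this \<delta>] show ?thesis by simp
  qed
  have step: "L - (2 / r) ^ Suc n * \<delta> \<le> D (y - \<alpha>)" "L - (2 / r) ^ Suc n * \<delta> \<le> D (y - \<beta>)"
    if y: "X + \<mu> < y" "L - (2 / r) ^ n * \<delta> \<le> D y" for y n
  proof -
    have eq: "D y = p * D (y - \<alpha>) + q * D (y - \<beta>)"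
      using y x \<mu> by (intro harmonic_fromD[OF D]) simp
    have up: "D (y - \<alpha>) \<le> L + (2 / r) ^ n * \<delta>" "D (y - \<beta>) \<le> L + (2 / r) ^ n * \<delta>"
      using le[of "y - \<alpha>"] le[of "y - \<beta>"] y \<mu> grow[of n] by auto
    show "L - (2 / r) ^ Suc n * \<delta> \<le> D (y - \<alpha>)"
      using near_sup_step[OF eq pq r(1,2) _ up(2) y(2)] grow[of n] \<delta> q_pos by (simp add: mult.assoc)
    show "L - (2 / r) ^ Suc n * \<delta> \<le> D (y - \<beta>)"
      using near_sup_step[of "D y" q "D (y - \<beta>)" p "D (y - \<alpha>)" r L, OF _ _ r(1,3) _ up(1) y(2)]
        eq pq grow[of n] \<delta> p_pos by (simp add: mult.assoc)
  qed
  have i: "L - (2 / r) ^ i * \<delta> \<le> D (x - real i * \<alpha>)" if "X + real i * \<alpha> + \<mu> < x" for i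
    using that
  proof (induction i)
    case (Suc i)
    then have "L - (2 / r) ^ Suc i * \<delta> \<le> D (x - real i * \<alpha> - \<alpha>)"
      using \<alpha>_pos by (intro step Suc.IH) (auto simp: algebra_simps)
    then show ?case by (simp add: algebra_simps)
  qed (use Dx in simp)
  have "L - (2 / r) ^ (i + j) * \<delta> \<le> D (x - real i * \<alpha> - real j * \<beta>)"
    using x(2)
  proof (induction j)
    case 0
    then show ?case using i by simp
  next
    case (Suc j)
    then have "L - (2 / r) ^ Suc (i + j) * \<delta> \<le> D (x - real i * \<alpha> - real j * \<beta> - \<beta>)"
      using \<beta>_pos by (intro step Suc.IH) (auto simp: algebra_simps)
    then show ?case by (simp add: algebra_simps)
  qed
  then show ?thesis by (simp add: r_def)
qed

text \<open>Let L be the limit superior. Far out some value is close to L, hence so are the values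
  at all points that a bounded number of steps leads to. By irrationality these points are dense in
  a window of length \<mu>, uniform continuity fills the gaps between them, and the comparison
  principle carries the lower bound to everything on the right. So the limit inferior is L as
  well.\<close>

lemma harmonic_convergent:
  assumes irr: "\<alpha> / \<beta> \<notin> \<rat>" and D: "harmonic_from 0 D"
    and bdd: "\<And>x. - \<mu> < x \<Longrightarrow> x \<le> 0 \<Longrightarrow> \<bar>D x\<bar> \<le> B"
    and unif: "\<And>e. 0 < e \<Longrightarrow> \<exists>d>0. \<forall>x\<ge>0. \<forall>y\<ge>0. \<bar>x - y\<bar> < d \<longrightarrow> \<bar>D x - D y\<bar> < e"
  shows "\<exists>L. (D \<longlongrightarrow> L) at_top"
proof -
  have "D x \<le> B" "- B \<le> D x" if "0 \<le> x" for x
  proof -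
    have "- \<mu> < x" using that \<mu> by simp
    then show "D x \<le> B" using harmonic_le[OF D harmonic_const[of 0 B], of x] bdd by force
    show "- B \<le> D x" using harmonic_le[OF harmonic_const[of 0 "- B"] D, of x] bdd \<open>- \<mu> < x\<close> by force
  qed
  then have bound: "\<bar>D x\<bar> \<le> B" if "0 \<le> x" for x using that by (simp add: abs_le_iff minus_le_iff)
  define M where "M X = Sup (D ` {X..})" for X
  define L where "L = Inf (M ` {0..})"
  have bddD: "bdd_above (D ` {X..})" if "0 \<le> X" for X
    using bound that by (intro bdd_aboveI[of _ B]) (force simp: abs_le_iff)
  have DM: "D x \<le> M X" if "0 \<le> X" "X \<le> x" for x X
    unfolding M_def using bddD that by (intro cSup_upper) auto
  have bddM: "bdd_below (M ` {0..})"
  proof (rule bdd_belowI2)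
    fix X :: real assume "X \<in> {0..}"
    then show "- B \<le> M X" using DM[of X X] bound[of X] by (simp add: abs_le_iff)
  qed
  have upper: "\<exists>X\<ge>0. \<forall>x\<ge>X. D x \<le> L + \<delta>" if "0 < \<delta>" for \<delta>
  proof -
    have "Inf (M ` {0..}) < L + \<delta>" using that by (simp add: L_def)
    then obtain X where "0 \<le> X" "M X < L + \<delta>"
      using bddM by (subst (asm) cInf_less_iff) auto
    then show ?thesis using DM by (meson less_imp_le order_trans)
  qed
  have freq: "\<exists>x\<ge>X. L - \<delta> \<le> D x" if "0 < \<delta>" "0 \<le> X" for \<delta> X
  proof -
    have "L \<le> M X" unfolding L_def using that bddM by (intro cInf_lower) auto
    then have "L - \<delta> < Sup (D ` {X..})" using that unfolding M_def by linarith
    then show ?thesis using bddD that by (subst (asm) less_cSup_iff) force+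
  qed
  have lower: "\<exists>Y. \<forall>y\<ge>Y. L - 2 * e \<le> D y" if e: "0 < e" for e
  proof -
    obtain d where d: "0 < d" "\<And>x y. 0 \<le> x \<Longrightarrow> 0 \<le> y \<Longrightarrow> \<bar>x - y\<bar> < d \<Longrightarrow> \<bar>D x - D y\<bar> < e"
      using unif[OF e] by blast
    obtain X where X: "0 \<le> X" "\<And>t. X \<le> t \<Longrightarrow> \<exists>k l :: nat. \<bar>t - (real k * \<alpha> + real l * \<beta>)\<bar> < d"
      using combinations_dense[OF \<alpha>_pos \<beta>_pos irr d(1)] by blast
    define W where "W = X + \<mu> + d"
    define N where "N = nat \<lceil>W / \<kappa>\<rceil>"
    have rpos: "0 < min p q" using p_pos q_pos by simp
    have r2: "1 \<le> 2 / min p q" using pq p_pos q_pos rpos by (simp add: le_divide_eq)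
    \<comment> \<open>At most N steps lead from \<open>x\<close> into the window, because their
      total length stays below W; a defect \<delta> at \<open>x\<close> has then grown to at most
      e.\<close>
    define \<delta> where "\<delta> = e / (2 / min p q) ^ N"
    have \<delta>: "0 < \<delta>" "(2 / min p q) ^ N * \<delta> = e" using e rpos by (auto simp: \<delta>_def)
    obtain X1 where X1: "0 \<le> X1" "\<And>x. X1 \<le> x \<Longrightarrow> D x \<le> L + \<delta>" using upper[OF \<delta>(1)] by blast
    define X2 where "X2 = X1 + W + \<mu> + 1"
    have "0 \<le> X2" using X1 X d \<mu> by (simp add: X2_def W_def)
    then obtain x where x: "X2 \<le> x" "L - \<delta> \<le> D x" using freq \<delta>(1) by blast
    have window: "L - 2 * e \<le> D y" if y: "x - X - \<mu> < y" "y \<le> x - X" for y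
    proof -
      obtain k l where kl: "\<bar>(x - y) - (real k * \<alpha> + real l * \<beta>)\<bar> < d" using X(2)[of "x - y"] y by auto
      then have sum: "real k * \<alpha> + real l * \<beta> < W" using y by (simp add: W_def)
      have "(real k + real l) * \<kappa> \<le> real k * \<alpha> + real l * \<beta>"
        unfolding distrib_right using \<kappa> by (intro add_mono mult_left_mono) auto
      then have "(real k + real l) * \<kappa> < W" using sum by simp
      then have "real k + real l \<le> W / \<kappa>" using \<kappa> by (simp add: field_simps)
      then have "k + l \<le> N" unfolding N_def by linarith
      then have "(2 / min p q) ^ (k + l) \<le> (2 / min p q) ^ N" using r2 by (rule power_increasing)
      then have "(2 / min p q) ^ (k + l) * \<delta> \<le> e"
        using \<delta> by (metis less_imp_le mult_right_mono)
      moreover have "L - (2 / min p q) ^ (k + l) * \<delta> \<le> D (x - real k * \<alpha> - real l * \<beta>)"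
        using \<delta> X1 x sum by (intro harmonic_near_sup[OF D X1(2)]) (auto simp: X2_def)
      moreover have "\<bar>D y - D (x - real k * \<alpha> - real l * \<beta>)\<bar> < e"
        using kl y x X1 sum X \<mu> d by (intro d(2)) (auto simp: X2_def W_def)
      ultimately show ?thesis by linarith
    qed
    have "0 \<le> x - X" using x X X1 \<mu> d(1) by (simp add: X2_def W_def)
    then have "harmonic_from (x - X) D" using D harmonic_mono by blast
    then have "L - 2 * e \<le> D y" if "x - X \<le> y" for y
      using harmonic_le[OF harmonic_const, of "x - X" D "L - 2 * e" y] window that \<mu> by auto
    then show ?thesis by blast
  qed
  have "(D \<longlongrightarrow> L) at_top"
  proof (rule tendstoI)
    fix e :: real assume "0 < e"
    then obtain X Y where *: "\<forall>x\<ge>X. D x \<le> L + e / 3" "\<forall>y\<ge>Y. L - 2 * (e / 3) \<le> D y"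
      using upper[of "e / 3"] lower[of "e / 3"] by auto
    then have "\<bar>D x - L\<bar> < e" if "max X Y \<le> x" for x
    proof -
      have "D x \<le> L + e / 3" "L - 2 * (e / 3) \<le> D x" using * that by auto
      then show ?thesis using \<open>0 < e\<close> by (simp only: abs_less_iff) linarith
    qed
    then have "\<forall>x\<ge>max X Y. dist (D x) L < e" by (simp add: dist_real_def)
    then show "\<forall>\<^sub>F x in at_top. dist (D x) L < e" unfolding eventually_at_top_linorder by blast
  qed
  then show ?thesis ..
qed


section \<open>The overshoot over zero and its limit law\<close>

function overshoot :: "(real \<Rightarrow> real) \<Rightarrow> real \<Rightarrow> real" where
  "overshoot g x = (if x \<le> 0 then g (- x)
     else p * overshoot g (x - \<alpha>) + q * overshoot g (x - \<beta>))"
  by pat_completeness auto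
termination
proof (relation "Wellfounded.measure (\<lambda>(g, x). nat \<lceil>x / \<kappa>\<rceil>)")
  fix g :: "real \<Rightarrow> real" and x :: real
  assume "\<not> x \<le> 0"
  have "nat \<lceil>(x - d) / \<kappa>\<rceil> < nat \<lceil>x / \<kappa>\<rceil>" if "\<kappa> \<le> d" for d
  proof -
    have "(x - d) / \<kappa> \<le> x / \<kappa> - 1" using that \<kappa> by (simp add: field_simps)
    moreover have "0 < x / \<kappa>" using \<kappa> \<open>\<not> x \<le> 0\<close> by simp
    ultimately show ?thesis by linarith
  qed
  then show "((g, x - \<alpha>), g, x) \<in> Wellfounded.measure (\<lambda>(g, x). nat \<lceil>x / \<kappa>\<rceil>)"
    "((g, x - \<beta>), g, x) \<in> Wellfounded.measure (\<lambda>(g, x). nat \<lceil>x / \<kappa>\<rceil>)"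
    using \<kappa> by auto
qed auto

declare overshoot.simps [simp del]

lemma overshoot_base [simp]: "x \<le> 0 \<Longrightarrow> overshoot g x = g (- x)"
  by (simp add: overshoot.simps)

lemma overshoot_rec:
  "0 < x \<Longrightarrow> overshoot g x = p * overshoot g (x - \<alpha>) + q * overshoot g (x - \<beta>)"
  using overshoot.simps[of g x] by auto

lemma overshoot_harmonic: "harmonic_from 0 (overshoot g)"
  by (simp add: harmonic_from_def overshoot_rec)

lemma overshoot_mono:
  assumes "\<And>s. 0 \<le> s \<Longrightarrow> s < \<mu> \<Longrightarrow> g s \<le> h s" and "0 < x"
  shows "overshoot g x \<le> overshoot h x"
proof (rule harmonic_le[OF overshoot_harmonic overshoot_harmonic])
  show "overshoot g x \<le> overshoot h x" if "0 - \<mu> < x" "x \<le> 0" for x using assms that by simp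
qed (use assms \<mu> in auto)

lemma overshoot_const: "overshoot (\<lambda>_. m) x = m"
  by (induction x rule: walk_induct[of 0]) (simp_all add: overshoot_rec combine)

text \<open>The tail of the stationary excess law: for a random step Y, equal to \<alpha> with
  probability p and to \<beta> with probability q, it is the mean of the positive part of Y - u
  divided by the mean of Y.\<close>

definition tail_limit :: "real \<Rightarrow> real" where
  "tail_limit u = (p * max 0 (\<alpha> - u) + q * max 0 (\<beta> - u)) / (p * \<alpha> + q * \<beta>)"

definition tail :: "real \<Rightarrow> real \<Rightarrow> real" where
  "tail u s = (if u < s then 1 else 0)"

lemma mean_pos: "0 < p * \<alpha> + q * \<beta>"
  using p_pos q_pos \<alpha>_pos \<beta>_pos by (intro add_pos_pos mult_pos_pos)

text \<open>The integral of \<open>overshoot (tail u)\<close>, corrected by a linear function so that it becomes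
  harmonic. It is uniformly continuous, whereas \<open>overshoot (tail u)\<close> has jumps; its increments
  over a short distance squeeze the latter.\<close>

definition potential :: "real \<Rightarrow> real \<Rightarrow> real" where
  "potential u = overshoot (\<lambda>s. tail_limit u * s - max 0 (s - u))"

text \<open>For non-negative u and d this is the integral of \<open>overshoot (tail u)\<close> from
  x to x + d; the last summand undoes the linear correction in the potential.\<close>

definition increment :: "real \<Rightarrow> real \<Rightarrow> real \<Rightarrow> real" where
  "increment u d x = potential u (x + d) - potential u x + tail_limit u * d"

lemma increment_harmonic: "0 \<le> d \<Longrightarrow> harmonic_from 0 (increment u d)"
  unfolding harmonic_from_def
proof (intro allI impI)
  fix x :: real assume "0 < x" "0 \<le> d"
  have "increment u d x = (p * potential u (x - \<alpha> + d) + q * potential u (x - \<beta> + d))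
      - (p * potential u (x - \<alpha>) + q * potential u (x - \<beta>)) + tail_limit u * d"
    using \<open>0 < x\<close> \<open>0 \<le> d\<close> overshoot_rec[of "x + d"] overshoot_rec[of x]
    by (simp add: increment_def potential_def algebra_simps)
  moreover have "tail_limit u * d = p * (tail_limit u * d) + q * (tail_limit u * d)" by (simp only: combine)
  ultimately show "increment u d x = p * increment u d (x - \<alpha>) + q * increment u d (x - \<beta>)"
    unfolding increment_def right_diff_distrib distrib_left by linarith
qed

lemma increment_left:
  "x \<le> - d \<Longrightarrow> 0 \<le> d \<Longrightarrow> increment u d x = max 0 (- x - u) - max 0 (- x - d - u)"
  by (simp add: increment_def potential_def algebra_simps)

text \<open>The interval from x to x + d straddles 0, and d < \<kappa> ensures that one step returns
  to non-positive points. The constant \<open>tail_limit u\<close> drops out of the result: for u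
  \<ge> 0 it is the one slope that makes the potential continuous at 0.\<close>

lemma increment_right:
  assumes "- d < x" "x \<le> 0" "d < \<kappa>"
  shows "increment u d x =
    p * (max 0 (\<alpha> - u) - max 0 (\<alpha> - (x + d) - u)) + q * (max 0 (\<beta> - u) - max 0 (\<beta> - (x + d) - u))
      + max 0 (- x - u)"
proof -
  define e where "e = x + d"
  have e: "0 < e" "e < \<alpha>" "e < \<beta>" using assms \<kappa> by (auto simp: e_def)
  have lim: "tail_limit u * (p * \<alpha> + q * \<beta>) = p * max 0 (\<alpha> - u) + q * max 0 (\<beta> - u)"
    using mean_pos by (simp add: tail_limit_def)
  have "potential u e = p * (tail_limit u * (\<alpha> - e) - max 0 (\<alpha> - e - u))
      + q * (tail_limit u * (\<beta> - e) - max 0 (\<beta> - e - u))"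
    using e by (simp add: potential_def overshoot_rec)
  also have "\<dots> = tail_limit u * (p * \<alpha> + q * \<beta>) - (p * (tail_limit u * e) + q * (tail_limit u * e))
      - p * max 0 (\<alpha> - e - u) - q * max 0 (\<beta> - e - u)"
    by (simp add: algebra_simps)
  finally have "potential u e = p * max 0 (\<alpha> - u) + q * max 0 (\<beta> - u) - tail_limit u * e
      - p * max 0 (\<alpha> - e - u) - q * max 0 (\<beta> - e - u)"
    by (simp only: lim combine)
  moreover have "potential u x = tail_limit u * (- x) - max 0 (- x - u)"
    using assms by (simp add: potential_def)
  ultimately have "increment u d x = p * max 0 (\<alpha> - u) + q * max 0 (\<beta> - u) - tail_limit u * e
      - p * max 0 (\<alpha> - e - u) - q * max 0 (\<beta> - e - u) + tail_limit u * x + max 0 (- x - u) + tail_limit u * d"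
    by (simp add: increment_def e_def)
  then show ?thesis unfolding e_def by (simp add: algebra_simps)
qed

text \<open>These are the bounds for an integral of probabilities over a length d. By the comparison
  principle only starts x \<le> 0 need a computation.\<close>

lemma increment_bounds:
  assumes "0 \<le> u" "0 < d" "d < \<kappa>" "- \<mu> < x"
  shows "0 \<le> increment u d x" "increment u d x \<le> d"
proof -
  have "0 \<le> increment u d x \<and> increment u d x \<le> d" if "x \<le> 0" for x
  proof (cases "x \<le> - d")
    case True
    then show ?thesis using assms by (simp add: increment_left max_def)
  next
    case False
    define e where "e = x + d"
    have e: "0 < e" "e \<le> d" using False that by (auto simp: e_def)
    have A: "0 \<le> max 0 (y - u) - max 0 (y - e - u)" "max 0 (y - u) - max 0 (y - e - u) \<le> e" for y
      using e by (auto simp: max_def)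
    have "p * 0 + q * 0 \<le> p * (max 0 (\<alpha> - u) - max 0 (\<alpha> - e - u)) + q * (max 0 (\<beta> - u) - max 0 (\<beta> - e - u))"
      "p * (max 0 (\<alpha> - u) - max 0 (\<alpha> - e - u)) + q * (max 0 (\<beta> - u) - max 0 (\<beta> - e - u)) \<le> p * e + q * e"
      by (intro combine_mono A)+
    moreover have "max 0 (- x - u) \<le> d - e" using assms that by (simp add: e_def)
    moreover have "0 \<le> max 0 (- x - u)" by simp
    moreover have "increment u d x = p * (max 0 (\<alpha> - u) - max 0 (\<alpha> - e - u))
        + q * (max 0 (\<beta> - u) - max 0 (\<beta> - e - u)) + max 0 (- x - u)"
      using increment_right[of d x u] False that assms by (simp flip: e_def)
    ultimately show ?thesis unfolding combine by linarith
  qed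
  then have base: "0 \<le> increment u d x" "increment u d x \<le> d" if "x \<le> 0" for x using that by auto
  show "0 \<le> increment u d x"
    by (rule harmonic_le[OF harmonic_const increment_harmonic]) (use assms base in auto)
  show "increment u d x \<le> d"
    by (rule harmonic_le[OF increment_harmonic harmonic_const]) (use assms base in auto)
qed

lemma harmonic_scale: "harmonic_from z D \<Longrightarrow> harmonic_from z (\<lambda>x. m * D x)"
  unfolding harmonic_from_def by (simp add: algebra_simps)

text \<open>If x lies below - u - d, the whole interval from x to x + d lies below - u and
  contributes its full length d. This settles the starts x \<le> 0, and harmonicity does the
  rest.\<close>

lemma increment_lower:
  assumes "0 \<le> u" "0 < d" "d < \<kappa>" "- \<mu> < x"
  shows "d * overshoot (tail (u + d)) x \<le> increment u d x"
proof (rule harmonic_le[OF harmonic_scale[OF overshoot_harmonic] increment_harmonic])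
  fix x assume x: "0 - \<mu> < x" "x \<le> 0"
  show "d * overshoot (tail (u + d)) x \<le> increment u d x"
  proof (cases "u + d < - x")
    case True
    then show ?thesis using x assms by (simp add: tail_def increment_left)
  next
    case False
    then show ?thesis using x assms increment_bounds[of u d x] by (simp add: tail_def)
  qed
qed (use assms in auto)

text \<open>The right end of the interval is within d of each of its points, so it overshoots u - d
  whenever one of them overshoots u. If the interval straddles 0, this is applied after one step.
  The shift by d keeps the right-hand side harmonic.\<close>

lemma increment_upper:
  assumes "d \<le> u" "0 < d" "d < \<kappa>" "- \<mu> < x"
  shows "increment u d x \<le> d * overshoot (tail (u - d)) (x + d)"
proof (rule harmonic_le[OF increment_harmonic])
  show "harmonic_from 0 (\<lambda>x. d * overshoot (tail (u - d)) (x + d))"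
    unfolding harmonic_from_def
    using assms by (auto simp: overshoot_rec[of "_ + d"] algebra_simps)
  fix x assume x: "0 - \<mu> < x" "x \<le> 0"
  show "increment u d x \<le> d * overshoot (tail (u - d)) (x + d)"
  proof (cases "x \<le> - d")
    case True
    then show ?thesis using assms by (simp add: increment_left tail_def max_def)
  next
    case False
    define e where "e = x + d"
    have e: "0 < e" "e \<le> d" "e < \<alpha>" "e < \<beta>" using False x assms \<kappa> by (auto simp: e_def)
    have A: "max 0 (y - u) - max 0 (y - e - u) \<le> d * tail (u - d) (y - e)" for y
      using e by (auto simp: max_def tail_def)
    have "d * overshoot (tail (u - d)) e
        = p * (d * tail (u - d) (\<alpha> - e)) + q * (d * tail (u - d) (\<beta> - e))"
      using e by (simp add: overshoot_rec algebra_simps)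
    moreover have "p * (max 0 (\<alpha> - u) - max 0 (\<alpha> - e - u)) + q * (max 0 (\<beta> - u) - max 0 (\<beta> - e - u))
        \<le> p * (d * tail (u - d) (\<alpha> - e)) + q * (d * tail (u - d) (\<beta> - e))"
      by (intro combine_mono A)
    moreover have "max 0 (- x - u) = 0" using False x assms by simp
    ultimately show ?thesis
      using increment_right[of d x u] False x assms by (simp flip: e_def)
  qed
qed (use assms in auto)

lemma tail_limit_nonneg: "0 \<le> tail_limit u"
  using mean_pos p_pos q_pos by (simp add: tail_limit_def)

lemma filterlim_add_const_at_top: "filterlim (\<lambda>x. x + d) at_top at_top" for d :: real
  using filterlim_tendsto_add_at_top[OF tendsto_const[of d] filterlim_ident] by (simp add: add.commute)

text \<open>The bounds on increments make the potential Lipschitz, so it converges. Its unknown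
  limit cancels in the difference, and only the linear term remains.\<close>

lemma increment_tendsto:
  assumes irr: "\<alpha> / \<beta> \<notin> \<rat>" and u: "0 \<le> u" and d: "0 < d" "d < \<kappa>"
  shows "(increment u d \<longlongrightarrow> tail_limit u * d) at_top"
proof -
  define B where "B = 1 + tail_limit u"
  have "0 < B" using tail_limit_nonneg[of u] by (simp add: B_def)
  have lip: "\<bar>potential u x - potential u y\<bar> \<le> B * (x - y)" if "0 \<le> y" "y < x" "x - y < \<kappa>" for x y
  proof -
    have "0 \<le> increment u (x - y) y" "increment u (x - y) y \<le> x - y"
      using increment_bounds[OF u, of "x - y" y] that \<mu> by auto
    moreover have "0 \<le> tail_limit u * (x - y)" using tail_limit_nonneg that by simp
    ultimately show ?thesis by (simp add: increment_def B_def distrib_right)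
  qed
  have "\<exists>L. (potential u \<longlongrightarrow> L) at_top"
  proof (rule harmonic_convergent[OF irr])
    show "harmonic_from 0 (potential u)" unfolding potential_def by (rule overshoot_harmonic)
    show "\<bar>potential u x\<bar> \<le> tail_limit u * \<mu> + \<mu>" if "- \<mu> < x" "x \<le> 0" for x
    proof -
      have "tail_limit u * (- x) \<le> tail_limit u * \<mu>" "0 \<le> tail_limit u * (- x)"
        using that tail_limit_nonneg[of u] mult_left_mono[of "- x" \<mu> "tail_limit u"]
        by (auto intro: mult_nonneg_nonpos)
      moreover have "0 \<le> max 0 (- x - u)" "max 0 (- x - u) \<le> \<mu>" using that u \<mu> by auto
      moreover have "potential u x = tail_limit u * (- x) - max 0 (- x - u)"
        using that by (simp add: potential_def)
      ultimately show ?thesis unfolding abs_le_iff by linarith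
    qed
    fix e :: real assume "0 < e"
    define \<delta> where "\<delta> = min \<kappa> (e / B)"
    have "0 < \<delta>" using \<open>0 < e\<close> \<open>0 < B\<close> \<kappa> by (simp add: \<delta>_def)
    have one: "\<bar>potential u x - potential u y\<bar> < e" if "0 \<le> y" "y < x" "x - y < \<delta>" for x y
    proof -
      have "\<bar>potential u x - potential u y\<bar> \<le> B * (x - y)" using that by (intro lip) (auto simp: \<delta>_def)
      also have "\<dots> < B * (e / B)" using that \<open>0 < B\<close> by (intro mult_strict_left_mono) (auto simp: \<delta>_def)
      finally show ?thesis using \<open>0 < B\<close> by simp
    qed
    have "\<bar>potential u x - potential u y\<bar> < e" if "0 \<le> x" "0 \<le> y" "\<bar>x - y\<bar> < \<delta>" for x y
    proof (cases x y rule: linorder_cases)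
      case less
      then show ?thesis using one[of x y] that by (simp add: abs_minus_commute)
    next
      case greater
      then show ?thesis using one[of y x] that by simp
    qed (use \<open>0 < e\<close> in simp)
    with \<open>0 < \<delta>\<close> show "\<exists>d>0. \<forall>x\<ge>0. \<forall>y\<ge>0. \<bar>x - y\<bar> < d \<longrightarrow> \<bar>potential u x - potential u y\<bar> < e" by blast
  qed
  then obtain L where L: "(potential u \<longlongrightarrow> L) at_top" ..
  have "((\<lambda>x. potential u (x + d)) \<longlongrightarrow> L) at_top"
    by (rule filterlim_compose[OF L filterlim_add_const_at_top])
  with L have "((\<lambda>x. potential u (x + d) - potential u x + tail_limit u * d)
      \<longlongrightarrow> L - L + tail_limit u * d) at_top"
    by (intro tendsto_intros)
  then show ?thesis by (simp add: increment_def[abs_def])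
qed

lemma tail_limit_lipschitz: "0 \<le> d \<Longrightarrow> \<bar>tail_limit (u + d) - tail_limit u\<bar> \<le> d / (p * \<alpha> + q * \<beta>)"
proof -
  assume "0 \<le> d"
  have A: "0 \<le> max 0 (y - u) - max 0 (y - (u + d))" "max 0 (y - u) - max 0 (y - (u + d)) \<le> d" for y
    using \<open>0 \<le> d\<close> by (auto simp: max_def)
  have "p * 0 + q * 0 \<le> p * (max 0 (\<alpha> - u) - max 0 (\<alpha> - (u + d))) + q * (max 0 (\<beta> - u) - max 0 (\<beta> - (u + d)))"
    "p * (max 0 (\<alpha> - u) - max 0 (\<alpha> - (u + d))) + q * (max 0 (\<beta> - u) - max 0 (\<beta> - (u + d))) \<le> p * d + q * d"
    by (intro combine_mono A)+
  then have "\<bar>(p * max 0 (\<alpha> - (u + d)) + q * max 0 (\<beta> - (u + d))) - (p * max 0 (\<alpha> - u) + q * max 0 (\<beta> - u))\<bar> \<le> d"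
    unfolding combine abs_le_iff right_diff_distrib by linarith
  then show ?thesis
    using mean_pos by (simp add: tail_limit_def divide_right_mono flip: diff_divide_distrib)
qed

text \<open>A difference quotient over a distance d determines the tail up to a change of u by d,
  which moves \<open>tail_limit\<close> by at most d / m < e. The upper bound uses increments at u -
  d and therefore asks for u > 0.\<close>

lemma tail_eventually:
  assumes irr: "\<alpha> / \<beta> \<notin> \<rat>" and u: "0 \<le> u" and e: "0 < e"
  shows "\<forall>\<^sub>F x in at_top. tail_limit u - e < overshoot (tail u) x"
    and "0 < u \<Longrightarrow> \<forall>\<^sub>F x in at_top. overshoot (tail u) x < tail_limit u + e"
proof -
  define m where "m = p * \<alpha> + q * \<beta>"
  have m: "0 < m" using mean_pos by (simp add: m_def)
  define d where "d = min (\<kappa> / 2) (e * m / 2)"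
  have d: "0 < d" "d < \<kappa>" "d / m < e" using \<kappa> m e by (auto simp: d_def min_def field_simps)
  \<comment> \<open>\<open>increment_upper\<close> estimates the overshoot at the right end of an
    interval; to obtain it at x, the interval has to start at x - d.\<close>
  have "((\<lambda>x. increment (u + d) d (x - d)) \<longlongrightarrow> tail_limit (u + d) * d) at_top"
    using filterlim_compose[OF increment_tendsto[OF irr, of "u + d" d] filterlim_add_const_at_top[of "- d"]] d u
    by simp
  moreover have "(tail_limit u - e) * d < tail_limit (u + d) * d"
    using tail_limit_lipschitz[of d u] d by (intro mult_strict_right_mono) (auto simp flip: m_def)
  ultimately have "\<forall>\<^sub>F x in at_top. (tail_limit u - e) * d < increment (u + d) d (x - d)"
    by (rule order_tendstoD(1))
  moreover have "\<forall>\<^sub>F x in at_top. 0 < (x::real)" by (rule eventually_gt_at_top)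
  ultimately show "\<forall>\<^sub>F x in at_top. tail_limit u - e < overshoot (tail u) x"
  proof eventually_elim
    case (elim x)
    have "- \<mu> < x - d" using elim d \<kappa> \<mu> by linarith
    then have "increment (u + d) d (x - d) \<le> overshoot (tail u) x * d"
      using increment_upper[of d "u + d" "x - d"] d u by (simp add: mult.commute)
    with elim(1) have "(tail_limit u - e) * d < overshoot (tail u) x * d" by (rule less_le_trans)
    then show ?case using d by (simp only: mult_less_cancel_right_pos)
  qed
next
  assume "0 < u"
  define m where "m = p * \<alpha> + q * \<beta>"
  have m: "0 < m" using mean_pos by (simp add: m_def)
  define d where "d = min u (min (\<kappa> / 2) (e * m / 2))"
  have d: "0 < d" "d < \<kappa>" "d / m < e" "d \<le> u"
    using \<kappa> m e \<open>0 < u\<close> by (auto simp: d_def min_def field_simps)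
  have "(increment (u - d) d \<longlongrightarrow> tail_limit (u - d) * d) at_top"
    using d by (intro increment_tendsto[OF irr]) auto
  moreover have "tail_limit (u - d) * d < (tail_limit u + e) * d"
    using tail_limit_lipschitz[of d "u - d"] d by (intro mult_strict_right_mono) (auto simp flip: m_def)
  ultimately have "\<forall>\<^sub>F x in at_top. increment (u - d) d x < (tail_limit u + e) * d"
    by (rule order_tendstoD(2))
  moreover have "\<forall>\<^sub>F x in at_top. 0 < (x::real)" by (rule eventually_gt_at_top)
  ultimately show "\<forall>\<^sub>F x in at_top. overshoot (tail u) x < tail_limit u + e"
  proof eventually_elim
    case (elim x)
    have "overshoot (tail u) x * d \<le> increment (u - d) d x"
      using increment_lower[of "u - d" d x] elim d \<mu> by (simp add: mult.commute)
    from le_less_trans[OF this elim(1)]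
    have "overshoot (tail u) x * d < (tail_limit u + e) * d" .
    then show ?case using d by (simp only: mult_less_cancel_right_pos)
  qed
qed

text \<open>The limit law has no atoms, so it is immaterial whether g counts the value u itself: g
  lies between \<open>tail u\<close> and \<open>tail (u - d)\<close>. At u = 0 there is no room
  below, but there the limit is 1 and the upper bound is trivial.\<close>

lemma overshoot_tail_tendsto:
  assumes irr: "\<alpha> / \<beta> \<notin> \<rat>" and u: "0 \<le> u"
    and g: "\<And>s. 0 \<le> s \<Longrightarrow> s < \<mu> \<Longrightarrow> tail u s \<le> g s"
      "\<And>s. 0 \<le> s \<Longrightarrow> s < \<mu> \<Longrightarrow> u \<le> s \<Longrightarrow> g s = 1 \<or> s = u \<and> g s = 0"
      "\<And>s. 0 \<le> s \<Longrightarrow> s < u \<Longrightarrow> g s = 0"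
  shows "(overshoot g \<longlongrightarrow> tail_limit u) at_top"
proof (rule order_tendstoI)
  fix y assume "y < tail_limit u"
  then have "\<forall>\<^sub>F x in at_top. y < overshoot (tail u) x"
    using tail_eventually(1)[OF irr u, of "tail_limit u - y"] by simp
  moreover have "\<forall>\<^sub>F x in at_top. 0 < (x::real)" by (rule eventually_gt_at_top)
  ultimately show "\<forall>\<^sub>F x in at_top. y < overshoot g x"
    by eventually_elim (use overshoot_mono[of "tail u" g] g(1) in force)
next
  fix y assume y: "tail_limit u < y"
  show "\<forall>\<^sub>F x in at_top. overshoot g x < y"
  proof (cases "u = 0")
    case True
    have "tail_limit 0 = 1" using mean_pos \<alpha>_pos \<beta>_pos by (simp add: tail_limit_def)
    then have "1 < y" using y True by simp
    have "overshoot g x \<le> overshoot (\<lambda>_. 1) x" if "0 < x" for x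
      by (rule overshoot_mono) (use g(2) that True in force)+
    then have "\<forall>\<^sub>F x in at_top. overshoot g x \<le> 1"
      unfolding eventually_at_top_dense overshoot_const by blast
    then show ?thesis by eventually_elim (use \<open>1 < y\<close> in simp)
  next
    case False
    define m where "m = p * \<alpha> + q * \<beta>"
    have m: "0 < m" using mean_pos by (simp add: m_def)
    define d where "d = min (u / 2) ((y - tail_limit u) / 2 * m)"
    have d: "0 < d" "d < u" "d / m \<le> (y - tail_limit u) / 2"
      using m y u False by (auto simp: d_def min_def field_simps)
    have "tail_limit (u - d) < y"
    proof -
      have "\<bar>tail_limit u - tail_limit (u - d)\<bar> \<le> d / m"
        using tail_limit_lipschitz[of d "u - d"] d by (simp add: m_def)
      then show ?thesis using d(3) y by (simp only: abs_le_iff) argo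
    qed
    then have "\<forall>\<^sub>F x in at_top. overshoot (tail (u - d)) x < y"
      using tail_eventually(2)[OF irr, of "u - d" "y - tail_limit (u - d)"] d by simp
    moreover have "\<forall>\<^sub>F x in at_top. 0 < (x::real)" by (rule eventually_gt_at_top)
    ultimately show ?thesis
    proof eventually_elim
      case (elim x)
      have "overshoot g x \<le> overshoot (tail (u - d)) x"
      proof (rule overshoot_mono)
        fix s assume "0 \<le> s" "s < \<mu>"
        then show "g s \<le> tail (u - d) s" using g(2)[of s] g(3)[of s] d by (cases "u \<le> s") (auto simp: tail_def)
      qed (use elim in simp)
      then show ?case using elim by simp
    qed
  qed
qed

end


section \<open>Equidistribution of the Fourier modes of the orientation\<close>

locale pinwheel = renewal +
  fixes \<omega> :: complex
  assumes norm_\<omega>: "norm \<omega> = 1" and \<omega>_power: "0 < n \<Longrightarrow> \<omega> ^ n \<noteq> 1"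
    and ratio: "\<alpha> / \<beta> \<notin> \<rat>"
begin

definition turn :: "bool \<Rightarrow> complex" where "turn h = (if h then \<omega> else cnj \<omega>)"
text \<open>\<open>turn h\<close> leads from the direction of A C to that of A B. The additional
  quarter turn leads on to the direction from C to the foot F, which is perpendicular to A
  B.\<close>

definition turn_\<alpha> :: "bool \<Rightarrow> complex" where "turn_\<alpha> h = (if h then \<i> else - \<i>) * turn h"

lemma norm_turn [simp]: "norm (turn h) = 1" "norm (turn_\<alpha> h) = 1"
  using norm_\<omega> by (auto simp: turn_def turn_\<alpha>_def norm_mult)

text \<open>For a parent tile of handedness \<open>h\<close> and direction \<open>w\<close> with size parameter \<open>- x\<close>, this is the
  area-weighted average of \<open>f\<close> over the tiles of non-negative size parameter obtained from it.\<close>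

function descend :: "(bool \<Rightarrow> complex \<Rightarrow> real \<Rightarrow> 'v::real_vector) \<Rightarrow> bool \<Rightarrow> complex \<Rightarrow> real \<Rightarrow> 'v" where
  "descend f h w x = (if x \<le> 0 then f h w (- x)
     else p *\<^sub>R descend f (\<not> h) (turn_\<alpha> h * w) (x - \<alpha>)
       + (q / 2) *\<^sub>R descend f (\<not> h) (turn h * w) (x - \<beta>)
       + (q / 4) *\<^sub>R descend f h (turn h * w) (x - \<beta>)
       + (q / 4) *\<^sub>R descend f h (- (turn h * w)) (x - \<beta>))"
  by pat_completeness auto
termination
proof (relation "Wellfounded.measure (\<lambda>(f, h, w, x). nat \<lceil>x / \<kappa>\<rceil>)")
  fix f :: "bool \<Rightarrow> complex \<Rightarrow> real \<Rightarrow> 'v" and h w and x :: real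
  assume "\<not> x \<le> 0"
  have *: "nat \<lceil>(x - d) / \<kappa>\<rceil> < nat \<lceil>x / \<kappa>\<rceil>" if "\<kappa> \<le> d" for d
  proof -
    have "(x - d) / \<kappa> \<le> x / \<kappa> - 1" using that \<kappa> by (simp add: field_simps)
    moreover have "0 < x / \<kappa>" using \<kappa> \<open>\<not> x \<le> 0\<close> by simp
    ultimately show ?thesis by linarith
  qed
  show "((f, \<not> h, turn_\<alpha> h * w, x - \<alpha>), f, h, w, x) \<in> Wellfounded.measure (\<lambda>(f, h, w, x). nat \<lceil>x / \<kappa>\<rceil>)"
    "((f, \<not> h, turn h * w, x - \<beta>), f, h, w, x) \<in> Wellfounded.measure (\<lambda>(f, h, w, x). nat \<lceil>x / \<kappa>\<rceil>)"
    "((f, h, turn h * w, x - \<beta>), f, h, w, x) \<in> Wellfounded.measure (\<lambda>(f, h, w, x). nat \<lceil>x / \<kappa>\<rceil>)"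
    "((f, h, - (turn h * w), x - \<beta>), f, h, w, x) \<in> Wellfounded.measure (\<lambda>(f, h, w, x). nat \<lceil>x / \<kappa>\<rceil>)"
    using * \<kappa> by auto
qed auto

declare descend.simps [simp del]

lemma descend_base [simp]: "x \<le> 0 \<Longrightarrow> descend f h w x = f h w (- x)"
  by (simp add: descend.simps)

lemma descend_rec: "0 < x \<Longrightarrow> descend f h w x = p *\<^sub>R descend f (\<not> h) (turn_\<alpha> h * w) (x - \<alpha>)
    + (q / 2) *\<^sub>R descend f (\<not> h) (turn h * w) (x - \<beta>)
    + (q / 4) *\<^sub>R descend f h (turn h * w) (x - \<beta>)
    + (q / 4) *\<^sub>R descend f h (- (turn h * w)) (x - \<beta>)"
  using descend.simps[of f h w x] by auto

lemma descend_linear: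
  assumes "linear L"
  shows "descend (\<lambda>h w s. L (f h w s)) h w x = L (descend f h w x)"
proof (induction x arbitrary: h w rule: walk_induct[of 0])
  case (step x)
  then show ?case using linear_add[OF assms] linear_scale[OF assms] by (simp add: descend_rec)
qed simp

lemma descend_add: "descend (\<lambda>h w s. f h w s + g h w s) h w x = descend f h w x + descend g h w x"
proof (induction x arbitrary: h w rule: walk_induct[of 0])
  case (step x)
  then show ?case by (simp add: descend_rec scaleR_add_right)
qed simp

lemma descend_scaleR: "descend (\<lambda>h w s. c *\<^sub>R f h w s) h w x = c *\<^sub>R descend f h w x"
  by (rule descend_linear) (simp add: linear_iff scaleR_add_right)

lemma descend_const: "descend (\<lambda>_ _ _. m) h w x = m"
proof (induction x arbitrary: h w rule: walk_induct[of 0])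
  case (step x)
  have "p + q / 2 + q / 4 + q / 4 = 1" using pq by simp
  then show ?case using step by (simp add: descend_rec flip: scaleR_add_left)
qed simp

lemma descend_mono:
  fixes f g :: "bool \<Rightarrow> complex \<Rightarrow> real \<Rightarrow> real"
  assumes le: "\<And>h w s. norm w = 1 \<Longrightarrow> 0 \<le> s \<Longrightarrow> s < \<mu> \<Longrightarrow> f h w s \<le> g h w s"
    and "norm w = 1" "- \<mu> < x"
  shows "descend f h w x \<le> descend g h w x"
proof -
  have "norm w = 1 \<longrightarrow> - \<mu> < x \<longrightarrow> descend f h w x \<le> descend g h w x"
  proof (induction x arbitrary: h w rule: walk_induct[of 0])
    case (step x)
    have "- \<mu> < x - \<alpha>" "- \<mu> < x - \<beta>" using step(1) \<mu> by auto
    with step show ?case using p_pos q_pos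
      by (auto simp: descend_rec norm_mult intro!: add_mono mult_left_mono)
  qed (use le in auto)
  with assms show ?thesis by blast
qed

lemma descend_norm_le:
  fixes f :: "bool \<Rightarrow> complex \<Rightarrow> real \<Rightarrow> 'v::real_normed_vector"
  assumes le: "\<And>h w s. norm w = 1 \<Longrightarrow> 0 \<le> s \<Longrightarrow> s < \<mu> \<Longrightarrow> norm (f h w s) \<le> B"
    and "norm w = 1" "- \<mu> < x"
  shows "norm (descend f h w x) \<le> B"
proof -
  have "norm w = 1 \<longrightarrow> - \<mu> < x \<longrightarrow> norm (descend f h w x) \<le> B"
  proof (induction x arbitrary: h w rule: walk_induct[of 0])
    case (step x)
    show ?case
    proof (intro impI)
      assume w: "norm w = 1"
      have "- \<mu> < x - \<alpha>" "- \<mu> < x - \<beta>" using step(1) \<mu> by auto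
      with step(2,3) w have *: "norm (descend f (\<not> h) (turn_\<alpha> h * w) (x - \<alpha>)) \<le> B"
        "norm (descend f (\<not> h) (turn h * w) (x - \<beta>)) \<le> B"
        "norm (descend f h (turn h * w) (x - \<beta>)) \<le> B"
        "norm (descend f h (- (turn h * w)) (x - \<beta>)) \<le> B"
        by (auto simp: norm_mult)
      have "norm (descend f h w x) \<le> p * B + (q / 2) * B + (q / 4) * B + (q / 4) * B"
        unfolding descend_rec[OF step(1)]
        using * p_pos q_pos by (intro norm_triangle_mono) (auto intro: mult_left_mono)
      also have "\<dots> = p * B + q * B" by simp
      also have "\<dots> = B" by (rule combine)
      finally show "norm (descend f h w x) \<le> B" .
    qed
  qed (use le in auto)
  with assms show ?thesis by blast
qed

text \<open>Uniform in handedness and direction, since the tiles from which the supertiles of a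
  sequence arise may be oriented arbitrarily.\<close>

definition settles :: "(bool \<Rightarrow> complex \<Rightarrow> real \<Rightarrow> 'v::real_normed_vector) \<Rightarrow> 'v \<Rightarrow> bool" where
  "settles f L \<longleftrightarrow> (\<forall>e>0. \<exists>X. \<forall>x\<ge>X. \<forall>h w. norm w = 1 \<longrightarrow> norm (descend f h w x - L) < e)"

text \<open>Moving the threshold by l gains a factor c, so after n moves the bound is c ^ n *
  B.\<close>

lemma contraction_tendsto:
  fixes N :: "real \<Rightarrow> real"
  assumes c: "0 \<le> c" "c < 1" and B: "\<And>x. 0 < x \<Longrightarrow> N x \<le> B" and "0 \<le> B"
    and contr: "\<And>z B. 0 \<le> z \<Longrightarrow> 0 \<le> B \<Longrightarrow> (\<And>x. z < x \<Longrightarrow> N x \<le> B) \<Longrightarrow> (\<And>x. z + l < x \<Longrightarrow> N x \<le> c * B)"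
    and l: "0 \<le> l" and e: "0 < e"
  shows "\<exists>X\<ge>0. \<forall>x\<ge>X. N x < e"
proof -
  have *: "N x \<le> c ^ n * B" if "real n * l < x" for n x
    using that
  proof (induction n arbitrary: x)
    case (Suc n)
    have "N x \<le> c * (c ^ n * B)"
      using Suc c l \<open>0 \<le> B\<close> by (intro contr[of "real n * l"]) (auto simp: algebra_simps)
    then show ?case by simp
  qed (use B in simp)
  have "(\<lambda>n. c ^ n * B) \<longlonglongrightarrow> 0 * B" using c by (intro tendsto_mult LIMSEQ_realpow_zero tendsto_const)
  then have "\<forall>\<^sub>F n in sequentially. c ^ n * B < e" using e by (auto dest: order_tendstoD(2))
  then obtain n where n: "c ^ n * B < e" by (meson eventually_sequentially order_refl)
  have "\<forall>x\<ge>real n * l + 1. N x < e" using * n by (smt (verit))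
  moreover have "0 \<le> real n * l + 1" using l by simp
  ultimately show ?thesis by blast
qed

text \<open>Fixing the final handedness separates the two copies of the circle. Non-negative powers
  suffice because real test functions are obtained as real parts.\<close>

definition mode :: "bool \<Rightarrow> nat \<Rightarrow> (real \<Rightarrow> real) \<Rightarrow> bool \<Rightarrow> complex \<Rightarrow> real \<Rightarrow> complex" where
  "mode h0 k g h w s = (if h = h0 then w ^ k * of_real (g s) else 0)"

text \<open>The recursion changes directions only by constant factors, so a rotation of the parent
  rotates all descendants alike. What remains are two functions of x, one for each handedness of the
  parent.\<close>

lemma descend_mode: "descend (mode h0 k g) h (z * w) x = w ^ k * descend (mode h0 k g) h z x"
proof (induction x arbitrary: h z w rule: walk_induct[of 0])
  case (base x)
  then show ?case by (simp add: mode_def power_mult_distrib)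
next
  case (step x)
  let ?d = "descend (mode h0 k g)"
  have "?d (\<not> h) (turn_\<alpha> h * (z * w)) (x - \<alpha>) = w ^ k * ?d (\<not> h) (turn_\<alpha> h * z) (x - \<alpha>)"
    "?d h' (turn h * (z * w)) (x - \<beta>) = w ^ k * ?d h' (turn h * z) (x - \<beta>)"
    "?d h' (- (turn h * (z * w))) (x - \<beta>) = w ^ k * ?d h' (- (turn h * z)) (x - \<beta>)" for h'
    using step(2)[of "\<not> h" "turn_\<alpha> h * z" w] step(3)[of h' "turn h * z" w]
      step(3)[of h' "- (turn h * z)" w] by (simp_all add: mult.assoc)
  then show ?case
    unfolding descend_rec[OF step(1)] scaleR_conv_of_real by (simp only: distrib_left mult.left_commute)
qed

lemma mode_le:
  assumes g: "\<And>s. 0 \<le> s \<Longrightarrow> s < \<mu> \<Longrightarrow> \<bar>g s\<bar> \<le> 1" and "norm w = 1" "- \<mu> < x"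
  shows "norm (descend (mode h0 k g) h w x) \<le> 1"
  using assms by (intro descend_norm_le) (auto simp: mode_def norm_mult norm_power)

lemma settles_mode:
  assumes "\<And>h e. 0 < e \<Longrightarrow> \<exists>X. \<forall>x\<ge>X. norm (descend (mode h0 k g) h 1 x - L h) < e"
    and L: "\<And>h w. norm w = 1 \<Longrightarrow> w ^ k * L h = L'"
  shows "settles (mode h0 k g) L'"
  unfolding settles_def
proof (intro allI impI)
  fix e :: real assume "0 < e"
  then obtain X where X: "\<And>h x. X h \<le> x \<Longrightarrow> norm (descend (mode h0 k g) h 1 x - L h) < e"
    using assms(1) by metis
  have "norm (descend (mode h0 k g) h w x - L') < e"
    if "max (X True) (X False) \<le> x" "norm w = 1" for x h w
  proof -
    have "descend (mode h0 k g) h w x - L' = w ^ k * (descend (mode h0 k g) h 1 x - L h)"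
      using descend_mode[of h0 k g h 1 w x] L[OF that(2)] by (simp add: right_diff_distrib)
    moreover have "norm (descend (mode h0 k g) h 1 x - L h) < e" using that by (cases h) (auto intro: X)
    ultimately show ?thesis using that by (simp add: norm_mult norm_power)
  qed
  then show "\<exists>X. \<forall>x\<ge>X. \<forall>h w. norm w = 1 \<longrightarrow> norm (descend (mode h0 k g) h w x - L') < e" by blast
qed

text \<open>The factor 1 + (- 1) ^ k stems from the two daughters with the handedness of the parent,
  which point in opposite directions.\<close>

lemma mode_rec:
  fixes h0 k g
  assumes "0 < x"
  defines "v \<equiv> \<lambda>h. descend (mode h0 k g) h 1"
  shows "v h x = of_real p * turn_\<alpha> h ^ k * v (\<not> h) (x - \<alpha>)
    + of_real (q / 2) * turn h ^ k * v (\<not> h) (x - \<beta>)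
    + of_real (q / 4) * (1 + (- 1) ^ k) * turn h ^ k * v h (x - \<beta>)"
proof -
  have "descend (mode h0 k g) h' z y = z ^ k * v h' y" for h' z y
    using descend_mode[of h0 k g h' 1 z y] by (simp add: v_def)
  moreover have "(- (turn h)) ^ k = (- 1) ^ k * turn h ^ k"
    by (metis mult_minus1 power_mult_distrib)
  ultimately show ?thesis
    using descend_rec[OF assms(1), of "mode h0 k g" h 1]
    by (simp add: scaleR_conv_of_real v_def[symmetric] algebra_simps)
qed

lemma norm_combine_le:
  fixes z1 z2 z3 :: complex
  assumes "norm z1 \<le> B1" "norm z2 \<le> B2" "norm z3 \<le> B3"
  shows "norm (z1 + z2 + z3) \<le> B1 + B2 + B3"
  using assms by (intro norm_triangle_mono)

lemma mode_settles_0: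
  assumes g: "\<And>s. 0 \<le> s \<Longrightarrow> s < \<mu> \<Longrightarrow> \<bar>g s\<bar> \<le> 1" and k: "0 < k"
  shows "settles (mode h0 k g) 0"
proof (rule settles_mode[where L = "\<lambda>_. 0"])
  define v where "v h = descend (mode h0 k g) h 1" for h
  define N where "N x = max (norm (v True x)) (norm (v False x))" for x
  have Nv: "norm (v h x) \<le> N x" for h x by (cases h) (auto simp: N_def)
  have vN: "N x \<le> B" if "\<And>h. norm (v h x) \<le> B" for x B using that by (simp add: N_def)
  have rec: "v h x = of_real p * turn_\<alpha> h ^ k * v (\<not> h) (x - \<alpha>)
    + of_real (q / 2) * turn h ^ k * v (\<not> h) (x - \<beta>)
    + of_real (q / 4) * (1 + (- 1) ^ k) * turn h ^ k * v h (x - \<beta>)" if "0 < x" for h x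
    using mode_rec[OF that] unfolding v_def by simp
  have N1: "N x \<le> 1" if "0 < x" for x
    using mode_le[of g 1 x h0 k] g that \<mu> by (intro vN) (simp add: v_def)
  fix h and e :: real assume e: "0 < e"
  have "\<exists>X\<ge>0. \<forall>x\<ge>X. N x < e"
  proof (cases "even k")
    case False
    show ?thesis
    \<comment> \<open>For odd k the two daughters of opposite directions cancel, which removes the
      weight q / 2 from the total 1.\<close>
    proof (rule contraction_tendsto[where c = "p + q / 2" and l = \<mu> and B = 1])
      show "0 \<le> p + q / 2" "p + q / 2 < 1" using p_pos q_pos pq by auto
      fix z B x assume z: "0 \<le> z" "0 \<le> (B::real)" "\<And>x. z < x \<Longrightarrow> N x \<le> B" "z + \<mu> < x"
      have b: "norm (v h y) \<le> B" if "z < y" for h y using Nv[of h y] z(3)[OF that] by simp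
      have "norm (v h x) \<le> p * B + q / 2 * B + 0" for h
      proof -
        have "v h x = of_real p * turn_\<alpha> h ^ k * v (\<not> h) (x - \<alpha>)
          + of_real (q / 2) * turn h ^ k * v (\<not> h) (x - \<beta>) + 0"
          using rec[of x h] z \<mu> False by simp
        also have "norm \<dots> \<le> p * B + q / 2 * B + 0"
          using b[of "x - \<alpha>" "\<not> h"] b[of "x - \<beta>" "\<not> h"] z \<mu> p_pos q_pos
          by (intro norm_combine_le) (auto simp: norm_mult norm_power)
        finally show ?thesis .
      qed
      then show "N x \<le> (p + q / 2) * B" by (intro vN) (simp add: distrib_right)
    qed (use N1 \<mu> e in auto)
  next
    case True
    txt \<open>A step of size \<open>\<alpha>\<close> followed by one of size \<open>\<beta>\<close> and the same steps in the opposite order end at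
      the same size, but their phases differ by the factor \<open>\<omega> ^ (2 * k) \<noteq> 1\<close>. The
      resulting cancellation makes two steps a strict contraction.\<close>
    define r where "r = norm (\<omega> ^ k + cnj \<omega> ^ k)"
    have T: "turn h ^ k + turn (\<not> h) ^ k = \<omega> ^ k + cnj \<omega> ^ k" for h
      by (cases h) (auto simp: turn_def)
    have r2: "r < 2"
    proof -
      define u where "u = \<omega> ^ k"
      have nu: "norm u = 1" using norm_\<omega> by (simp add: u_def norm_power)
      have "u\<^sup>2 = \<omega> ^ (2 * k)" by (simp add: u_def mult.commute flip: power_mult)
      then have u1: "u\<^sup>2 \<noteq> 1" using \<omega>_power[of "2 * k"] k by simp
      have "\<bar>Re u\<bar> \<noteq> 1"
      proof
        assume "\<bar>Re u\<bar> = 1"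
        moreover have "(Re u)\<^sup>2 + (Im u)\<^sup>2 = 1" using nu by (simp add: cmod_def)
        moreover have "(Re u)\<^sup>2 = 1" using \<open>\<bar>Re u\<bar> = 1\<close> by (metis power2_abs one_power2)
        ultimately have "Im u = 0" by simp
        then have "u\<^sup>2 = 1" using \<open>(Re u)\<^sup>2 = 1\<close> by (simp add: complex_eq_iff power2_eq_square)
        then show False using u1 by simp
      qed
      moreover have "\<bar>Re u\<bar> \<le> 1" using abs_Re_le_cmod[of u] nu by simp
      ultimately have "\<bar>Re u\<bar> < 1" by simp
      moreover have "u + cnj u = of_real (2 * Re u)" by (simp add: complex_add_cnj)
      ultimately show ?thesis unfolding r_def complex_cnj_power[symmetric] u_def[symmetric] by (simp only: norm_of_real)
    qed
    have r0: "0 \<le> r" by (simp add: r_def)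
    \<comment> \<open>Each of the two interfering paths has weight p * q / 2. Together they
      contribute at most p * q / 2 * r instead of p * q, and all other weights are kept.\<close>
    define c where "c = 1 - p * q / 2 * (2 - r)"
    have pq1: "p * q \<le> 1" using p_pos q_pos pq by (intro mult_le_one) auto
    have c: "0 \<le> c" "c < 1"
    proof -
      have "p * q / 2 * (2 - r) \<le> p * q / 2 * 2" using p_pos q_pos r0 by (intro mult_left_mono) auto
      then show "0 \<le> c" using pq1 by (simp add: c_def)
      show "c < 1" using p_pos q_pos r2 by (simp add: c_def)
    qed
    have rec2: "v h x = of_real p * turn_\<alpha> h ^ k * v (\<not> h) (x - \<alpha>)
      + of_real (q / 2) * turn h ^ k * v (\<not> h) (x - \<beta>)
      + of_real (q / 2) * turn h ^ k * v h (x - \<beta>)" if "0 < x" for h x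
      using rec[OF that, of h] True by simp
    show ?thesis
    proof (rule contraction_tendsto[where c = c and l = "2 * \<mu>" and B = 1])
      fix z B x assume z: "0 \<le> z" "0 \<le> (B::real)" "\<And>x. z < x \<Longrightarrow> N x \<le> B" "z + 2 * \<mu> < x"
      have b: "norm (v h y) \<le> B" if "z < y" for h y using Nv[of h y] z(3)[OF that] by simp
      have nT [simp]: "norm (turn h ^ k) = 1" "norm (turn_\<alpha> h ^ k) = 1" for h by (simp_all add: norm_power)
      have "norm (v h x) \<le> c * B" for h
      proof -
        define P Q where "P = complex_of_real p" and "Q = complex_of_real (q / 2)"
        have nP: "norm P = p" "norm Q = q / 2" using p_pos q_pos by (auto simp: P_def Q_def)
        have pos: "0 < x" "0 < x - \<alpha>" "0 < x - \<beta>" using z \<mu> by auto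
        have comm: "x - \<beta> - \<alpha> = x - \<alpha> - \<beta>" by simp
        have "v h x = P * turn_\<alpha> h ^ k * v (\<not> h) (x - \<alpha>) + Q * turn h ^ k * v (\<not> h) (x - \<beta>)
            + Q * turn h ^ k * v h (x - \<beta>)"
          using rec2[OF pos(1)] by (simp add: P_def Q_def)
        \<comment> \<open>Two of the three terms are expanded once more, namely those that produce
          the interfering pair at \<open>x - \<alpha> - \<beta>\<close>.\<close>
        also have "v (\<not> h) (x - \<alpha>) = P * turn_\<alpha> (\<not> h) ^ k * v h (x - \<alpha> - \<alpha>)
            + Q * turn (\<not> h) ^ k * v h (x - \<alpha> - \<beta>) + Q * turn (\<not> h) ^ k * v (\<not> h) (x - \<alpha> - \<beta>)"
          using rec2[OF pos(2), of "\<not> h"] by (simp add: P_def Q_def)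
        also have "v h (x - \<beta>) = P * turn_\<alpha> h ^ k * v (\<not> h) (x - \<alpha> - \<beta>)
            + Q * turn h ^ k * v (\<not> h) (x - \<beta> - \<beta>) + Q * turn h ^ k * v h (x - \<beta> - \<beta>)"
          using rec2[OF pos(3), of h] unfolding P_def Q_def comm .
        finally have "v h x =
            (P * P * turn_\<alpha> h ^ k * turn_\<alpha> (\<not> h) ^ k * v h (x - \<alpha> - \<alpha>)
              + P * Q * turn_\<alpha> h ^ k * turn (\<not> h) ^ k * v h (x - \<alpha> - \<beta>)
              + P * Q * turn_\<alpha> h ^ k * (turn h ^ k + turn (\<not> h) ^ k) * v (\<not> h) (x - \<alpha> - \<beta>))
            + Q * turn h ^ k * v (\<not> h) (x - \<beta>)
            + (Q * Q * turn h ^ k * turn h ^ k * v (\<not> h) (x - \<beta> - \<beta>)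
              + Q * Q * turn h ^ k * turn h ^ k * v h (x - \<beta> - \<beta>) + 0)"
          by (simp only: ring_distribs mult_ac add_ac add_0_left add_0_right)
        also have "norm \<dots> \<le> (p * p * B + p * (q / 2) * B + p * (q / 2) * r * B) + q / 2 * B
            + (q / 2 * (q / 2) * B + q / 2 * (q / 2) * B + 0)"
          unfolding T
          using b[of "x - \<alpha> - \<alpha>" h] b[of "x - \<alpha> - \<beta>" h] b[of "x - \<alpha> - \<beta>" "\<not> h"] b[of "x - \<beta>" "\<not> h"]
            b[of "x - \<beta> - \<beta>" h] b[of "x - \<beta> - \<beta>" "\<not> h"] z \<mu> p_pos q_pos r0
          by (intro norm_combine_le) (auto simp: norm_mult nP r_def[symmetric] intro!: mult_left_mono)
        also have "\<dots> = c * B"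
        proof -
          have q': "q = 1 - p" using pq by simp
          have "p * p + p * (q / 2) + p * (q / 2) * r + q / 2 + (q / 2 * (q / 2) + q / 2 * (q / 2)) = c"
            unfolding c_def q' by (simp add: field_simps)
          then show ?thesis by (simp only: add_0_right flip: distrib_right)
        qed
        finally show ?thesis .
      qed
      then show "N x \<le> c * B" by (rule vN)
    qed (use N1 \<mu> e c in auto)
  qed
  then show "\<exists>X. \<forall>x\<ge>X. norm (descend (mode h0 k g) h 1 x - 0) < e"
    using Nv[of h] unfolding v_def by (metis diff_0_right le_less_trans)
qed simp

text \<open>Without phases, the sum over the two handednesses of the parent obeys the overshoot
  recursion. In their difference the steps by \<beta> cancel, as they lead to both handednesses with
  equal weight, and a factor p < 1 is left. So both values tend to half the limit of the
  sum.\<close>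

lemma mode_0_settles:
  assumes g: "\<And>s. 0 \<le> s \<Longrightarrow> s < \<mu> \<Longrightarrow> \<bar>g s\<bar> \<le> 1" and lim: "(overshoot g \<longlongrightarrow> L) at_top"
  shows "settles (mode h0 0 g) (of_real (L / 2))"
proof (rule settles_mode[where L = "\<lambda>_. of_real (L / 2)"])
  define v where "v h = descend (mode h0 0 g) h 1" for h
  have rec: "v h x = of_real p * v (\<not> h) (x - \<alpha>) + of_real (q / 2) * v (\<not> h) (x - \<beta>)
    + of_real (q / 2) * v h (x - \<beta>)" if "0 < x" for h x
    using mode_rec[OF that, of h0 0 g h] unfolding v_def by simp
  have sum: "v True x + v False x = of_real (overshoot g x)" for x
  proof (induction x rule: walk_induct[of 0])
    case (base x)
    then show ?case by (auto simp: v_def mode_def)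
  next
    case (step x)
    have "v True x + v False x = of_real p * (v True (x - \<alpha>) + v False (x - \<alpha>))
        + of_real q * (v True (x - \<beta>) + v False (x - \<beta>))"
      using rec[OF step(1)] by (simp add: algebra_simps)
    then show ?case using step by (simp add: overshoot_rec)
  qed
  have diff: "v True x - v False x = - of_real p * (v True (x - \<alpha>) - v False (x - \<alpha>))" if "0 < x" for x
    using rec[OF that] by (simp add: algebra_simps)
  have N2: "norm (v True x - v False x) \<le> 2" if "0 < x" for x
  proof -
    have "norm (v h x) \<le> 1" for h
      unfolding v_def using that \<mu> by (intro mode_le g) auto
    then show ?thesis using norm_triangle_ineq4[of "v True x" "v False x"] by (smt (verit))
  qed
  fix h and e :: real assume e: "0 < e"
  obtain X where X: "0 \<le> X" "\<And>x. X \<le> x \<Longrightarrow> norm (v True x - v False x) < e"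
    using contraction_tendsto[of p "\<lambda>x. norm (v True x - v False x)" 2 \<mu> e]
  proof -
    have "\<exists>X\<ge>0. \<forall>x\<ge>X. norm (v True x - v False x) < e"
    proof (rule contraction_tendsto[where c = p and l = \<mu> and B = 2])
      fix z B x assume z: "0 \<le> z" "0 \<le> (B::real)" "\<And>x. z < x \<Longrightarrow> norm (v True x - v False x) \<le> B" "z + \<mu> < x"
      have "norm (v True x - v False x) = p * norm (v True (x - \<alpha>) - v False (x - \<alpha>))"
        using diff[of x] z \<mu> p_pos by (simp add: norm_mult)
      also have "\<dots> \<le> p * B" using z \<mu> p_pos by (intro mult_left_mono) auto
      finally show "norm (v True x - v False x) \<le> p * B" .
    qed (use N2 p_pos q_pos pq \<mu> e in auto)
    then show ?thesis using that by blast
  qed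
  have "\<forall>\<^sub>F x in at_top. dist (overshoot g x) L < e" using lim e by (rule tendstoD)
  then obtain Y where Y: "\<And>x. Y \<le> x \<Longrightarrow> \<bar>overshoot g x - L\<bar> < e"
    by (auto simp: eventually_at_top_linorder dist_real_def)
  have "norm (v h x - of_real (L / 2)) < e" if "max X Y \<le> x" for x
  proof -
    define s :: complex where "s = (if h then 1 else - 1)"
    have "2 * (v h x - of_real (L / 2)) = of_real (overshoot g x - L) + s * (v True x - v False x)"
      using sum[of x] by (cases h) (simp_all add: s_def algebra_simps)
    then have "norm (2 * (v h x - of_real (L / 2)))
        \<le> norm (complex_of_real (overshoot g x - L)) + norm (s * (v True x - v False x))"
      by (metis norm_triangle_ineq)
    also have "\<dots> < e + e"
      using X(2)[of x] Y[of x] that unfolding norm_of_real by (intro add_strict_mono) (auto simp: s_def norm_minus_commute)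
    finally show ?thesis by (simp only: norm_mult) simp
  qed
  then show "\<exists>X. \<forall>x\<ge>X. norm (descend (mode h0 0 g) h 1 x - of_real (L / 2)) < e"
    unfolding v_def by blast
qed simp

end


section \<open>Subdivision of tiles\<close>

locale tiling =
  fixes a b c :: real
  assumes a_pos: "0 < a" and b_pos: "0 < b" and c_pos: "0 < c" and pythagoras: "a\<^sup>2 + b\<^sup>2 = c\<^sup>2"
    and irrational_ratio: "size_alpha a c / size_beta b c \<notin> \<rat>"
    and irrational_angle: "arctan (a / b) / pi \<notin> \<rat>"
begin

lemma c_gt: "a < c" "b < c"
proof -
  have "0 < a\<^sup>2" "0 < b\<^sup>2" using a_pos b_pos by simp_all
  then have "a\<^sup>2 < c\<^sup>2" "b\<^sup>2 < c\<^sup>2" using pythagoras by linarith+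
  then show "a < c" "b < c" using c_pos by (auto dest: power_less_imp_less_base)
qed

lemma cis_arctan: "cis (arctan (a / b)) = Complex (b / c) (a / c)"
proof -
  have "sqrt (1 + (a / b)\<^sup>2) = c / b"
  proof -
    have "1 + (a / b)\<^sup>2 = (c / b)\<^sup>2"
      using b_pos by (simp add: power_divide pythagoras[symmetric] add_divide_distrib)
    then show ?thesis using b_pos c_pos by simp
  qed
  then show ?thesis
    using b_pos c_pos by (simp add: complex_eq_iff cos_arctan sin_arctan)
qed

end

text \<open>The probabilities are shares of the parent's area: that of the daughter (C, F, B), and
  that of the four smaller copies scaled by b / (2 c) together.\<close>

sublocale tiling \<subseteq> pinwheel "a\<^sup>2 / c\<^sup>2" "b\<^sup>2 / c\<^sup>2" "size_alpha a c" "size_beta b c" "cis (arctan (a / b))"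
proof
  show "a\<^sup>2 / c\<^sup>2 + b\<^sup>2 / c\<^sup>2 = 1"
    using c_pos by (simp add: pythagoras flip: add_divide_distrib)
  show "0 < size_alpha a c" "0 < size_beta b c"
    using c_gt a_pos b_pos c_pos by (simp_all add: size_alpha_def size_beta_def)
  show "cis (arctan (a / b)) ^ n \<noteq> 1" if "0 < n" for n
  proof
    assume "cis (arctan (a / b)) ^ n = 1"
    then have "cis (real n * arctan (a / b)) = 1" by (simp only: Complex.DeMoivre)
    then have "Re (cis (real n * arctan (a / b))) = Re 1" by (rule arg_cong)
    then have "cos (real n * arctan (a / b)) = 1" by simp
    then obtain m :: int where "real n * arctan (a / b) = of_int m * 2 * pi"
      by (auto simp: cos_one_2pi_int)
    then have "arctan (a / b) / pi = of_int (2 * m) / of_nat n"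
      using that by (simp add: field_simps)
    then show False using irrational_angle by (metis Rats_divide Rats_of_int Rats_of_nat)
  qed
qed (use a_pos b_pos c_pos irrational_ratio in auto)

context tiling
begin

lemma \<mu>_eq: "\<mu> = size_mu a b c"
  by (simp add: \<mu>_def size_mu_def)

section \<open>Tiles in complex coordinates\<close>

definition make_tile :: "complex \<Rightarrow> complex \<Rightarrow> bool \<Rightarrow> tile" where
  "make_tile A u h = (A, A + u, A + of_real (c / b) * u * turn h)"

lemma turn_eq: "turn h = Complex (b / c) (if h then a / c else - a / c)"
proof -
  have "turn h = (if h then cis (arctan (a / b)) else cnj (cis (arctan (a / b))))" by (rule turn_def)
  also have "\<dots> = Complex (b / c) (if h then a / c else - a / c)"
    unfolding cis_arctan by (simp add: complex_eq_iff)
  finally show ?thesis .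
qed

lemma turn_mult_turn [simp]: "turn h * turn (\<not> h) = 1" "turn (\<not> h) * turn h = 1"
  by (auto simp: turn_def cis_cnj cis_mult)

lemma turn_square: "1 + turn h * turn h = of_real (2 * b / c) * turn h"
proof -
  have "turn (\<not> h) + turn h = of_real (2 * b / c)" by (simp add: turn_eq complex_eq_iff)
  then have "(turn (\<not> h) + turn h) * turn h = of_real (2 * b / c) * turn h" by simp
  then show ?thesis by (simp add: distrib_right)
qed

lemma turn_\<alpha>_eq: "of_real (b / c) * turn h - 1 = of_real (a / c) * turn_\<alpha> h"
proof -
  have "b * b = c * c - a * a" using pythagoras by (simp add: power2_eq_square)
  then show ?thesis
    using c_pos by (auto simp: turn_\<alpha>_def turn_eq complex_eq_iff field_simps)
qed

lemma hypotenuse_eq: "of_real (c / b) * turn h = 1 + of_real (a / b) * (if h then \<i> else - \<i>)"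
  using b_pos c_pos by (auto simp: turn_eq complex_eq_iff)

text \<open>By orthogonality the quotient of B - C by C - A is purely imaginary, and its modulus is
  a / b; the sign of its imaginary part is the handedness.\<close>

lemma is_tile_make_tile:
  assumes "is_tile a b c T"
  obtains A u h where "T = make_tile A u h" "u \<noteq> 0"
proof -
  from is_tileE [OF assms c_pos] obtain A C B r where T: "T = (A, C, B)" "0 < r" "dist A C = r * b"
    "dist C B = r * a" "orthogonal (A - C) (B - C)" by metis
  define u where "u = C - A"
  define z where "z = (B - C) / u"
  have nu: "norm u = r * b" using T(3) by (simp add: u_def dist_norm norm_minus_commute)
  then have u: "u \<noteq> 0" using T(2) b_pos by auto
  have BC: "B - C = z * u" using u by (simp add: z_def)
  have "norm z * (r * b) = r * a"
    using T(4) unfolding nu[symmetric] norm_mult[symmetric] BC[symmetric] by (simp add: dist_norm norm_minus_commute)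
  then have nz: "norm z = a / b" using T(2) b_pos by (simp add: field_simps)
  have "(A - C) \<bullet> (B - C) = - (Re z * (norm u)\<^sup>2)"
    unfolding BC u_def[symmetric] cmod_power2
    using u_def by (simp add: inner_complex_def algebra_simps power2_eq_square)
      (simp add: u_def algebra_simps)
  then have Re0: "Re z = 0" using T(5) u by (simp add: orthogonal_def)
  then have "\<bar>Im z\<bar> = a / b" using nz by (simp add: cmod_def)
  then have z: "z = of_real (a / b) * (if 0 \<le> Im z then \<i> else - \<i>)"
    using Re0 a_pos b_pos by (auto simp: complex_eq_iff)
  have "B = A + u + z * u" using BC by (simp add: u_def algebra_simps)
  also have "\<dots> = A + of_real (c / b) * u * turn (0 \<le> Im z)"
  proof -
    have "of_real (c / b) * turn (0 \<le> Im z) = 1 + z"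
      unfolding hypotenuse_eq using z by (rule arg_cong[where f = "(+) 1", OF sym])
    then have "of_real (c / b) * u * turn (0 \<le> Im z) = u * (1 + z)" by (metis mult.assoc mult.left_commute)
    then show ?thesis by (simp add: algebra_simps)
  qed
  finally have "T = make_tile A u (0 \<le> Im z)" by (simp add: T(1) make_tile_def u_def)
  then show ?thesis using that u by blast
qed

lemma make_tile_class:
  assumes "u \<noteq> 0"
  shows "tile_class c (make_tile A u h) = ((h, sgn u), ln (b / norm u))"
proof -
  have "cnj u * (of_real (c / b) * u * turn h) = of_real (c / b) * (u * cnj u) * turn h"
    by (simp only: mult_ac)
  also have "\<dots> = of_real (c / b * (norm u)\<^sup>2) * turn h"
    by (simp only: of_real_mult complex_norm_square)
  finally have "cnj u * (of_real (c / b) * u * turn h) = of_real (c / b * (norm u)\<^sup>2) * turn h" .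
  moreover have "Im (of_real r * z) = r * Im z" for r z by simp
  ultimately have Im: "Im (cnj u * (of_real (c / b) * u * turn h)) = c / b * (norm u)\<^sup>2 * Im (turn h)"
    by (simp only:)
  have "0 < Im (turn h) \<longleftrightarrow> h" using divide_pos_pos[OF a_pos c_pos] by (auto simp: turn_eq)
  moreover have "0 < c / b * (norm u)\<^sup>2" using assms b_pos c_pos by simp
  ultimately have "0 < Im (cnj u * (of_real (c / b) * u * turn h)) \<longleftrightarrow> h"
    unfolding Im zero_less_mult_iff[of "c / b * (norm u)\<^sup>2"] by auto
  moreover have "tile_size c (make_tile A u h) = ln (b / norm u)"
    using b_pos c_pos by (simp add: make_tile_def tile_size_def dist_norm norm_mult norm_divide)
  ultimately show ?thesis
    by (simp only: tile_class_def tile_orientation_def make_tile_def prod.case add_diff_cancel_left')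
qed

lemma make_tile_area: "tile_area (make_tile A u h) = a / (2 * b) * (norm u)\<^sup>2"
proof -
  have "dist (A + u) (A + of_real (c / b) * u * turn h) = a / b * norm u"
  proof -
    have "(A + of_real (c / b) * u * turn h) - (A + u) = u * (of_real (c / b) * turn h - 1)"
      by (simp add: algebra_simps)
    also have "of_real (c / b) * turn h - 1 = of_real (a / b) * (if h then \<i> else - \<i>)"
      unfolding hypotenuse_eq by simp
    finally show ?thesis
      unfolding dist_commute[of "A + u"] unfolding dist_norm
      using a_pos b_pos by (simp only: norm_mult norm_of_real) simp
  qed
  then show ?thesis
    unfolding tile_area_def make_tile_def prod.case by (simp only:) (simp add: dist_norm power2_eq_square mult_ac)
qed

lemma foot_make_tile:
  assumes "u \<noteq> 0"
  shows "perp_foot A (A + of_real (c / b) * u * turn h) (A + u) = A + of_real (b / c) * u * turn h"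
proof -
  define v where "v = of_real (c / b) * u * turn h"
  have "v = u * (1 + of_real (a / b) * (if h then \<i> else - \<i>))"
    unfolding v_def using hypotenuse_eq[of h] by (metis mult.assoc mult.left_commute)
  then have v: "Re v = Re u - a / b * (if h then 1 else - 1) * Im u"
    "Im v = Im u + a / b * (if h then 1 else - 1) * Re u" by (auto simp: algebra_simps)
  have "u \<bullet> v = (norm u)\<^sup>2"
    unfolding v cmod_power2 inner_complex_def
    by (simp add: power2_eq_square algebra_simps)
  moreover have "v \<bullet> v = (c / b)\<^sup>2 * (norm u)\<^sup>2"
    using b_pos c_pos
    by (simp add: v_def norm_mult norm_divide power_mult_distrib power_divide flip: power2_norm_eq_inner)
  ultimately have "(u \<bullet> v) / (v \<bullet> v) = (b / c)\<^sup>2" using assms by (simp add: power_divide)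
  then have "perp_foot A (A + v) (A + u) = A + (b / c)\<^sup>2 *\<^sub>R v"
    by (simp add: perp_foot_def)
  also have "(b / c)\<^sup>2 *\<^sub>R v = of_real (b / c) * u * turn h"
    using b_pos c_pos by (simp add: v_def scaleR_conv_of_real power2_eq_square)
  finally show ?thesis unfolding v_def .
qed

text \<open>The vector w leads from A to N and from M to K, and 2 w leads from A to F. Hence w or -
  w is the leg from the first vertex to the right angle in all daughters except (C, F, B).\<close>

lemma daughters_make_tile:
  fixes A u h
  assumes "u \<noteq> 0"
  defines "w \<equiv> of_real (b / (2 * c)) * (turn h * u)"
  obtains F M where "daughters (make_tile A u h) = {# make_tile A w (\<not> h), make_tile M w (\<not> h),
    make_tile M w h, make_tile F (- w) h, make_tile (A + u) (of_real (a / c) * (turn_\<alpha> h * u)) (\<not> h) #}"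
proof -
  define F where "F = perp_foot A (A + of_real (c / b) * u * turn h) (A + u)"
  define M where "M = midpoint A (A + u)"
  have F: "F = A + 2 * w"
  proof -
    have "complex_of_real (b / c) = 2 * of_real (b / (2 * c))" by simp
    then show ?thesis unfolding F_def foot_make_tile[OF assms(1)] w_def by (simp only: mult_ac)
  qed
  have M: "M = A + u / 2" by (simp add: M_def midpoint_def scaleR_conv_of_real field_simps)
  have N: "midpoint A F = A + w" by (simp add: F midpoint_def scaleR_conv_of_real field_simps)
  have K: "midpoint F (A + u) = M + w" by (simp add: F M midpoint_def scaleR_conv_of_real field_simps)
  have w1: "of_real (c / b) * w * turn (\<not> h) = u / 2"
    using b_pos c_pos by (simp add: w_def mult.assoc)
  \<comment> \<open>The two daughters that keep the handedness have the segment between M and F as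
    hypotenuse, and F - M = 2 w - u / 2; \<open>turn_square\<close> eliminates the square of the
    turn.\<close>
  have "of_real (c / b) * w * turn h = u / 2 * (turn h * turn h)"
    using b_pos c_pos by (simp add: w_def mult_ac)
  also have "\<dots> = u / 2 * (of_real (2 * b / c) * turn h - 1)"
    using turn_square[of h] by (metis add_diff_cancel_left')
  also have "\<dots> = 2 * w - u / 2" by (simp add: w_def right_diff_distrib mult_ac)
  finally have w2: "of_real (c / b) * w * turn h = 2 * w - u / 2" .
  define x where "x = of_real (a / c) * (turn_\<alpha> h * u)"
  have x: "x = 2 * w - u"
  proof -
    have "x = (of_real (b / c) * turn h - 1) * u" unfolding turn_\<alpha>_eq by (simp add: x_def)
    then show ?thesis by (simp add: w_def left_diff_distrib)
  qed
  have x2: "of_real (c / b) * x * turn (\<not> h) = of_real (c / b) * u * turn h - u"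
  proof -
    have "of_real (c / b) * x * turn (\<not> h) = of_real (a / b) * (if h then \<i> else - \<i>) * (turn h * turn (\<not> h)) * u"
      using b_pos c_pos by (simp add: x_def turn_\<alpha>_def mult_ac del: turn_mult_turn)
    also have "\<dots> = (of_real (c / b) * turn h - 1) * u" unfolding hypotenuse_eq by simp
    finally show ?thesis by (simp only: left_diff_distrib right_diff_distrib mult_1_left mult_1_right mult_ac)
  qed
  have "daughters (make_tile A u h) = {# (A, A + w, M), (M, M + w, A + u), (M, M + w, F), (F, A + w, M),
      (A + u, F, A + of_real (c / b) * u * turn h) #}"
    unfolding make_tile_def daughters_def Let_def prod.case F_def[symmetric] M_def[symmetric] N K ..
  moreover have "make_tile A w (\<not> h) = (A, A + w, M)" "make_tile M w (\<not> h) = (M, M + w, A + u)"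
    unfolding make_tile_def w1 by (simp_all add: M)
  moreover have "make_tile M w h = (M, M + w, F)"
    unfolding make_tile_def w2 by (simp add: M F)
  moreover have "make_tile F (- w) h = (F, A + w, M)"
  proof -
    have "of_real (c / b) * (- w) * turn h = - (2 * w - u / 2)" using w2 by simp
    then show ?thesis unfolding make_tile_def by (simp add: M F)
  qed
  moreover have "make_tile (A + u) x (\<not> h) = (A + u, F, A + of_real (c / b) * u * turn h)"
    unfolding make_tile_def x2 by (simp add: x F)
  ultimately have "daughters (make_tile A u h) = {# make_tile A w (\<not> h), make_tile M w (\<not> h),
    make_tile M w h, make_tile F (- w) h, make_tile (A + u) x (\<not> h) #}" by (simp only:)
  then show ?thesis using that unfolding x_def by blast
qed

section \<open>Averages over a supertile as expectations along the walk\<close>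

definition tile_value :: "(orientation \<times> real \<Rightarrow> real) \<Rightarrow> tile \<Rightarrow> real" where
  "tile_value f T = (case tile_class c T of ((h, w), s) \<Rightarrow> descend (\<lambda>h w s. f ((h, w), s)) h w (- s))"

lemma tile_value_make_tile: "u \<noteq> 0 \<Longrightarrow>
  tile_value f (make_tile A u h) = descend (\<lambda>h w s. f ((h, w), s)) h (sgn u) (- ln (b / norm u))"
  by (simp add: tile_value_def make_tile_class)

text \<open>The recursion of \<open>descend\<close> read geometrically: one daughter takes the
  fraction \<open>a\<^sup>2 / c\<^sup>2\<close> of the area, each of the other four a quarter of
  \<open>b\<^sup>2 / c\<^sup>2\<close>. The negative size is what allows the recursion to
  unfold.\<close>

lemma sum_daughters:
  assumes T: "is_tile a b c T" and size: "tile_size c T < 0"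
  shows "(\<Sum>D\<in>#daughters T. tile_area D * tile_value f D) = tile_area T * tile_value f T"
proof -
  obtain A u h where T': "T = make_tile A u h" and u: "u \<noteq> 0" using is_tile_make_tile[OF T] .
  define w where "w = of_real (b / (2 * c)) * (turn h * u)"
  obtain F M where D: "daughters T = {# make_tile A w (\<not> h), make_tile M w (\<not> h),
    make_tile M w h, make_tile F (- w) h, make_tile (A + u) (of_real (a / c) * (turn_\<alpha> h * u)) (\<not> h) #}"
    using daughters_make_tile[OF u, of A h] unfolding T' w_def .
  define y where "y = of_real (a / c) * (turn_\<alpha> h * u)"
  define x where "x = - ln (b / norm u)"
  have nonzero: "turn h \<noteq> 0" "turn_\<alpha> h \<noteq> 0" using norm_turn[of h] by (metis norm_zero zero_neq_one)+
  have nw: "norm w = b / (2 * c) * norm u" "norm y = a / c * norm u"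
    using a_pos b_pos c_pos by (simp_all add: w_def y_def norm_mult norm_divide)
  have w0: "w \<noteq> 0" "- w \<noteq> 0" "y \<noteq> 0"
    using u nonzero a_pos b_pos c_pos by (auto simp: w_def y_def)
  have sgn_unit: "sgn (of_real r * (z * u)) = z * sgn u" if "0 < r" "norm z = 1" for r and z :: complex
    using that by (simp add: sgn_div_norm norm_mult scaleR_conv_of_real field_simps)
  have sg: "sgn w = turn h * sgn u" "sgn (- w) = - (turn h * sgn u)" "sgn y = turn_\<alpha> h * sgn u"
    using sgn_unit[of "b / (2 * c)" "turn h"] sgn_unit[of "a / c" "turn_\<alpha> h"] a_pos b_pos c_pos
    by (simp_all add: w_def y_def sgn_minus del: of_real_divide)
  have lw: "- ln (b / norm w) = x - size_beta b c"
    using u b_pos c_pos by (simp add: nw x_def size_beta_def ln_div ln_mult)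
  have ly: "- ln (b / norm y) = x - size_alpha a c"
    using u a_pos b_pos c_pos by (simp add: nw x_def size_alpha_def ln_div ln_mult)
  have x: "0 < x" using size make_tile_class[OF u, of A h] by (simp add: T' x_def tile_class_def)
  let ?g = "\<lambda>h w s. f ((h, w), s)"
  obtain P Q where PQ: "P = a\<^sup>2 / c\<^sup>2" "Q = b\<^sup>2 / c\<^sup>2" by blast
  define k where "k = a / (2 * b) * (norm u)\<^sup>2"
  have area: "tile_area (make_tile A' w h') = k * (Q / 4)" "tile_area (make_tile A' (- w) h') = k * (Q / 4)"
    "tile_area (make_tile A' y h') = k * P" "tile_area (make_tile A' u h') = k" for A' h'
    by (simp_all add: make_tile_area nw k_def PQ power_mult_distrib power_divide)
  define d where "d = descend (\<lambda>h w s. f ((h, w), s))"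
  have rec: "d h (sgn u) x = P * d (\<not> h) (turn_\<alpha> h * sgn u) (x - size_alpha a c)
    + Q / 2 * d (\<not> h) (turn h * sgn u) (x - size_beta b c)
    + Q / 4 * d h (turn h * sgn u) (x - size_beta b c)
    + Q / 4 * d h (- (turn h * sgn u)) (x - size_beta b c)"
    using descend_rec[OF x, of "\<lambda>h w s. f ((h, w), s)" h "sgn u"] unfolding d_def PQ by (simp only: real_scaleR_def)
  have val: "tile_value f (make_tile A' w h') = d h' (turn h * sgn u) (x - size_beta b c)"
    "tile_value f (make_tile A' (- w) h') = d h' (- (turn h * sgn u)) (x - size_beta b c)"
    "tile_value f (make_tile A' y h') = d h' (turn_\<alpha> h * sgn u) (x - size_alpha a c)"
    "tile_value f (make_tile A' u h') = d h' (sgn u) x" for A' h'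
    using w0 u by (simp_all add: tile_value_make_tile sg lw ly d_def flip: x_def)
  have "(\<Sum>D\<in>#daughters T. tile_area D * tile_value f D) =
      k * (Q / 4) * d (\<not> h) (turn h * sgn u) (x - size_beta b c)
      + k * (Q / 4) * d (\<not> h) (turn h * sgn u) (x - size_beta b c)
      + k * (Q / 4) * d h (turn h * sgn u) (x - size_beta b c)
      + k * (Q / 4) * d h (- (turn h * sgn u)) (x - size_beta b c)
      + k * P * d (\<not> h) (turn_\<alpha> h * sgn u) (x - size_alpha a c)"
    unfolding D y_def[symmetric] by (simp add: area val)
  also have "\<dots> = k * d h (sgn u) x" unfolding rec by (simp add: algebra_simps)
  finally show ?thesis unfolding T' area val .
qed

text \<open>The area-weighted sum of \<open>tile_value f\<close> is invariant along every chain of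
  subdivisions. At the end all sizes are non-negative, where \<open>tile_value f\<close> is just the
  value of f. A factor exp (2 s) compensates the area and yields equal weights.\<close>

lemma inflates_to_average:
  assumes T: "is_tile a b c T" and inf: "inflates_to c t {#T#} S"
  obtains h w where "norm w = 1"
    "\<And>f. tile_area_average c f S = descend (\<lambda>h w s. f ((h, w), s)) h w (t - tile_size c T)"
    "\<And>f. tile_average c f S = tile_area_average c (\<lambda>x. f x * exp (2 * snd x)) S
      / tile_area_average c (\<lambda>x. exp (2 * snd x)) S"
proof -
  define T' where "T' = expand_tile t T"
  have T't: "is_tile a b c T'" using T c_pos by (simp add: T'_def is_tile_expand)
  have steps: "(subdivide_largest c)\<^sup>*\<^sup>* {#T'#} S" and nonneg: "\<forall>U\<in>#S. 0 \<le> tile_size c U"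
    using inf by (auto simp: inflates_to_def T'_def)
  have inv: "(\<forall>U\<in>#S. is_tile a b c U)
    \<and> (\<forall>f. (\<Sum>U\<in>#S. tile_area U * tile_value f U) = tile_area T' * tile_value f T')"
    using steps
  proof (induction rule: rtranclp_induct)
    case base
    then show ?case using T't by simp
  next
    case (step S1 S2)
    from step(2) obtain U R where U: "S1 = add_mset U R" "S2 = daughters U + R" "tile_size c U < 0" by cases
    then have tiles: "is_tile a b c U" "\<forall>V\<in>#R. is_tile a b c V" using step(3) by auto
    then have "\<forall>V\<in>#S2. is_tile a b c V"
      using daughters_props(1)[OF a_pos b_pos c_pos pythagoras tiles(1)] by (auto simp: U)
    then show ?case using step(3) sum_daughters[OF tiles(1) U(3)] by (simp add: U)
  qed
  obtain A u h where u: "T' = make_tile A u h" "u \<noteq> 0" using is_tile_make_tile[OF T't] .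
  obtain A0 C0 B0 where T0: "T = (A0, C0, B0)" by (cases T)
  have "dist A0 B0 \<noteq> 0" using T c_pos by (auto simp: T0 is_tile_def)
  moreover have "dist (exp t *\<^sub>R A0) (exp t *\<^sub>R B0) = exp t * dist A0 B0"
    by (simp add: dist_norm flip: scaleR_diff_right)
  ultimately have "tile_size c T' = tile_size c T - t"
    using c_pos by (simp add: T'_def T0 expand_tile_def tile_size_def ln_div ln_mult)
  then have size: "- ln (b / norm u) = t - tile_size c T"
    using make_tile_class[OF u(2), of A h] by (simp add: u tile_class_def)
  have area_pos: "0 < tile_area T'" using a_pos b_pos u by (simp add: make_tile_area)
  have final: "tile_value f U = f (tile_class c U)" if "U \<in># S" for f U
    using nonneg that by (auto simp: tile_value_def tile_class_def split: prod.splits)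
  have sums: "(\<Sum>U\<in>#S. tile_area U * f (tile_class c U)) = tile_area T' * tile_value f T'" for f
    using inv final by (simp cong: image_mset_cong)
  have "(\<Sum>U\<in>#S. tile_area U) = tile_area T'"
    using sums[of "\<lambda>_. 1"] by (simp add: tile_value_def descend_const split: prod.splits)
  then have avg: "tile_area_average c f S = tile_value f T'" for f
    using area_pos by (simp add: tile_area_average_def sums)
  \<comment> \<open>A tile of size 0 has legs a and b, hence area a * b / 2, and the area scales
    with exp (- 2 s).\<close>
  have area: "tile_area U * exp (2 * snd (tile_class c U)) = a * b / 2" if "U \<in># S" for U
  proof -
    have "is_tile a b c U" using inv that by blast
    then obtain A v h' where v: "U = make_tile A v h'" "v \<noteq> 0" by (rule is_tile_make_tile)
    have "exp (2 * ln (b / norm v)) = (b / norm v)\<^sup>2"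
      using v b_pos by (simp add: exp_double)
    then show ?thesis
      using v b_pos by (simp add: make_tile_class make_tile_area power_divide) (simp add: power2_eq_square)
  qed
  have "(\<Sum>U\<in>#S. tile_area U * (f (tile_class c U) * exp (2 * snd (tile_class c U))))
      = a * b / 2 * (\<Sum>U\<in>#S. f (tile_class c U))" for f
  proof -
    have "tile_area U * (f (tile_class c U) * exp (2 * snd (tile_class c U))) = a * b / 2 * f (tile_class c U)"
      if "U \<in># S" for U
      using area[OF that] by (metis mult.commute mult.left_commute)
    then have "image_mset (\<lambda>U. tile_area U * (f (tile_class c U) * exp (2 * snd (tile_class c U)))) S
        = image_mset (\<lambda>U. a * b / 2 * f (tile_class c U)) S" by (rule image_mset_cong)
    then show ?thesis by (simp only: sum_mset_distrib_left)
  qed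
  note weighted = this
  have "tile_average c f S = tile_area_average c (\<lambda>x. f x * exp (2 * snd x)) S
      / tile_area_average c (\<lambda>x. exp (2 * snd x)) S" for f
  proof -
    have E: "(\<Sum>U\<in>#S. tile_area U * exp (2 * snd (tile_class c U))) = a * b / 2 * real (size S)"
      using weighted[of "\<lambda>_. 1"] by simp
    then show ?thesis
      using a_pos b_pos area_pos \<open>(\<Sum>U\<in>#S. tile_area U) = tile_area T'\<close>
      unfolding tile_average_def tile_area_average_def weighted E by simp
  qed
  moreover have "norm (sgn u) = 1" using u by (simp add: norm_sgn)
  moreover have "tile_value f T' = descend (\<lambda>h w s. f ((h, w), s)) h (sgn u) (t - tile_size c T)" for f
    using u size by (simp add: tile_value_make_tile)
  ultimately show ?thesis by (intro that[of "sgn u" h]) (simp_all only: avg)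
qed

end


section \<open>The limit measures\<close>

definition circle_measure :: "complex measure" where
  "circle_measure = distr (density lborel (\<lambda>\<phi>. ennreal (indicator {0..<2 * pi} \<phi> / (4 * pi)))) borel cis"

lemma orientation_measure_eq: "orientation_measure = count_space UNIV \<Otimes>\<^sub>M circle_measure"
  by (simp add: orientation_measure_def circle_measure_def)

lemma sets_circle_measure [measurable_cong, simp]: "sets circle_measure = sets borel"
  by (simp add: circle_measure_def)

lemma space_circle_measure [simp]: "space circle_measure = UNIV"
  by (simp add: circle_measure_def)

lemma cis_measurable [measurable]: "cis \<in> borel_measurable borel"
  by (intro borel_measurable_continuous_onI continuous_on_cis continuous_on_id)

text \<open>The end point 2 pi, a null set, is added so that the fundamental theorem of calculus can
  be applied on a closed interval.\<close>

lemma integral_circle_measure: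
  fixes F :: "complex \<Rightarrow> real"
  assumes [measurable]: "F \<in> borel_measurable borel"
  shows "(LINT w|circle_measure. F w) = (LINT \<phi>|lborel. indicator {0..2 * pi} \<phi> * F (cis \<phi>)) / (4 * pi)"
proof -
  have "(LINT w|circle_measure. F w)
      = (LINT \<phi>|density lborel (\<lambda>\<phi>. ennreal (indicator {0..<2 * pi} \<phi> / (4 * pi))). F (cis \<phi>))"
    unfolding circle_measure_def by (subst integral_distr) simp_all
  also have "\<dots> = (LINT \<phi>|lborel. (indicator {0..<2 * pi} \<phi> / (4 * pi)) * F (cis \<phi>))"
    by (subst integral_density) auto
  also have "\<dots> = (LINT \<phi>|lborel. (indicator {0..2 * pi} \<phi> * F (cis \<phi>)) / (4 * pi))"
  proof (rule integral_cong_AE)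
    show "AE \<phi> in lborel. indicator {0..<2 * pi} \<phi> / (4 * pi) * F (cis \<phi>)
        = indicator {0..2 * pi} \<phi> * F (cis \<phi>) / (4 * pi)"
      using AE_lborel_singleton[of "2 * pi"] by eventually_elim (auto simp: indicator_def)
  qed simp_all
  finally show ?thesis by simp
qed

lemma finite_measure_circle: "finite_measure circle_measure"
proof
  have "emeasure circle_measure (space circle_measure)
      = (\<integral>\<^sup>+ \<phi>. ennreal (indicator {0..<2 * pi} \<phi> / (4 * pi)) \<partial>lborel)"
    unfolding circle_measure_def by (simp add: emeasure_distr emeasure_density)
  also have "\<dots> = (\<integral>\<^sup>+ \<phi>. ennreal (1 / (4 * pi)) * indicator {0..<2 * pi} \<phi> \<partial>lborel)"
    by (intro nn_integral_cong) (auto simp: indicator_def)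
  also have "\<dots> < \<infinity>"
    by (simp add: nn_integral_cmult_indicator ennreal_mult_less_top)
  finally show "emeasure circle_measure (space circle_measure) \<noteq> \<infinity>" by simp
qed

interpretation circle: finite_measure circle_measure by (rule finite_measure_circle)

interpretation bool_count: finite_measure "count_space (UNIV :: bool set)"
  by (rule finite_measure_count_space) simp

interpretation bool_circle: pair_sigma_finite "count_space (UNIV :: bool set)" circle_measure ..

lemma finite_measure_orientation: "finite_measure orientation_measure"
  unfolding orientation_measure_eq
  by (intro finite_measure_pair_measure) unfold_locales

interpretation orientation: finite_measure orientation_measure by (rule finite_measure_orientation)

interpretation orientation_size: pair_sigma_finite orientation_measure lborel ..

lemma sets_orientation_measure [measurable_cong]:
  "sets orientation_measure = sets (count_space UNIV \<Otimes>\<^sub>M borel)"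
  unfolding orientation_measure_eq by (intro sets_pair_measure_cong) simp_all

lemma space_orientation_measure [simp]: "space orientation_measure = UNIV"
  by (simp add: orientation_measure_eq space_pair_measure)

lemma integral_orientation_measure:
  fixes F :: "complex \<Rightarrow> real"
  assumes [measurable]: "F \<in> borel_measurable borel" and B: "\<And>w. \<bar>F w\<bar> \<le> B"
  shows "(LINT \<Omega>|orientation_measure. indicator {h} (fst \<Omega>) * F (snd \<Omega>)) = (LINT w|circle_measure. F w)"
proof -
  have "integrable (count_space (UNIV :: bool set) \<Otimes>\<^sub>M circle_measure) (\<lambda>(h', w). indicator {h} h' * F w)"
  proof -
    have "finite_measure (count_space (UNIV :: bool set) \<Otimes>\<^sub>M circle_measure)"
      by (intro finite_measure_pair_measure) unfold_locales
    then interpret finite_measure "count_space (UNIV :: bool set) \<Otimes>\<^sub>M circle_measure" .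
    have "0 \<le> B" using B[of 0] by simp
    then show ?thesis using B
      by (intro integrable_const_bound[where B = B]) (auto simp: indicator_def split: prod.splits)
  qed
  from bool_circle.integral_fst'[OF this] show ?thesis
    by (simp add: orientation_measure_eq lebesgue_integral_count_space_finite UNIV_bool case_prod_beta' indicator_def)
qed

text \<open>Orthogonality of the characters; the factor 1 / 2 is the mass of one copy of the circle.
  The cutoff to the unit circle allows later integrands that are controlled only there.\<close>

lemma integral_circle_harmonic:
  "(LINT w|circle_measure. indicator (sphere 0 1) w * Re (\<zeta> * w ^ k)) = (if k = 0 then Re \<zeta> / 2 else 0)"
proof -
  have "(LINT \<phi>|lborel. indicator {0..2 * pi} \<phi> * (indicator (sphere 0 1) (cis \<phi>) * Re (\<zeta> * cis \<phi> ^ k)))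
     = (LINT \<phi>|lborel. indicator {0..2 * pi} \<phi> *\<^sub>R Re (\<zeta> * cis (real k * \<phi>)))"
    by (simp add: Complex.DeMoivre)
  also have "\<dots> = (if k = 0 then Re \<zeta> * (2 * pi) else 0)"
  proof (cases "k = 0")
    case False
    have "(LINT \<phi>|lborel. indicator {0..2 * pi} \<phi> *\<^sub>R Re (\<zeta> * cis (real k * \<phi>)))
        = Im (\<zeta> * cis (real k * (2 * pi))) / k - Im (\<zeta> * cis (real k * 0)) / k"
    proof (rule integral_FTC_Icc)
      show "((\<lambda>\<phi>. Im (\<zeta> * cis (real k * \<phi>)) / k) has_vector_derivative Re (\<zeta> * cis (real k * x))) (at x within {0..2 * pi})" for x
        unfolding has_real_derivative_iff_has_vector_derivative[symmetric]
        using False by (auto intro!: derivative_eq_intros simp: field_simps)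
      show "continuous_on {0..2 * pi} (\<lambda>x. Re (\<zeta> * cis (real k * x)))"
        by (intro continuous_intros)
    qed simp
    also have "cis (real k * (2 * pi)) = 1"
      using cis_multiple_2pi[of "real k"] by (simp add: mult_ac)
    finally show ?thesis using False by simp
  qed simp
  finally have int: "(LINT \<phi>|lborel. indicator {0..2 * pi} \<phi> * (indicator (sphere 0 1) (cis \<phi>) * Re (\<zeta> * cis \<phi> ^ k)))
      = (if k = 0 then Re \<zeta> * (2 * pi) else 0)" .
  have "(\<lambda>w. indicator (sphere 0 1) w * Re (\<zeta> * w ^ k)) \<in> borel_measurable borel"
    by (intro borel_measurable_times borel_measurable_indicator borel_measurable_continuous_onI continuous_intros) simp
  from integral_circle_measure[OF this] show ?thesis unfolding int by simp
qed

section \<open>Integration with respect to \<nu> and \<rho>\<close>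

context tiling
begin

text \<open>The density of the size under \<rho>: the two exponentials in the defining densities
  cancel.\<close>

definition size_density :: "real \<Rightarrow> real" where
  "size_density s = (a\<^sup>2 * unit_step (size_alpha a c - s) + b\<^sup>2 * unit_step (size_beta b c - s))
     / (a\<^sup>2 * size_alpha a c + b\<^sup>2 * size_beta b c)"

lemma unit_step_measurable [measurable]: "unit_step \<in> borel_measurable borel"
  unfolding unit_step_def[abs_def] by measurable

lemma size_density_measurable [measurable]: "size_density \<in> borel_measurable borel"
  unfolding size_density_def[abs_def] by measurable

lemma mean_pos': "0 < a\<^sup>2 * size_alpha a c + b\<^sup>2 * size_beta b c"
  using a_pos b_pos \<alpha>_pos \<beta>_pos by (intro add_pos_pos mult_pos_pos) simp_all

lemma size_density_bounds: "0 \<le> size_density s"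
  "size_density s \<le> (a\<^sup>2 + b\<^sup>2) / (a\<^sup>2 * size_alpha a c + b\<^sup>2 * size_beta b c)"
  using mean_pos' unfolding size_density_def unit_step_def by (auto intro!: divide_right_mono)

lemma upset_borel:
  fixes U :: "real set"
  assumes "{u<..} \<subseteq> U" "U \<subseteq> {u..}"
  shows "U \<in> sets borel"
proof -
  have "U = (if u \<in> U then {u..} else {u<..})" using assms by (auto simp: le_less)
  then show ?thesis by (metis atLeast_borel greaterThan_borel)
qed

text \<open>Here the renewal limit meets the measures: the length of the part of [0, \<alpha>] above
  u is the positive part of \<alpha> - u, and likewise for \<beta>. The points u and \<mu> are null
  sets, so it does not matter whether u belongs to U.\<close>

lemma integral_size_density:
  assumes u: "0 \<le> u" and U: "{u<..} \<subseteq> U" "U \<subseteq> {u..}"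
  shows "(LINT s|lborel. indicator {0..<\<mu>} s * size_density s * indicator U s) = tail_limit u"
    and "integrable lborel (\<lambda>s. indicator {0..<\<mu>} s * size_density s * indicator U s)"
proof -
  have [measurable]: "U \<in> sets borel" using U by (rule upset_borel)
  let ?M = "a\<^sup>2 * size_alpha a c + b\<^sup>2 * size_beta b c"
  let ?f = "\<lambda>s. (a\<^sup>2 * indicator {u..size_alpha a c} s + b\<^sup>2 * indicator {u..size_beta b c} s) / ?M"
  have ae: "AE s in lborel. ?f s = indicator {0..<\<mu>} s * size_density s * indicator U s"
    using AE_lborel_singleton[of u] AE_lborel_singleton[of \<mu>]
  proof eventually_elim
    case (elim s)
    show ?case
    proof (cases "u < s \<and> s < \<mu>")
      case True
      then have "s \<in> U" "0 \<le> s" using U u by auto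
      then show ?thesis using True by (simp add: size_density_def unit_step_def indicator_def)
    next
      case False
      then have "s < u \<or> \<mu> < s" using elim by auto
      then have "s \<notin> U \<and> s < u \<or> \<mu> < s" using U by auto
      then show ?thesis using \<mu> by (auto simp: indicator_def)
    qed
  qed
  have int: "has_bochner_integral lborel ?f
      ((a\<^sup>2 * measure lborel {u..size_alpha a c} + b\<^sup>2 * measure lborel {u..size_beta b c}) / ?M)"
    by (intro has_bochner_integral_divide_zero has_bochner_integral_add has_bochner_integral_mult_right
        has_bochner_integral_real_indicator) (auto simp: emeasure_lborel_Icc_eq)
  have "has_bochner_integral lborel (\<lambda>s. indicator {0..<\<mu>} s * size_density s * indicator U s)
      ((a\<^sup>2 * measure lborel {u..size_alpha a c} + b\<^sup>2 * measure lborel {u..size_beta b c}) / ?M)"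
    by (rule has_bochner_integral_cong_AE[THEN iffD1, OF _ _ ae int]) simp_all
  moreover have "(a\<^sup>2 * measure lborel {u..size_alpha a c} + b\<^sup>2 * measure lborel {u..size_beta b c}) / ?M
      = tail_limit u"
  proof -
    have m: "measure lborel {u..v} = max 0 (v - u)" for v by simp
    have "tail_limit u = ((a\<^sup>2 * max 0 (size_alpha a c - u) + b\<^sup>2 * max 0 (size_beta b c - u)) / c\<^sup>2) / (?M / c\<^sup>2)"
      unfolding tail_limit_def by (simp add: add_divide_distrib)
    then show ?thesis unfolding m using c_pos by simp
  qed
  ultimately show "(LINT s|lborel. indicator {0..<\<mu>} s * size_density s * indicator U s) = tail_limit u"
    "integrable lborel (\<lambda>s. indicator {0..<\<mu>} s * size_density s * indicator U s)"
    by (auto simp: has_bochner_integral_iff)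
qed

abbreviation "base_measure \<equiv> orientation_measure \<Otimes>\<^sub>M (lborel :: real measure)"

abbreviation "X \<equiv> tile_space a b c"
abbreviation "\<rho> \<equiv> tile_rho a b c"
abbreviation "\<nu> \<equiv> tile_nu a b c"

lemma mem_X: "x \<in> X \<longleftrightarrow> norm (snd (fst x)) = 1 \<and> 0 \<le> snd x \<and> snd x < \<mu>"
  by (cases x; cases "fst x") (auto simp: tile_space_def \<mu>_eq)

lemma X_sets: "X \<in> sets base_measure"
proof -
  have "UNIV \<times> sphere 0 1 \<in> sets orientation_measure"
    unfolding sets_orientation_measure by (intro pair_measureI) auto
  then show ?thesis unfolding tile_space_def by (intro pair_measureI) auto
qed

lemma space_base: "space base_measure = UNIV"
  by (simp add: space_pair_measure)

lemma space_\<rho> [simp]: "space \<rho> = X"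
  by (simp add: tile_rho_def tile_nu_def space_restrict_space space_base)

lemma sets_\<rho>: "sets \<rho> = sets (restrict_space base_measure X)"
  by (simp add: tile_rho_def tile_nu_def)

lemma sets_\<nu>: "sets \<nu> = sets (restrict_space base_measure X)"
  by (simp add: tile_nu_def)

lemma measurable_\<rho>: "f \<in> borel_measurable base_measure \<Longrightarrow> f \<in> borel_measurable \<rho>"
  unfolding measurable_cong_sets[OF sets_\<rho> refl] by (rule measurable_restrict_space1)

lemma measurable_\<rho>_iff:
  fixes f :: "orientation \<times> real \<Rightarrow> real"
  shows "f \<in> borel_measurable \<rho> \<longleftrightarrow> (\<lambda>x. indicator X x * f x) \<in> borel_measurable base_measure"
  unfolding measurable_cong_sets[OF sets_\<rho> refl]
  using borel_measurable_restrict_space_iff[of X base_measure f] X_sets space_base by (simp add: mult.commute)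

text \<open>Nothing is known about f outside X, so it is cut off there. Treating the two
  handednesses separately reduces the claim to functions on a Borel product.\<close>

lemma measurable_continuous:
  fixes f :: "orientation \<times> real \<Rightarrow> real"
  assumes f: "continuous_on X f"
  shows "f \<in> borel_measurable \<rho>"
proof -
  let ?g = "\<lambda>h y. indicator (sphere 0 1 \<times> {0..<\<mu>}) y *\<^sub>R f ((h, fst y), snd y)"
  have g [measurable]: "?g h \<in> borel_measurable (borel \<Otimes>\<^sub>M borel)" for h
    unfolding borel_prod
  proof (rule borel_measurable_continuous_on_indicator)
    have "(sphere 0 1 :: complex set) \<times> {0..<\<mu>} \<in> sets (borel \<Otimes>\<^sub>M borel)"
      by (intro pair_measureI) auto
    then show "(sphere 0 1 :: complex set) \<times> {0..<\<mu>} \<in> sets borel" by (simp only: borel_prod)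
    show "continuous_on (sphere 0 1 \<times> {0..<\<mu>}) (\<lambda>y. f ((h, fst y), snd y))"
      by (rule continuous_on_compose2[OF f]) (auto intro!: continuous_intros simp: mem_X)
  qed
  have "(\<lambda>x. if fst (fst x) then ?g True (snd (fst x), snd x) else ?g False (snd (fst x), snd x))
      \<in> borel_measurable base_measure"
    by measurable
  also have "(\<lambda>x. if fst (fst x) then ?g True (snd (fst x), snd x) else ?g False (snd (fst x), snd x))
      = (\<lambda>x. indicator X x * f x)"
    by (auto simp: fun_eq_iff indicator_def mem_X)
  finally show ?thesis unfolding measurable_\<rho>_iff .
qed

text \<open>The weight exp (2 s) undoes, up to a constant, the density of \<rho> with respect to
  \<nu>.\<close>

lemma integral_\<nu>:
  fixes f :: "orientation \<times> real \<Rightarrow> real"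
  assumes f: "f \<in> borel_measurable \<rho>"
  shows "(LINT x|\<rho>. f x * exp (2 * snd x))
    = 2 * c\<^sup>2 / (a\<^sup>2 * size_alpha a c + b\<^sup>2 * size_beta b c) * (LINT x|\<nu>. f x)"
proof -
  have f\<nu> [measurable]: "f \<in> borel_measurable \<nu>" using f by (simp add: measurable_cong_sets[OF sets_\<rho> refl] measurable_cong_sets[OF sets_\<nu> refl])
  have snd [measurable]: "snd \<in> borel_measurable \<nu>"
    unfolding measurable_cong_sets[OF sets_\<nu> refl] by (rule measurable_restrict_space1) measurable
  let ?M = "a\<^sup>2 * size_alpha a c + b\<^sup>2 * size_beta b c"
  have "(LINT x|\<rho>. f x * exp (2 * snd x)) = (LINT x|\<nu>. (2 * c\<^sup>2 * exp (- 2 * snd x) / ?M) *\<^sub>R (f x * exp (2 * snd x)))"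
    unfolding tile_rho_def case_prod_beta using mean_pos' by (intro integral_density) auto
  also have "\<dots> = (LINT x|\<nu>. 2 * c\<^sup>2 / ?M * f x)"
  proof (intro Bochner_Integration.integral_cong refl)
    fix x :: "orientation \<times> real"
    have "exp (- 2 * snd x) * exp (2 * snd x) = 1" by (simp flip: exp_add)
    moreover have "(2 * c\<^sup>2 * exp (- 2 * snd x) / ?M) *\<^sub>R (f x * exp (2 * snd x))
        = 2 * c\<^sup>2 / ?M * f x * (exp (- 2 * snd x) * exp (2 * snd x))" by simp
    ultimately show "(2 * c\<^sup>2 * exp (- 2 * snd x) / ?M) *\<^sub>R (f x * exp (2 * snd x)) = 2 * c\<^sup>2 / ?M * f x"
      by (simp only: mult_1_right)
  qed
  finally show ?thesis by simp
qed

lemma integral_\<rho>: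
  fixes f :: "orientation \<times> real \<Rightarrow> real"
  assumes f: "f \<in> borel_measurable \<rho>"
  shows "(LINT x|\<rho>. f x) = (LINT x|base_measure. indicator X x * (size_density (snd x) * f x))"
proof -
  let ?R = "restrict_space base_measure X"
  let ?M = "a\<^sup>2 * size_alpha a c + b\<^sup>2 * size_beta b c"
  have fR [measurable]: "f \<in> borel_measurable ?R" using f by (simp add: measurable_cong_sets[OF sets_\<rho> refl])
  have f\<nu> [measurable]: "f \<in> borel_measurable \<nu>" using f by (simp add: measurable_cong_sets[OF sets_\<rho> refl] measurable_cong_sets[OF sets_\<nu> refl])
  have snd [measurable]: "snd \<in> borel_measurable \<nu>" "snd \<in> borel_measurable ?R"
    unfolding measurable_cong_sets[OF sets_\<nu> refl] by (rule measurable_restrict_space1; measurable)+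
  have "(LINT x|\<rho>. f x) = (LINT x|\<nu>. (2 * c\<^sup>2 * exp (- 2 * snd x) / ?M) *\<^sub>R f x)"
    unfolding tile_rho_def case_prod_beta using mean_pos' by (intro integral_density) auto
  also have "\<dots> = (LINT x|?R. (exp (2 * snd x) * (a\<^sup>2 * unit_step (size_alpha a c - snd x)
      + b\<^sup>2 * unit_step (size_beta b c - snd x)) / (2 * c\<^sup>2)) *\<^sub>R ((2 * c\<^sup>2 * exp (- 2 * snd x) / ?M) *\<^sub>R f x))"
    unfolding tile_nu_def case_prod_beta
    by (intro integral_density) (auto simp: unit_step_def)
  also have "\<dots> = (LINT x|?R. size_density (snd x) * f x)"
  proof (intro Bochner_Integration.integral_cong refl)
    fix x :: "orientation \<times> real"
    let ?N = "a\<^sup>2 * unit_step (size_alpha a c - snd x) + b\<^sup>2 * unit_step (size_beta b c - snd x)"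
    have "exp (2 * snd x) * exp (- 2 * snd x) = 1" by (simp flip: exp_add)
    moreover have "(E * N / (2 * c\<^sup>2)) *\<^sub>R ((2 * c\<^sup>2 * E' / M) *\<^sub>R y) = N / M * y * (E * E')" for E E' N M y :: real
      using c_pos by simp
    ultimately show "(exp (2 * snd x) * ?N / (2 * c\<^sup>2)) *\<^sub>R ((2 * c\<^sup>2 * exp (- 2 * snd x) / ?M) *\<^sub>R f x)
        = size_density (snd x) * f x"
      unfolding size_density_def by (simp only: mult_1_right)
  qed
  also have "\<dots> = (LINT x|base_measure. indicator X x *\<^sub>R (size_density (snd x) * f x))"
    using X_sets space_base by (intro integral_restrict_space) simp
  finally show ?thesis by simp
qed

lemma measurable_base_product:
  fixes F :: "complex \<Rightarrow> real" and G :: "real \<Rightarrow> real"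
  assumes F: "F \<in> borel_measurable borel" and G: "G \<in> borel_measurable borel"
  shows "(\<lambda>x. indicator {h} (fst (fst x)) * F (snd (fst x)) * G (snd x)) \<in> borel_measurable base_measure"
proof -
  have O: "fst \<in> measurable orientation_measure (count_space UNIV)"
    "snd \<in> measurable orientation_measure borel"
    by (simp_all add: measurable_cong_sets[OF sets_orientation_measure refl])
  have "(\<lambda>x. indicator {h} (fst (fst x)) :: real) \<in> borel_measurable base_measure"
    by (rule measurable_compose[OF measurable_compose[OF measurable_fst O(1)]]) simp
  moreover have "(\<lambda>x. F (snd (fst x))) \<in> borel_measurable base_measure"
    by (rule measurable_compose[OF measurable_compose[OF measurable_fst O(2)] F])
  moreover have "(\<lambda>x. G (snd x)) \<in> borel_measurable base_measure"
    using G by (intro measurable_compose[OF measurable_snd]) simp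
  ultimately show ?thesis by (intro borel_measurable_times)
qed

text \<open>Under \<rho> orientation and size are independent, and Fubini's theorem applies. F is
  bounded on the unit circle only, so the restriction to X becomes a cutoff in each factor.\<close>

lemma integral_\<rho>_product:
  fixes F :: "complex \<Rightarrow> real" and G :: "real \<Rightarrow> real"
  assumes [measurable]: "F \<in> borel_measurable borel" "G \<in> borel_measurable borel"
    and B: "\<And>w. norm w = 1 \<Longrightarrow> \<bar>F w\<bar> \<le> B"
    and int_G: "integrable lborel (\<lambda>s. indicator {0..<\<mu>} s * size_density s * G s)"
  shows "(LINT x|\<rho>. indicator {h} (fst (fst x)) * F (snd (fst x)) * G (snd x))
    = (LINT w|circle_measure. indicator (sphere 0 1) w * F w)
      * (LINT s|lborel. indicator {0..<\<mu>} s * size_density s * G s)"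
proof -
  define A where "A \<Omega> = indicator {h} (fst \<Omega>) * (indicator (sphere 0 1) (snd \<Omega>) * F (snd \<Omega>))" for \<Omega> :: orientation
  define H where "H s = indicator {0..<\<mu>} s * size_density s * G s" for s
  have "(\<lambda>w. indicator (sphere 0 1) w * F w) \<in> borel_measurable borel"
    by (intro borel_measurable_times borel_measurable_indicator assms) simp
  then have "A \<in> borel_measurable (count_space UNIV \<Otimes>\<^sub>M borel)"
    unfolding A_def
    by (intro borel_measurable_times measurable_compose[OF measurable_snd] measurable_compose[OF measurable_fst]
        borel_measurable_indicator assms) simp_all
  then have [measurable]: "A \<in> borel_measurable orientation_measure"
    by (simp only: measurable_cong_sets[OF sets_orientation_measure refl])
  have [measurable]: "H \<in> borel_measurable lborel" unfolding H_def by measurable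
  have H: "integrable lborel H" using int_G by (simp add: H_def[abs_def])
  have "0 \<le> B" using B[of 1] by simp
  have FB: "\<bar>indicator (sphere 0 1) w * F w\<bar> \<le> B" for w
    using B[of w] \<open>0 \<le> B\<close> by (auto simp: indicator_def)
  have A: "integrable orientation_measure A"
    by (rule orientation.integrable_const_bound[where B = B])
      (use FB \<open>0 \<le> B\<close> in \<open>auto simp: A_def indicator_def\<close>)
  have int: "integrable base_measure (\<lambda>x. A (fst x) * H (snd x))"
  proof (rule orientation_size.Fubini_integrable)
    show "integrable orientation_measure (\<lambda>x. LINT y|lborel. norm (A (fst (x, y)) * H (snd (x, y))))"
      using A by (simp add: abs_mult)
    show "AE x in orientation_measure. integrable lborel (\<lambda>y. A (fst (x, y)) * H (snd (x, y)))"
      using H by simp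
  qed measurable
  have meas: "(\<lambda>x. indicator {h} (fst (fst x)) * F (snd (fst x)) * G (snd x)) \<in> borel_measurable \<rho>"
    by (intro measurable_\<rho> measurable_base_product assms)
  have "(LINT x|\<rho>. indicator {h} (fst (fst x)) * F (snd (fst x)) * G (snd x))
      = (LINT x|base_measure. A (fst x) * H (snd x))"
    unfolding integral_\<rho>[OF meas] A_def H_def
    by (intro Bochner_Integration.integral_cong) (auto simp: indicator_def mem_X)
  also have "\<dots> = (LINT \<Omega>|orientation_measure. LINT s|lborel. A \<Omega> * H s)"
    using orientation_size.integral_fst'[OF int] by simp
  also have "\<dots> = (LINT \<Omega>|orientation_measure. A \<Omega>) * (LINT s|lborel. H s)"
    by simp
  also have "(LINT \<Omega>|orientation_measure. A \<Omega>) = (LINT w|circle_measure. indicator (sphere 0 1) w * F w)"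
    unfolding A_def using FB
    by (intro integral_orientation_measure borel_measurable_times borel_measurable_indicator assms) simp_all
  finally show ?thesis unfolding H_def .
qed

text \<open>The boundary terms are \<open>c\<^sup>2\<close> at \<alpha>,
  \<open>4 * c\<^sup>2\<close> at \<beta> and, by Pythagoras, \<open>- c\<^sup>2\<close> at 0; half
  their sum is \<open>2 * c\<^sup>2\<close>. The result is the constant of
  \<open>integral_\<nu>\<close>, which gives \<nu> total mass 1.\<close>

lemma integral_size_density_exp:
  "(LINT s|lborel. indicator {0..<\<mu>} s * size_density s * exp (2 * s))
    = 2 * c\<^sup>2 / (a\<^sup>2 * size_alpha a c + b\<^sup>2 * size_beta b c)"
  and integrable_size_density_exp:
    "integrable lborel (\<lambda>s. indicator {0..<\<mu>} s * size_density s * exp (2 * s))"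
proof -
  let ?M = "a\<^sup>2 * size_alpha a c + b\<^sup>2 * size_beta b c"
  let ?f = "\<lambda>s. (a\<^sup>2 * (exp (2 * s) * indicator {0..size_alpha a c} s)
    + b\<^sup>2 * (exp (2 * s) * indicator {0..size_beta b c} s)) / ?M"
  have ae: "AE s in lborel. ?f s = indicator {0..<\<mu>} s * size_density s * exp (2 * s)"
    using AE_lborel_singleton[of \<mu>]
  proof eventually_elim
    case (elim s)
    then show ?case
      using \<mu> mean_pos' by (cases "0 \<le> s \<and> s < \<mu>")
        (auto simp: size_density_def unit_step_def indicator_def algebra_simps)
  qed
  have part: "has_bochner_integral lborel (\<lambda>s. exp (2 * s) * indicator {0..v} s) ((exp (2 * v) - 1) / 2)"
    if "0 < v" for v :: real
  proof -
    have "has_bochner_integral lborel (\<lambda>s. exp (2 * s) * indicator {0..v} s) (exp (2 * v) / 2 - exp (2 * 0) / 2)"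
    proof (rule has_bochner_integral_FTC_Icc_real)
      show "((\<lambda>s. exp (2 * s) / 2) has_real_derivative exp (2 * x)) (at x)" for x
        by (auto intro!: derivative_eq_intros)
      show "isCont (\<lambda>s. exp (2 * s)) x" for x :: real by (intro continuous_intros)
    qed (use that in auto)
    then show ?thesis by (simp add: diff_divide_distrib)
  qed
  have int: "has_bochner_integral lborel ?f ((a\<^sup>2 * ((exp (2 * size_alpha a c) - 1) / 2)
      + b\<^sup>2 * ((exp (2 * size_beta b c) - 1) / 2)) / ?M)"
    using \<alpha>_pos \<beta>_pos
    by (intro has_bochner_integral_divide_zero has_bochner_integral_add has_bochner_integral_mult_right part) auto
  have "has_bochner_integral lborel (\<lambda>s. indicator {0..<\<mu>} s * size_density s * exp (2 * s))
      ((a\<^sup>2 * ((exp (2 * size_alpha a c) - 1) / 2) + b\<^sup>2 * ((exp (2 * size_beta b c) - 1) / 2)) / ?M)"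
    by (rule has_bochner_integral_cong_AE[THEN iffD1, OF _ _ ae int]) simp_all
  moreover have "a\<^sup>2 * exp (2 * size_alpha a c) = c\<^sup>2" "b\<^sup>2 * exp (2 * size_beta b c) = 4 * c\<^sup>2"
    using a_pos b_pos c_pos
    by (simp_all add: exp_double size_alpha_def size_beta_def power_divide power_mult_distrib)
  then have "a\<^sup>2 * ((exp (2 * size_alpha a c) - 1) / 2) + b\<^sup>2 * ((exp (2 * size_beta b c) - 1) / 2) = 2 * c\<^sup>2"
    using pythagoras by (simp only: times_divide_eq_right right_diff_distrib mult_1_right) argo
  ultimately show "(LINT s|lborel. indicator {0..<\<mu>} s * size_density s * exp (2 * s)) = 2 * c\<^sup>2 / ?M"
    "integrable lborel (\<lambda>s. indicator {0..<\<mu>} s * size_density s * exp (2 * s))"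
    by (auto simp: has_bochner_integral_iff)
qed

end


section \<open>Test functions\<close>

inductive trig :: "(complex \<Rightarrow> real) \<Rightarrow> bool" where
  trig_mode: "(\<And>w. norm w = 1 \<Longrightarrow> f w = Re (\<zeta> * w ^ k)) \<Longrightarrow> trig f"
| trig_add: "trig f \<Longrightarrow> trig g \<Longrightarrow> trig (\<lambda>w. f w + g w)"

text \<open>In a sum, the second summand absorbs the whole discrepancy off the circle.\<close>

lemma trig_cong: "trig f \<Longrightarrow> (\<And>w. norm w = 1 \<Longrightarrow> g w = f w) \<Longrightarrow> trig g"
proof (induction arbitrary: g rule: trig.induct)
  case (trig_mode f \<zeta> k)
  then show ?case by (intro trig.trig_mode[of _ \<zeta> k]) simp
next
  case (trig_add f1 f2)
  have "trig (\<lambda>w. f1 w + (g w - f1 w))"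
    using trig_add.IH(2)[of "\<lambda>w. g w - f1 w"] trig_add by (intro trig.trig_add) simp_all
  then show ?case by simp
qed

text \<open>The product of Re x and Re y is half the sum of Re (x * cnj y) and Re (x * y), and on
  the circle \<open>cnj w\<close> is the inverse of w. For l > k the first term is conjugated so
  that its exponent becomes non-negative.\<close>

lemma trig_mult_modes: "trig (\<lambda>w. Re (\<zeta> * w ^ k) * Re (\<xi> * w ^ l))"
proof -
  have *: "trig (\<lambda>w. Re (\<zeta> * w ^ k * cnj (\<xi> * w ^ l)))" if "l \<le> k" for \<zeta> k \<xi> l
  proof (rule trig_mode[of _ "\<zeta> * cnj \<xi>" "k - l"])
    fix w :: complex assume "norm w = 1"
    then have "w * cnj w = 1" by (simp add: complex_norm_square[symmetric])
    then have "w ^ l * cnj w ^ l = 1" by (simp flip: power_mult_distrib)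
    moreover have "w ^ k = w ^ (k - l) * w ^ l" using that by (simp flip: power_add)
    then have "\<zeta> * w ^ k * cnj (\<xi> * w ^ l) = \<zeta> * cnj \<xi> * w ^ (k - l) * (w ^ l * cnj w ^ l)"
      by (simp only: complex_cnj_mult complex_cnj_power mult_ac)
    ultimately have "\<zeta> * w ^ k * cnj (\<xi> * w ^ l) = \<zeta> * cnj \<xi> * w ^ (k - l) * 1"
      by (simp only:)
    then show "Re (\<zeta> * w ^ k * cnj (\<xi> * w ^ l)) = Re (\<zeta> * cnj \<xi> * w ^ (k - l))"
      by (simp only: mult_1_right)
  qed
  have "trig (\<lambda>w. Re (\<zeta> / 2 * w ^ k * cnj (\<xi> * w ^ l)))"
  proof (cases "l \<le> k")
    case False
    then have "trig (\<lambda>w. Re (\<xi> * w ^ l * cnj (\<zeta> / 2 * w ^ k)))" by (intro *) simp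
    then show ?thesis
      by (rule trig_cong) (metis complex_cnj_cnj complex_cnj_mult cnj.simps(1) mult.commute)
  qed (rule *)
  moreover have "trig (\<lambda>w. Re (\<zeta> * \<xi> / 2 * w ^ (k + l)))" by (rule trig_mode) (rule refl)
  ultimately have "trig (\<lambda>w. Re (\<zeta> / 2 * w ^ k * cnj (\<xi> * w ^ l)) + Re (\<zeta> * \<xi> / 2 * w ^ (k + l)))"
    by (rule trig_add)
  moreover have "Re x * Re y = Re (x / 2 * cnj y) + Re (x * y / 2)" for x y
    by (simp add: field_simps)
  then have "Re (\<zeta> * w ^ k) * Re (\<xi> * w ^ l)
      = Re (\<zeta> * w ^ k / 2 * cnj (\<xi> * w ^ l)) + Re (\<zeta> * w ^ k * (\<xi> * w ^ l) / 2)" for w by blast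
  then have "(\<lambda>w. Re (\<zeta> / 2 * w ^ k * cnj (\<xi> * w ^ l)) + Re (\<zeta> * \<xi> / 2 * w ^ (k + l)))
      = (\<lambda>w. Re (\<zeta> * w ^ k) * Re (\<xi> * w ^ l))"
    by (simp add: fun_eq_iff power_add mult_ac)
  ultimately show ?thesis by simp
qed

lemma trig_mult: "trig f \<Longrightarrow> trig g \<Longrightarrow> trig (\<lambda>w. f w * g w)"
proof (induction rule: trig.induct)
  case f: (trig_mode f \<zeta> k)
  from f(2) f(1) show ?case
  proof (induction rule: trig.induct)
    case (trig_mode g \<xi> l)
    then show ?case by (intro trig_cong[OF trig_mult_modes[of \<zeta> k \<xi> l]]) simp
  next
    case (trig_add g1 g2)
    then show ?case unfolding distrib_left by (intro trig.trig_add) auto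
  qed
next
  case (trig_add f1 f2)
  then show ?case unfolding distrib_right by (intro trig.trig_add) auto
qed

text \<open>A real-linear function of w is the real part of a complex multiple of w. Polynomials
  supplied by the Stone-Weierstrass theorem thus become sums of modes.\<close>

lemma trig_polynomial: "real_polynomial_function f \<Longrightarrow> trig f" for f :: "complex \<Rightarrow> real"
proof (induction rule: real_polynomial_function.induct)
  case (linear f)
  interpret bounded_linear f by fact
  show ?case
  proof (rule trig_mode[of _ "Complex (f 1) (- f \<i>)" 1])
    fix w :: complex
    have "f w = f (Re w *\<^sub>R 1 + Im w *\<^sub>R \<i>)" by (rule arg_cong[where f = f]) (simp add: complex_eq_iff)
    also have "\<dots> = Re w * f 1 + Im w * f \<i>" by (simp only: add scaleR real_scaleR_def)
    finally show "f w = Re (Complex (f 1) (- f \<i>) * w ^ 1)" by (simp add: mult.commute)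
  qed
next
  case (const c)
  show ?case by (rule trig_mode[of _ "of_real c" 0]) simp
qed (auto intro: trig_add trig_mult)

section \<open>Functions whose averages converge to their integral\<close>

context tiling
begin

lemma settles_add: "settles f L \<Longrightarrow> settles g M \<Longrightarrow> settles (\<lambda>h w s. f h w s + g h w s) (L + M)"
  unfolding settles_def
proof (intro allI impI)
  fix e :: real
  assume f: "\<forall>e>0. \<exists>X. \<forall>x\<ge>X. \<forall>h w. norm w = 1 \<longrightarrow> norm (descend f h w x - L) < e"
    and g: "\<forall>e>0. \<exists>X. \<forall>x\<ge>X. \<forall>h w. norm w = 1 \<longrightarrow> norm (descend g h w x - M) < e" and "0 < e"
  from f[rule_format, of "e / 2"] g[rule_format, of "e / 2"] \<open>0 < e\<close>
  obtain X Y where *: "\<forall>x\<ge>X. \<forall>h w. norm w = 1 \<longrightarrow> norm (descend f h w x - L) < e / 2"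
    "\<forall>x\<ge>Y. \<forall>h w. norm w = 1 \<longrightarrow> norm (descend g h w x - M) < e / 2" by auto
  have "norm (descend (\<lambda>h w s. f h w s + g h w s) h w x - (L + M)) < e"
    if "max X Y \<le> x" "norm w = 1" for x h w
    unfolding descend_add add_diff_add using * that by (intro norm_add_less[THEN less_le_trans, of _ "e / 2" _ "e / 2"]) auto
  then show "\<exists>X. \<forall>x\<ge>X. \<forall>h w. norm w = 1
      \<longrightarrow> norm (descend (\<lambda>h w s. f h w s + g h w s) h w x - (L + M)) < e" by blast
qed

lemma settles_bounded_linear:
  assumes A: "bounded_linear A" and f: "settles f L"
  shows "settles (\<lambda>h w s. A (f h w s)) (A L)"
  unfolding settles_def
proof (intro allI impI)
  interpret bounded_linear A by fact
  fix e :: real assume "0 < e"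
  obtain K where K: "0 < K" "\<And>x. norm (A x) \<le> norm x * K" using pos_bounded by blast
  obtain X where X: "\<forall>x\<ge>X. \<forall>h w. norm w = 1 \<longrightarrow> norm (descend f h w x - L) < e / K"
    using f \<open>0 < e\<close> K(1) unfolding settles_def by (metis divide_pos_pos)
  have "norm (descend (\<lambda>h w s. A (f h w s)) h w x - A L) < e" if "X \<le> x" "norm w = 1" for x h w
  proof -
    have "norm (A (descend f h w x - L)) \<le> norm (descend f h w x - L) * K" by (rule K)
    also have "\<dots> < e / K * K" using X that K by (intro mult_strict_right_mono) auto
    finally show ?thesis using K by (simp add: descend_linear[OF linear_axioms] diff)
  qed
  then show "\<exists>X. \<forall>x\<ge>X. \<forall>h w. norm w = 1 \<longrightarrow> norm (descend (\<lambda>h w s. A (f h w s)) h w x - A L) < e" by blast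
qed

lemma settles_cong:
  assumes "settles f L" and eq: "\<And>h w s. norm w = 1 \<Longrightarrow> 0 \<le> s \<Longrightarrow> s < \<mu> \<Longrightarrow> f h w s = g h w s"
  shows "settles g L"
  unfolding settles_def
proof (intro allI impI)
  fix e :: real assume "0 < e"
  then obtain X where X: "\<forall>x\<ge>X. \<forall>h w. norm w = 1 \<longrightarrow> norm (descend f h w x - L) < e"
    using assms(1) unfolding settles_def by blast
  have "descend f h w x = descend g h w x" if "norm w = 1" "0 \<le> x" for h w x
  proof -
    have "norm (descend (\<lambda>h w s. f h w s + (- 1) *\<^sub>R g h w s) h w x) \<le> 0"
      using that \<mu> by (intro descend_norm_le) (simp_all add: eq)
    then show ?thesis unfolding descend_add descend_scaleR by simp
  qed
  then have "\<forall>x\<ge>max X 0. \<forall>h w. norm w = 1 \<longrightarrow> norm (descend g h w x - L) < e" using X by (metis max.bounded_iff)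
  then show "\<exists>X. \<forall>x\<ge>X. \<forall>h w. norm w = 1 \<longrightarrow> norm (descend g h w x - L) < e" by blast
qed

text \<open>Whether \<open>u\<close> itself belongs to \<open>U\<close> is left open: differences of such sets are all the
  intervals of sizes, whatever their end points.\<close>

definition upset :: "real \<Rightarrow> real set \<Rightarrow> bool" where
  "upset u U \<longleftrightarrow> 0 \<le> u \<and> {u<..} \<subseteq> U \<and> U \<subseteq> {u..}"

abbreviation box :: "bool \<Rightarrow> (complex \<Rightarrow> real) \<Rightarrow> real set \<Rightarrow> orientation \<times> real \<Rightarrow> real" where
  "box h F U \<equiv> \<lambda>x. indicator {h} (fst (fst x)) * F (snd (fst x)) * indicator U (snd x)"

lemma box_measurable:
  "F \<in> borel_measurable borel \<Longrightarrow> upset u U \<Longrightarrow> box h F U \<in> borel_measurable \<rho>"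
  using upset_borel[of u U] unfolding upset_def
  by (intro measurable_\<rho> measurable_base_product borel_measurable_indicator) auto

lemma integral_box:
  assumes "F \<in> borel_measurable borel" "\<And>w. norm w = 1 \<Longrightarrow> \<bar>F w\<bar> \<le> B" "upset u U"
  shows "(LINT x|\<rho>. box h F U x) = (LINT w|circle_measure. indicator (sphere 0 1) w * F w) * tail_limit u"
proof -
  have U: "0 \<le> u" "{u<..} \<subseteq> U" "U \<subseteq> {u..}" using assms(3) by (auto simp: upset_def)
  have [measurable]: "U \<in> sets borel" using U(2,3) by (rule upset_borel)
  show ?thesis
    using integral_\<rho>_product[OF assms(1) _ assms(2) integral_size_density(2)[OF U], of h]
    by (simp add: integral_size_density(1)[OF U])
qed

lemma upset_0: "upset 0 {0..}" by (auto simp: upset_def)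

lemma tail_limit_0: "tail_limit 0 = 1"
  using mean_pos \<alpha>_pos \<beta>_pos by (simp add: tail_limit_def)

lemma emeasure_\<rho>: "emeasure \<rho> (space \<rho>) = 1"
proof -
  have one: "(LINT x|\<rho>. box h (\<lambda>_. 1) {0..} x) = 1 / 2" for h
  proof -
    have "(LINT x|\<rho>. box h (\<lambda>_. 1) {0..} x) = (LINT w|circle_measure. indicator (sphere 0 1) w * 1) * tail_limit 0"
      by (rule integral_box[where B = 1]) (simp_all add: upset_0)
    moreover have "(LINT w|circle_measure. indicator (sphere 0 1) w * 1) = (1 / 2 :: real)"
      using integral_circle_harmonic[of 1 0] by simp
    ultimately show ?thesis by (simp only: tail_limit_0)
  qed
  \<comment> \<open>The integral of a non-integrable function is 0 by convention, but the value is 1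
    / 2.\<close>
  have int: "integrable \<rho> (box h (\<lambda>_. 1) {0..})" for h
  proof (rule ccontr)
    assume "\<not> integrable \<rho> (box h (\<lambda>_. 1) {0..})"
    from not_integrable_integral_eq[OF this] one[of h] show False by linarith
  qed
  have "(LINT x|\<rho>. 1) = (LINT x|\<rho>. box True (\<lambda>_. 1) {0..} x + box False (\<lambda>_. 1) {0..} x)"
    by (intro Bochner_Integration.integral_cong) (auto simp: mem_X indicator_def)
  also have "\<dots> = 1" unfolding Bochner_Integration.integral_add[OF int int] one by simp
  finally have "measure \<rho> (space \<rho>) = 1" by simp
  \<comment> \<open>The real-valued measure of a set of infinite mass would be 0 by
    convention.\<close>
  then show "emeasure \<rho> (space \<rho>) = 1"
    by (metis emeasure_eq_ennreal_measure ennreal_1 measure_def enn2real_top zero_neq_one)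
qed

lemma measure_\<rho> [simp]: "measure \<rho> X = 1"
  using emeasure_\<rho> by (simp add: measure_def)

sublocale \<rho>: finite_measure \<rho>
  by (rule finite_measureI) (use emeasure_\<rho> in simp)

text \<open>Boundedness on X makes f integrable with respect to \<rho>, so the integral here never
  is a default value.\<close>

definition good :: "(orientation \<times> real \<Rightarrow> real) \<Rightarrow> bool" where
  "good f \<longleftrightarrow> f \<in> borel_measurable \<rho> \<and> (\<exists>B. \<forall>x\<in>X. \<bar>f x\<bar> \<le> B)
     \<and> settles (\<lambda>h w s. f ((h, w), s)) (LINT x|\<rho>. f x)"

lemma integrable_\<rho>: "f \<in> borel_measurable \<rho> \<Longrightarrow> \<forall>x\<in>X. \<bar>f x\<bar> \<le> B \<Longrightarrow> integrable \<rho> f" for f :: "_ \<Rightarrow> real"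
  by (intro \<rho>.integrable_const_bound[of _ B] AE_I2) auto

lemma good_integrable: "good f \<Longrightarrow> integrable \<rho> f"
  unfolding good_def using integrable_\<rho> by blast

lemma good_const: "good (\<lambda>_. m)"
  unfolding good_def settles_def by (auto simp: descend_const)

lemma good_add:
  assumes "good f" "good g"
  shows "good (\<lambda>x. f x + g x)"
proof -
  obtain B C where "\<forall>x\<in>X. \<bar>f x\<bar> \<le> B" "\<forall>x\<in>X. \<bar>g x\<bar> \<le> C" using assms by (auto simp: good_def)
  then have "\<forall>x\<in>X. \<bar>f x + g x\<bar> \<le> B + C" by (meson abs_triangle_ineq add_mono order_trans)
  moreover have "settles (\<lambda>h w s. f ((h, w), s) + g ((h, w), s)) ((LINT x|\<rho>. f x) + (LINT x|\<rho>. g x))"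
    using assms by (intro settles_add) (auto simp: good_def)
  moreover have "(\<lambda>x. f x + g x) \<in> borel_measurable \<rho>"
    using assms by (intro borel_measurable_add) (simp_all add: good_def)
  ultimately show ?thesis
    unfolding good_def Bochner_Integration.integral_add[OF assms[THEN good_integrable]] by blast
qed

lemma good_scale:
  assumes "good f"
  shows "good (\<lambda>x. m * f x)"
proof -
  obtain B where B: "\<forall>x\<in>X. \<bar>f x\<bar> \<le> B" using assms by (auto simp: good_def)
  then have "\<forall>x\<in>X. \<bar>m * f x\<bar> \<le> \<bar>m\<bar> * B"
    unfolding abs_mult by (intro ballI mult_left_mono) (blast, rule abs_ge_zero)
  moreover have "settles (\<lambda>h w s. m * f ((h, w), s)) (m * (LINT x|\<rho>. f x))"
    by (rule settles_bounded_linear[OF bounded_linear_mult_right]) (use assms in \<open>simp add: good_def\<close>)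
  moreover have "(\<lambda>x. m * f x) \<in> borel_measurable \<rho>"
    using assms by (intro borel_measurable_times borel_measurable_const) (simp add: good_def)
  ultimately show ?thesis unfolding good_def integral_mult_right_zero by blast
qed

lemma good_diff: "good f \<Longrightarrow> good g \<Longrightarrow> good (\<lambda>x. f x - g x)"
  using good_add[of f "\<lambda>x. (- 1) * g x"] good_scale[of g "- 1"] by simp

lemma good_sum: "(\<And>i. i \<in> I \<Longrightarrow> good (f i)) \<Longrightarrow> good (\<lambda>x. \<Sum>i\<in>I. f i x)"
  by (induction I rule: infinite_finite_induct) (auto intro: good_const good_add)

lemma good_cong:
  assumes "good f" and eq: "\<And>x. x \<in> X \<Longrightarrow> g x = f x"
  shows "good g"
proof -
  have "g \<in> borel_measurable \<rho>"
    using assms by (subst measurable_cong[of _ _ f]) (auto simp: good_def)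
  moreover have "(LINT x|\<rho>. g x) = (LINT x|\<rho>. f x)"
    by (intro Bochner_Integration.integral_cong) (auto simp: eq)
  moreover have "settles (\<lambda>h w s. g ((h, w), s)) (LINT x|\<rho>. f x)"
    using assms(1) unfolding good_def
    by (elim conjE settles_cong) (simp add: eq mem_X)
  ultimately show ?thesis using assms by (simp add: good_def cong: ball_cong)
qed

text \<open>The approximation may be poor on a part of X as long as a good function r of small
  integral dominates the error: the averages of r are then eventually small too. The four quarters
  of e are spent on the integral of r, which enters twice, and on the convergence of g and of
  r.\<close>

lemma good_approx:
  assumes f: "f \<in> borel_measurable \<rho>" "\<forall>x\<in>X. \<bar>f x\<bar> \<le> B"
    and approx: "\<And>e. 0 < e \<Longrightarrow>
      \<exists>g r. good g \<and> good r \<and> (\<forall>x\<in>X. \<bar>f x - g x\<bar> \<le> r x) \<and> (LINT x|\<rho>. r x) < e"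
  shows "good f"
proof -
  have "settles (\<lambda>h w s. f ((h, w), s)) (LINT x|\<rho>. f x)"
    unfolding settles_def
  proof (intro allI impI)
    fix e :: real assume "0 < e"
    then obtain g r where g: "good g" and r: "good r" and fg: "\<forall>x\<in>X. \<bar>f x - g x\<bar> \<le> r x"
      and small: "(LINT x|\<rho>. r x) < e / 4"
      using approx[of "e / 4"] by auto
    obtain Y where Y: "\<And>x h w. Y \<le> x \<Longrightarrow> norm w = 1
        \<Longrightarrow> norm (descend (\<lambda>h w s. g ((h, w), s)) h w x - (LINT x|\<rho>. g x)) < e / 4"
      using g \<open>0 < e\<close> unfolding good_def settles_def by (metis zero_less_divide_iff zero_less_numeral)
    obtain Z where Z: "\<And>x h w. Z \<le> x \<Longrightarrow> norm w = 1
        \<Longrightarrow> norm (descend (\<lambda>h w s. r ((h, w), s)) h w x - (LINT x|\<rho>. r x)) < e / 4"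
      using r \<open>0 < e\<close> unfolding good_def settles_def by (metis zero_less_divide_iff zero_less_numeral)
    have intf: "integrable \<rho> f" using f by (rule integrable_\<rho>)
    have "\<bar>(LINT x|\<rho>. f x) - (LINT x|\<rho>. g x)\<bar> \<le> (LINT x|\<rho>. r x)"
    proof -
      have "\<bar>(LINT x|\<rho>. f x) - (LINT x|\<rho>. g x)\<bar> = \<bar>LINT x|\<rho>. f x - g x\<bar>"
        using intf good_integrable[OF g] by simp
      also have "\<dots> \<le> (LINT x|\<rho>. \<bar>f x - g x\<bar>)" by (rule integral_abs_bound)
      also have "\<dots> \<le> (LINT x|\<rho>. r x)"
        using intf good_integrable[OF g] good_integrable[OF r] fg by (intro integral_mono) auto
      finally show ?thesis .
    qed
    moreover have "\<bar>descend (\<lambda>h w s. f ((h, w), s)) h w x - descend (\<lambda>h w s. g ((h, w), s)) h w x\<bar>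
        \<le> descend (\<lambda>h w s. r ((h, w), s)) h w x" if "norm w = 1" "0 \<le> x" for h w x
    proof -
      have "f ((h, w), s) \<le> g ((h, w), s) + r ((h, w), s)" "g ((h, w), s) \<le> f ((h, w), s) + r ((h, w), s)"
        if "norm w = 1" "0 \<le> s" "s < \<mu>" for h w s
        using fg[rule_format, of "((h, w), s)"] that by (auto simp: mem_X abs_le_iff)
      then have "descend (\<lambda>h w s. f ((h, w), s)) h w x \<le> descend (\<lambda>h w s. g ((h, w), s) + r ((h, w), s)) h w x"
        "descend (\<lambda>h w s. g ((h, w), s)) h w x \<le> descend (\<lambda>h w s. f ((h, w), s) + r ((h, w), s)) h w x"
        using that \<mu> by (auto intro!: descend_mono)
      then show ?thesis unfolding descend_add abs_le_iff by linarith
    qed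
    ultimately have bounds: "\<bar>(LINT x|\<rho>. f x) - (LINT x|\<rho>. g x)\<bar> \<le> (LINT x|\<rho>. r x)"
      "\<And>h w x. norm w = 1 \<Longrightarrow> 0 \<le> x \<Longrightarrow> \<bar>descend (\<lambda>h w s. f ((h, w), s)) h w x
        - descend (\<lambda>h w s. g ((h, w), s)) h w x\<bar> \<le> descend (\<lambda>h w s. r ((h, w), s)) h w x"
      by blast+
    have "norm (descend (\<lambda>h w s. f ((h, w), s)) h w x - (LINT x|\<rho>. f x)) < e"
      if "max (max Y Z) 0 \<le> x" "norm w = 1" for x h w
    proof -
      have "Y \<le> x" "Z \<le> x" "0 \<le> x" using that by auto
      from Y[OF this(1) that(2), of h] Z[OF this(2) that(2), of h] bounds(1) bounds(2)[OF that(2) this(3), of h] small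
      show ?thesis unfolding real_norm_def by argo
    qed
    then show "\<exists>X. \<forall>x\<ge>X. \<forall>h w. norm w = 1
        \<longrightarrow> norm (descend (\<lambda>h w s. f ((h, w), s)) h w x - (LINT x|\<rho>. f x)) < e" by blast
  qed
  then show ?thesis using f by (auto simp: good_def)
qed

text \<open>The limit of the mode and the integral of the box agree: both are Re \<zeta> times half
  of \<open>tail_limit u\<close> for k = 0, and both vanish otherwise.\<close>

lemma good_harmonic:
  assumes U: "upset u U"
  shows "good (box h (\<lambda>w. Re (\<zeta> * w ^ k)) U)"
proof -
  have cont: "(\<lambda>w. Re (\<zeta> * w ^ k)) \<in> borel_measurable borel"
    by (intro borel_measurable_continuous_onI continuous_intros)
  have bound: "\<bar>Re (\<zeta> * w ^ k)\<bar> \<le> norm \<zeta>" if "norm w = 1" for w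
    using abs_Re_le_cmod[of "\<zeta> * w ^ k"] that by (simp add: norm_mult norm_power)
  have g: "\<bar>indicator U s :: real\<bar> \<le> 1" for s by (simp add: indicator_def)
  have "(overshoot (indicator U) \<longlongrightarrow> tail_limit u) at_top"
  proof (rule overshoot_tail_tendsto[OF ratio])
    show "0 \<le> u" using U by (simp add: upset_def)
    show "tail u s \<le> indicator U s" for s using U by (auto simp: tail_def upset_def indicator_def)
    show "indicator U s = (1::real) \<or> s = u \<and> indicator U s = (0::real)" if "u \<le> s" for s
      using U that by (auto simp: upset_def indicator_def le_less)
    show "indicator U s = (0::real)" if "s < u" for s
      using U that by (auto simp: upset_def indicator_def)
  qed
  then have "settles (mode h k (indicator U)) (of_real (if k = 0 then tail_limit u / 2 else 0))"
    using mode_settles_0[of "indicator U" k h] mode_0_settles[of "indicator U" "tail_limit u" h] g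
    by (cases "k = 0") auto
  then have s: "settles (\<lambda>h' w s. Re (\<zeta> * mode h k (indicator U) h' w s))
      (Re (\<zeta> * of_real (if k = 0 then tail_limit u / 2 else 0)))"
    by (rule settles_bounded_linear[rotated])
      (intro bounded_linear_compose[OF bounded_linear_Re] bounded_linear_mult_right)
  have eq1: "(\<lambda>h' w s. Re (\<zeta> * mode h k (indicator U) h' w s))
      = (\<lambda>h' w s. box h (\<lambda>w. Re (\<zeta> * w ^ k)) U ((h', w), s))"
    by (auto simp: fun_eq_iff mode_def indicator_def)
  have eq2: "Re (\<zeta> * of_real (if k = 0 then tail_limit u / 2 else 0))
      = (LINT x|\<rho>. box h (\<lambda>w. Re (\<zeta> * w ^ k)) U x)"
  proof -
    have "(LINT x|\<rho>. box h (\<lambda>w. Re (\<zeta> * w ^ k)) U x)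
        = (LINT w|circle_measure. indicator (sphere 0 1) w * Re (\<zeta> * w ^ k)) * tail_limit u"
      by (rule integral_box[OF cont bound U])
    then show ?thesis unfolding integral_circle_harmonic by simp
  qed
  have bnd: "\<bar>box h (\<lambda>w. Re (\<zeta> * w ^ k)) U x\<bar> \<le> norm \<zeta>" if "x \<in> X" for x
    using bound[of "snd (fst x)"] that by (auto simp: mem_X indicator_def)
  from s have "settles (\<lambda>h' w s. box h (\<lambda>w. Re (\<zeta> * w ^ k)) U ((h', w), s))
      (LINT x|\<rho>. box h (\<lambda>w. Re (\<zeta> * w ^ k)) U x)" unfolding eq1 eq2 .
  with box_measurable[OF cont U] bnd show ?thesis unfolding good_def by blast
qed

definition angular :: "(complex \<Rightarrow> real) \<Rightarrow> bool" where
  "angular F \<longleftrightarrow> (\<forall>h u U. upset u U \<longrightarrow> good (box h F U))"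

lemma angular_cong: "angular F \<Longrightarrow> (\<And>w. norm w = 1 \<Longrightarrow> G w = F w) \<Longrightarrow> angular G"
  unfolding angular_def
proof (intro allI impI)
  fix h u U assume "\<forall>h u U. upset u U \<longrightarrow> good (box h F U)" "\<And>w. norm w = 1 \<Longrightarrow> G w = F w" "upset u U"
  then show "good (box h G U)" by (intro good_cong[of "box h F U" "box h G U"]) (auto simp: mem_X)
qed

lemma angular_add: "angular F \<Longrightarrow> angular G \<Longrightarrow> angular (\<lambda>w. F w + G w)"
  unfolding angular_def
proof (intro allI impI)
  fix h u U assume "\<forall>h u U. upset u U \<longrightarrow> good (box h F U)" "\<forall>h u U. upset u U \<longrightarrow> good (box h G U)" "upset u U"
  then have "good (\<lambda>x. box h F U x + box h G U x)" by (intro good_add) auto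
  then show "good (box h (\<lambda>w. F w + G w) U)" by (rule good_cong) (simp add: algebra_simps)
qed

lemma angular_scale: "angular F \<Longrightarrow> angular (\<lambda>w. m * F w)"
  unfolding angular_def
proof (intro allI impI)
  fix h u U assume "\<forall>h u U. upset u U \<longrightarrow> good (box h F U)" "upset u U"
  then have "good (\<lambda>x. m * box h F U x)" by (intro good_scale) auto
  then show "good (box h (\<lambda>w. m * F w) U)" by (rule good_cong) simp
qed

lemma angular_trig: "trig F \<Longrightarrow> angular F"
proof (induction rule: trig.induct)
  case (trig_mode f \<zeta> k)
  have "angular (\<lambda>w. Re (\<zeta> * w ^ k))" unfolding angular_def using good_harmonic by blast
  then show ?case by (rule angular_cong) (rule trig_mode)
qed (rule angular_add)

lemma angular_const: "angular (\<lambda>_. m)"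
  by (rule angular_trig, rule trig_mode[of _ "of_real m" 0]) simp

text \<open>Polynomials approximate F uniformly on the circle. F is first cut off to the circle,
  because it may fail to be measurable elsewhere.\<close>

lemma angular_continuous:
  assumes cont: "continuous_on (sphere 0 1) F"
  shows "angular F"
proof -
  define G where "G w = indicator (sphere 0 1) w *\<^sub>R F w" for w
  have G: "G \<in> borel_measurable borel"
    unfolding G_def using cont by (intro borel_measurable_continuous_on_indicator) auto
  obtain B where B: "\<And>w. norm w = 1 \<Longrightarrow> \<bar>F w\<bar> \<le> B"
  proof -
    have "bounded (F ` sphere 0 1)" using cont by (intro compact_imp_bounded compact_continuous_image) auto
    then obtain B where "\<forall>w\<in>sphere 0 1. \<bar>F w\<bar> \<le> B" by (auto simp: bounded_iff)
    then show ?thesis by (intro that[of B]) simp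
  qed
  have "good (box h G U)" if U: "upset u U" for h u U
  proof (rule good_approx)
    show "box h G U \<in> borel_measurable \<rho>" using G U by (rule box_measurable)
    show "\<forall>x\<in>X. \<bar>box h G U x\<bar> \<le> B"
      using B order_trans[OF abs_ge_zero B[of 1]] by (auto simp: mem_X G_def indicator_def)
    fix e :: real assume "0 < e"
    obtain P where P: "real_polynomial_function P" "\<And>w. w \<in> sphere 0 1 \<Longrightarrow> \<bar>F w - P w\<bar> < e / 2"
      using Stone_Weierstrass_real_polynomial_function[OF compact_sphere cont, of "e / 2"] \<open>0 < e\<close> by auto
    have "good (box h P U)" using angular_trig[OF trig_polynomial[OF P(1)]] U by (auto simp: angular_def)
    moreover have "\<bar>box h G U x - box h P U x\<bar> \<le> e / 2" if "x \<in> X" for x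
      using P(2)[of "snd (fst x)"] that \<open>0 < e\<close> by (auto simp: mem_X G_def indicator_def)
    moreover have "(LINT x|\<rho>. e / 2) < e" using \<open>0 < e\<close> by simp
    ultimately show "\<exists>g r. good g \<and> good r \<and> (\<forall>x\<in>X. \<bar>box h G U x - g x\<bar> \<le> r x) \<and> (LINT x|\<rho>. r x) < e"
      using good_const[of "e / 2"] by (intro exI[of _ "box h P U"] exI[of _ "\<lambda>_. e / 2"]) auto
  qed
  then have "angular G" by (auto simp: angular_def)
  then show ?thesis by (rule angular_cong) (simp add: G_def)
qed

end


section \<open>Arcs of the unit circle\<close>

lemma cis_shift: "cis (t + 2 * pi * of_int n) = cis t"
  using cis_multiple_2pi[of "of_int n"] by (simp flip: cis_mult)

lemma cis_eqD:
  assumes "cis x = cis y"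
  shows "\<exists>n::int. x = y + 2 * pi * of_int n"
proof -
  have "cis (x - y) = 1" using assms by (metis cis_divide cis_neq_zero divide_self)
  then have "cos (x - y) = 1" by (metis cis.simps(1) one_complex.simps(1))
  then obtain n :: int where "x - y = of_int n * 2 * pi" by (auto simp: cos_one_2pi_int)
  then show ?thesis by (intro exI[of _ n]) (simp add: algebra_simps)
qed

lemma sphere_subset_cis: "sphere 0 1 \<subseteq> cis ` {l..l + 2 * pi}"
proof
  fix w :: complex assume "w \<in> sphere 0 1"
  then have w: "w = cis (Arg w)" using rcis_cmod_Arg[of w] by (simp add: rcis_def)
  define n where "n = \<lfloor>(Arg w - l) / (2 * pi)\<rfloor>"
  define t where "t = Arg w + 2 * pi * of_int (- n)"
  have "of_int n \<le> (Arg w - l) / (2 * pi)" "(Arg w - l) / (2 * pi) < of_int n + 1"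
    unfolding n_def by linarith+
  then have "of_int n * (2 * pi) \<le> Arg w - l" "Arg w - l < (of_int n + 1) * (2 * pi)"
    by (simp_all only: pos_le_divide_eq pos_divide_less_eq mult_pos_pos zero_less_numeral pi_gt_zero)
  then have "t \<in> {l..l + 2 * pi}" by (simp add: t_def algebra_simps)
  moreover have "cis t = w" unfolding t_def cis_shift using w by simp
  ultimately show "w \<in> cis ` {l..l + 2 * pi}" by blast
qed

text \<open>Two angles of a common point differ by a multiple of 2 pi that lies between 0 and 2 pi;
  either extreme forces an end point.\<close>

lemma complementary_arcs_Int:
  assumes "l \<le> r" "r \<le> l + 2 * pi"
  shows "cis ` {l..r} \<inter> cis ` {r..l + 2 * pi} \<subseteq> {cis l, cis r}"
proof
  fix w assume "w \<in> cis ` {l..r} \<inter> cis ` {r..l + 2 * pi}"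
  then obtain x y where xy: "w = cis x" "w = cis y" "x \<in> {l..r}" "y \<in> {r..l + 2 * pi}" by blast
  then obtain n :: int where n: "y = x + 2 * pi * of_int n" using cis_eqD by metis
  have "0 \<le> y - x" "y - x \<le> 2 * pi" using xy(3,4) by auto
  then have "2 * pi * 0 \<le> 2 * pi * real_of_int n" "2 * pi * real_of_int n \<le> 2 * pi * 1"
    unfolding n by simp_all
  then have "0 \<le> real_of_int n" "real_of_int n \<le> 1"
    by (simp_all only: mult_le_cancel_left_pos mult_pos_pos zero_less_numeral pi_gt_zero)
  then have "n = 0 \<or> n = 1" by auto
  then have "x = r \<or> x = l" using n xy by auto
  then show "w \<in> {cis l, cis r}" using xy(1) by auto
qed

text \<open>Leaves open which end points belong to the arc. An interval with two points at distance
  2 pi or more covers the whole circle and is replaced by a single turn; any other is bounded by its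
  infimum and supremum.\<close>

lemma interval_arc:
  assumes I: "is_interval (I :: real set)"
  obtains l r where "l \<le> r" "r \<le> l + 2 * pi" "cis ` {l<..<r} \<subseteq> cis ` I" "cis ` I \<subseteq> cis ` {l..r}"
proof (cases "I = {}")
  case True
  then show ?thesis by (intro that[of 0 0]) auto
next
  case ne: False
  show ?thesis
  proof (cases "\<exists>x\<in>I. \<exists>y\<in>I. x + 2 * pi \<le> y")
    case True
    then obtain x y where xy: "x \<in> I" "y \<in> I" "x + 2 * pi \<le> y" by blast
    then have "{x<..<x + 2 * pi} \<subseteq> I" using mem_is_interval_1_I[OF I xy(1,2)] by auto
    moreover have "cis ` I \<subseteq> sphere 0 1" by auto
    ultimately show ?thesis using sphere_subset_cis[of x] by (intro that[of x "x + 2 * pi"]) auto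
  next
    case False
    then have near: "y \<le> x + 2 * pi" if "x \<in> I" "y \<in> I" for x y using that by force
    obtain z where z: "z \<in> I" using ne by blast
    have bdd: "bdd_above I" "bdd_below I"
      using near[OF z] near[OF _ z] by (auto intro!: bdd_aboveI[of _ "z + 2 * pi"] bdd_belowI[of _ "z - 2 * pi"] simp: algebra_simps)
    have sub: "I \<subseteq> {Inf I..Sup I}" using bdd by (auto intro: cInf_lower cSup_upper)
    have "Inf I \<le> Sup I" using sub z by auto
    moreover have "Sup I \<le> Inf I + 2 * pi"
    proof -
      have "Sup I - 2 * pi \<le> Inf I"
      proof (rule cInf_greatest[OF ne])
        fix x assume "x \<in> I"
        then have "Sup I \<le> x + 2 * pi" using near by (intro cSup_least[OF ne]) auto
        then show "Sup I - 2 * pi \<le> x" by simp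
      qed
      then show ?thesis by simp
    qed
    moreover have "{Inf I<..<Sup I} \<subseteq> I"
    proof
      fix t assume "t \<in> {Inf I<..<Sup I}"
      then obtain i j where "i \<in> I" "i < t" "j \<in> I" "t < j"
        using bdd ne by (auto simp: cInf_less_iff less_cSup_iff)
      then show "t \<in> I" using mem_is_interval_1_I[OF I, of i j t] by simp
    qed
    ultimately show ?thesis using sub by (intro that[of "Inf I" "Sup I"]) auto
  qed
qed

section \<open>Indicators of arcs, and slicing by size\<close>

context tiling
begin

text \<open>Continuous functions bound the indicator of a compact arc only from above; the lower bound comes
  from the complementary compact arc, which meets the first one in at most two points.\<close>

lemma angular_arc:
  assumes lr: "l \<le> r" "r \<le> l + 2 * pi" and A: "cis ` {l<..<r} \<subseteq> A" "A \<subseteq> cis ` {l..r}"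
  shows "A \<in> sets borel" and "angular (indicator A)"
proof -
  define K1 K2 where "K1 = cis ` {l..r}" and "K2 = cis ` {r..l + 2 * pi}"
  have compact: "compact K1" "compact K2"
    unfolding K1_def K2_def by (intro compact_continuous_image continuous_on_cis continuous_on_id compact_Icc)+
  have closed: "closed K1" "closed K2" using compact by (auto intro: compact_imp_closed)
  have nonempty: "K1 \<noteq> {}" "K2 \<noteq> {}" using lr by (auto simp: K1_def K2_def)
  have Int: "K1 \<inter> K2 \<subseteq> {cis l, cis r}" unfolding K1_def K2_def using lr by (rule complementary_arcs_Int)
  have ends: "cis l \<in> K1" "cis r \<in> K1" "cis r \<in> K2" "cis l \<in> K2"
    using lr cis_shift[of l 1] by (auto simp: K1_def K2_def intro!: rev_image_eqI[of "l + 2 * pi"])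
  have cover: "w \<in> K1 \<or> w \<in> K2" if "norm w = 1" for w
  proof -
    have "{l..l + 2 * pi} = {l..r} \<union> {r..l + 2 * pi}" using lr by auto
    then show ?thesis using sphere_subset_cis[of l] that unfolding K1_def K2_def by (auto simp: image_Un)
  qed
  have K1A: "K1 - A \<subseteq> {cis l, cis r}"
  proof -
    have "{l..r} \<subseteq> {l<..<r} \<union> {l, r}" by auto
    then have "K1 \<subseteq> cis ` {l<..<r} \<union> {cis l, cis r}" unfolding K1_def by (auto simp: less_le)
    then show ?thesis using A(1) by blast
  qed
  have "A = K1 - (K1 - A)" using A(2) by (auto simp: K1_def)
  moreover have "finite (K1 - A)" using K1A by (rule finite_subset) simp
  ultimately show borel: "A \<in> sets borel"
    using closed(1) by (metis borel_closed finite_imp_closed sets.Diff)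
  define \<phi> \<psi> where "\<phi> n w = max 0 (1 - real n * infdist w K1)" and "\<psi> n w = max 0 (1 - real n * infdist w K2)"
    for n and w :: complex
  have cont: "continuous_on T (\<phi> n)" "continuous_on T (\<psi> n)" for n T
    unfolding \<phi>_def \<psi>_def by (intro continuous_intros)+
  \<comment> \<open>On the circle \<open>1 - \<psi> n\<close> lies below the indicator of A and
    \<open>\<phi> n\<close> above it; D n is the gap. It is eventually 0 away from the two end
    points, so its integral tends to 0 by dominated convergence.\<close>
  define D where "D n w = \<phi> n w + \<psi> n w - 1" for n w
  have contD: "continuous_on T (D n)" for n T
    unfolding D_def by (intro continuous_intros cont)
  have D_meas [measurable]: "D n \<in> borel_measurable borel" for n
    by (rule borel_measurable_continuous_onI[OF contD])
  have range: "0 \<le> \<phi> n w" "\<phi> n w \<le> 1" "0 \<le> \<psi> n w" "\<psi> n w \<le> 1" for n w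
    by (auto simp: \<phi>_def \<psi>_def infdist_nonneg)
  have one: "w \<in> K1 \<Longrightarrow> \<phi> n w = 1" "w \<in> K2 \<Longrightarrow> \<psi> n w = 1" for n w
    by (auto simp: \<phi>_def \<psi>_def)
  have zero: "\<forall>\<^sub>F n in sequentially. max 0 (1 - real n * infdist w K) = 0"
    if "closed K" "K \<noteq> {}" "w \<notin> K" for w :: complex and K
  proof -
    have pos: "0 < infdist w K" using that by (simp add: infdist_pos_not_in_closed)
    obtain N :: nat where N: "1 / infdist w K < real N" using reals_Archimedean2 by blast
    have "max 0 (1 - real n * infdist w K) = 0" if "N \<le> n" for n
    proof -
      have "1 / infdist w K \<le> real n" using N that by linarith
      then show ?thesis using pos by (simp add: field_simps)
    qed
    then show ?thesis by (auto simp: eventually_sequentially)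
  qed
  have lim: "(\<lambda>n. D n w) \<longlonglongrightarrow> 0" if w: "norm w = 1" "w \<notin> {cis l, cis r}" for w
  proof (rule tendsto_eventually)
    consider "w \<in> K1" "w \<notin> K2" | "w \<notin> K1" "w \<in> K2" using cover[OF w(1)] Int w(2) by blast
    then show "\<forall>\<^sub>F n in sequentially. D n w = 0"
    proof cases
      case 1
      then show ?thesis
        using zero[OF closed(2) nonempty(2) 1(2)] by (auto simp: D_def one \<psi>_def elim: eventually_mono)
    next
      case 2
      then show ?thesis
        using zero[OF closed(1) nonempty(1) 2(1)] by (auto simp: D_def one \<phi>_def elim: eventually_mono)
    qed
  qed
  have absD: "\<bar>D n w\<bar> \<le> 1" for n w using range[of n w] unfolding D_def abs_le_iff by linarith
  have null: "AE t in lborel. cis t \<notin> {cis l, cis r}"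
  proof -
    have "{t. cis t \<in> {cis l, cis r}} \<subseteq> range (\<lambda>n::int. l + 2 * pi * of_int n) \<union> range (\<lambda>n::int. r + 2 * pi * of_int n)"
      using cis_eqD by blast
    then have "countable {t. cis t \<in> {cis l, cis r}}" by (rule countable_subset) simp
    then have "{t. cis t \<in> {cis l, cis r}} \<in> null_sets lborel" by (rule countable_imp_null_set_lborel)
    then show ?thesis by (rule AE_I') auto
  qed
  have "(\<lambda>n. LINT t|lborel. indicator {0..2 * pi} t * (indicator (sphere 0 1) (cis t) * D n (cis t)))
      \<longlonglongrightarrow> (LINT t|(lborel :: real measure). (0::real))"
  proof (rule integral_dominated_convergence[where w = "indicator {0..2 * pi}"])
    show "AE t in lborel. (\<lambda>n. indicator {0..2 * pi} t * (indicator (sphere 0 1) (cis t) * D n (cis t))) \<longlonglongrightarrow> 0"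
      using null
    proof eventually_elim
      case (elim t)
      show ?case using lim[of "cis t"] elim by (cases "t \<in> {0..2 * pi}") (simp_all add: indicator_def)
    qed
    show "AE t in lborel. norm (indicator {0..2 * pi} t * (indicator (sphere 0 1) (cis t) * D n (cis t)))
        \<le> indicator {0..2 * pi} t" for n
      using absD by (auto simp: indicator_def)
    show "(\<lambda>t. indicator {0..2 * pi} t * (indicator (sphere 0 1) (cis t) * D n (cis t))) \<in> borel_measurable lborel" for n
      by simp
  qed simp_all
  then have "(\<lambda>n. (LINT t|lborel. indicator {0..2 * pi} t * (indicator (sphere 0 1) (cis t) * D n (cis t))) / (4 * pi))
      \<longlonglongrightarrow> 0 / (4 * pi)"
    by (intro tendsto_divide tendsto_const) simp_all
  moreover have "(\<lambda>w. indicator (sphere 0 1) w * D n w) \<in> borel_measurable borel" for n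
    by (intro borel_measurable_times borel_measurable_indicator D_meas) simp
  ultimately have small: "(\<lambda>n. LINT w|circle_measure. indicator (sphere 0 1) w * D n w) \<longlonglongrightarrow> 0"
    by (simp add: integral_circle_measure)
  show "angular (indicator A)"
    unfolding angular_def
  proof (intro allI impI)
    fix h u U assume U: "upset u U"
    have ind: "indicator A \<in> borel_measurable borel" using borel by simp
    show "good (box h (indicator A) U)"
    proof (rule good_approx[where B = 1])
      show "box h (indicator A) U \<in> borel_measurable \<rho>" using ind U by (rule box_measurable)
      show "\<forall>x\<in>X. \<bar>box h (indicator A) U x\<bar> \<le> 1" by (simp add: indicator_def)
      fix e :: real assume "0 < e"
      have "(\<lambda>n. (LINT w|circle_measure. indicator (sphere 0 1) w * D n w) * tail_limit u) \<longlonglongrightarrow> 0 * tail_limit u"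
        using small by (intro tendsto_mult tendsto_const)
      then have "\<forall>\<^sub>F n in sequentially. (LINT w|circle_measure. indicator (sphere 0 1) w * D n w) * tail_limit u < e"
        using \<open>0 < e\<close> by (simp add: order_tendstoD(2))
      then obtain n where n: "(LINT w|circle_measure. indicator (sphere 0 1) w * D n w) * tail_limit u < e"
        by (meson eventually_sequentially order_refl)
      have "(LINT x|\<rho>. box h (D n) U x) = (LINT w|circle_measure. indicator (sphere 0 1) w * D n w) * tail_limit u"
        by (rule integral_box[OF D_meas absD U])
      moreover have "good (box h (\<phi> n) U)" "good (box h (D n) U)"
        using angular_continuous[OF cont(1)] angular_continuous[OF contD] U by (auto simp: angular_def)
      moreover have "\<bar>box h (indicator A) U x - box h (\<phi> n) U x\<bar> \<le> box h (D n) U x" if "x \<in> X" for x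
      proof -
        let ?w = "snd (fst x)"
        have w: "norm ?w = 1" using that by (simp add: mem_X)
        have "\<bar>indicator A ?w - \<phi> n ?w\<bar> \<le> D n ?w"
        proof (cases "?w \<in> K1")
          case True
          then show ?thesis
            using K1A ends one(1)[OF True, of n] one(2)[of ?w n] range(3)[of n ?w] by (auto simp: D_def indicator_def)
        next
          case False
          then have "?w \<in> K2" "?w \<notin> A" using cover[OF w] A(2) by (auto simp: K1_def)
          then show ?thesis using one(2)[of ?w n] range(1)[of n ?w] by (simp add: D_def)
        qed
        then show ?thesis by (auto simp: indicator_def)
      qed
      ultimately show "\<exists>g r. good g \<and> good r \<and> (\<forall>x\<in>X. \<bar>box h (indicator A) U x - g x\<bar> \<le> r x) \<and> (LINT x|\<rho>. r x) < e"
        using n by (intro exI[of _ "box h (\<phi> n) U"] exI[of _ "box h (D n) U"]) auto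
    qed
  qed
qed

text \<open>With the size argument of G frozen at t, the function is a sum of two boxes, one for
  each handedness.\<close>

lemma good_angular:
  assumes "\<And>h. angular (\<lambda>w. G ((h, w), t))" and U: "upset u U"
  shows "good (\<lambda>x. G (fst x, t) * indicator U (snd x))"
proof -
  have "good (\<lambda>x. box True (\<lambda>w. G ((True, w), t)) U x + box False (\<lambda>w. G ((False, w), t)) U x)"
    using assms by (intro good_add) (auto simp: angular_def)
  then show ?thesis
  proof (rule good_cong)
    fix x :: "orientation \<times> real"
    show "G (fst x, t) * indicator U (snd x)
        = box True (\<lambda>w. G ((True, w), t)) U x + box False (\<lambda>w. G ((False, w), t)) U x"
      by (cases x; cases "fst (fst x)") auto
  qed
qed

lemma upset_Int: "upset u U \<Longrightarrow> 0 \<le> t \<Longrightarrow> upset (max u t) (U \<inter> {t..})"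
  by (auto simp: upset_def max_def)

text \<open>A Riemann sum in the size: on each slice G is replaced by its value at the lower end.
  Uniform continuity is available only below v < \<mu>; above v the error is at most B, and the mass
  is small. The jump at the boundary of U is reproduced exactly by the sum.\<close>

lemma good_slices:
  assumes meas: "(\<lambda>x. G x * indicator U (snd x)) \<in> borel_measurable \<rho>"
    and U: "upset u U"
    and B: "\<And>x. x \<in> X \<Longrightarrow> \<bar>G x\<bar> \<le> B"
    and ang: "\<And>h t. 0 \<le> t \<Longrightarrow> t < \<mu> \<Longrightarrow> angular (\<lambda>w. G ((h, w), t))"
    and unif: "\<And>v e. 0 < v \<Longrightarrow> v < \<mu> \<Longrightarrow> 0 < e \<Longrightarrow> \<exists>\<eta>>0. \<forall>h w. norm w = 1 \<longrightarrow>
      (\<forall>s\<in>{0..v}. \<forall>t\<in>{0..v}. \<bar>s - t\<bar> < \<eta> \<longrightarrow> \<bar>G ((h, w), s) - G ((h, w), t)\<bar> < e)"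
  shows "good (\<lambda>x. G x * indicator U (snd x))"
proof (rule good_approx[where B = B])
  have B0: "0 \<le> B" using order_trans[OF abs_ge_zero B[of "((True, 1), 0)"]] \<mu> by (simp add: mem_X)
  show "\<forall>x\<in>X. \<bar>G x * indicator U (snd x)\<bar> \<le> B" using B B0 by (auto simp: indicator_def)
  show "(\<lambda>x. G x * indicator U (snd x)) \<in> borel_measurable \<rho>" by (rule meas)
  fix e :: real assume e: "0 < e"
  define m where "m = a\<^sup>2 / c\<^sup>2 * size_alpha a c + b\<^sup>2 / c\<^sup>2 * size_beta b c"
  have m: "0 < m" using mean_pos by (simp add: m_def)
  \<comment> \<open>Sizes from \<mu> - d on have mass at most d / m, and B * (d / m) \<le> e / 4; B
    + 1 in the denominator covers the case B = 0.\<close>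
  define d where "d = min (\<mu> / 2) (e * m / (4 * (B + 1)))"
  have d: "0 < d" "d < \<mu>" using \<mu> e m B0 by (auto simp: d_def)
  have dB: "B * (d / m) \<le> e / 4"
  proof -
    have "d \<le> e * m / (4 * (B + 1))" by (simp add: d_def)
    then have "(B + 1) * d \<le> e * m / 4" using B0 by (simp add: field_simps)
    moreover have "B * d \<le> (B + 1) * d" using d by (intro mult_right_mono) auto
    ultimately show ?thesis using m by (simp add: field_simps)
  qed
  define v where "v = \<mu> - d"
  have v: "0 < v" "v < \<mu>" using d by (auto simp: v_def)
  obtain \<eta> where \<eta>: "0 < \<eta>" "\<And>h w s t. norm w = 1 \<Longrightarrow> s \<in> {0..v} \<Longrightarrow> t \<in> {0..v} \<Longrightarrow> \<bar>s - t\<bar> < \<eta>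
      \<Longrightarrow> \<bar>G ((h, w), s) - G ((h, w), t)\<bar> < e / 4"
    using unif[OF v, of "e / 4"] e by auto
  obtain n :: nat where n: "v / \<eta> < real n" using reals_Archimedean2 by blast
  have n0: "0 < n" using n v \<eta>(1) by (metis divide_pos_pos gr0I less_asym of_nat_0)
  define k where "k = v / real n"
  have k: "0 < k" "k < \<eta>" "real n * k = v" using n n0 v \<eta>(1) by (auto simp: k_def field_simps)
  \<comment> \<open>\<open>P i i - P i (Suc i)\<close> lives on the slice between i k and (i + 1) k.
    Slices are written as differences because goodness is available for
    \<open>upset\<close>s.\<close>
  define P where "P i j x = G (fst x, real i * k) * indicator (U \<inter> {real j * k..}) (snd x)" for i j and x :: "orientation \<times> real"
  define g where "g x = (\<Sum>i<n. P i i x - P i (Suc i) x)" for x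
  define r where "r x = e / 4 + B * (indicator {v..} (snd x) :: real)" for x :: "orientation \<times> real"
  have goodP: "good (P i j)" if "i < n" for i j
  proof -
    have "real i * k < real n * k" using that k(1) by simp
    then have "real i * k < \<mu>" using k(3) v by linarith
    then show ?thesis
      unfolding P_def using ang k by (intro good_angular[OF _ upset_Int[OF U]]) auto
  qed
  have "good g" unfolding g_def using goodP by (intro good_sum good_diff) auto
  have upv: "upset v {v..}" using v by (auto simp: upset_def)
  have goodv: "good (\<lambda>x. indicator {v..} (snd x))"
    using good_angular[of "\<lambda>_. 1" 0 v "{v..}"] angular_const upv by simp
  then have "good r" unfolding r_def by (intro good_add good_const good_scale)
  have "(LINT x|\<rho>. indicator {v..} (snd x)) = tail_limit v"
  proof -
    have one: "(LINT x|\<rho>. box h (\<lambda>_. 1) {v..} x) = 1 / 2 * tail_limit v" for h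
    proof -
      have "(LINT x|\<rho>. box h (\<lambda>_. 1) {v..} x) = (LINT w|circle_measure. indicator (sphere 0 1) w * 1) * tail_limit v"
        by (rule integral_box[where B = 1]) (simp_all add: upv)
      moreover have "(LINT w|circle_measure. indicator (sphere 0 1) w * 1) = (1 / 2 :: real)"
        using integral_circle_harmonic[of 1 0] by simp
      ultimately show ?thesis by (simp only:)
    qed
    have int: "integrable \<rho> (box h (\<lambda>_. 1) {v..})" for h
      using angular_const[of 1] upv by (intro good_integrable) (auto simp: angular_def)
    have "(LINT x|\<rho>. indicator {v..} (snd x)) = (LINT x|\<rho>. box True (\<lambda>_. 1) {v..} x + box False (\<lambda>_. 1) {v..} x)"
      by (intro Bochner_Integration.integral_cong) (auto simp: indicator_def)
    also have "\<dots> = 1 / 2 * tail_limit v + 1 / 2 * tail_limit v"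
      unfolding Bochner_Integration.integral_add[OF int int] one ..
    finally show ?thesis by simp
  qed
  moreover have "tail_limit v \<le> d / m"
  proof -
    have "max 0 (size_alpha a c - \<mu>) = 0" "max 0 (size_beta b c - \<mu>) = 0" using \<mu> by auto
    then have "tail_limit \<mu> = 0" unfolding tail_limit_def by (simp only: mult_zero_right add_0_left div_0)
    then show ?thesis using tail_limit_lipschitz[of d v] d by (simp add: v_def m_def)
  qed
  ultimately have "B * (LINT x|\<rho>. indicator {v..} (snd x)) \<le> e / 4"
    using order_trans[OF mult_left_mono[OF _ B0] dB] by metis
  then have small: "(LINT x|\<rho>. r x) < e"
    unfolding r_def using good_integrable[OF goodv] e by simp
  have "\<bar>G x * indicator U (snd x) - g x\<bar> \<le> r x" if "x \<in> X" for x
  proof -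
    obtain h w s where x: "x = ((h, w), s)" by (cases x) auto
    have w: "norm w = 1" and s: "0 \<le> s" "s < \<mu>" using that by (auto simp: x mem_X)
    have piece: "P i i x - P i (Suc i) x
        = (if real i * k \<le> s \<and> s < real (Suc i) * k then G ((h, w), real i * k) * indicator U s else 0)" for i
    proof -
      have "real i * k \<le> real (Suc i) * k" using k by simp
      then show ?thesis by (auto simp: P_def x indicator_def)
    qed
    show ?thesis
    proof (cases "s < v")
      case True
      define j where "j = nat \<lfloor>s / k\<rfloor>"
      have "0 \<le> s / k" using s k by simp
      then have "real j \<le> s / k" "s / k < real j + 1" unfolding j_def by linarith+
      then have j: "real j * k \<le> s" "s < real (Suc j) * k" using k by (simp_all add: field_simps)
      have "real j * k < real n * k" using j(1) True k by linarith
      then have jn: "j < n" using k(1) by simp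
      have uniq: "real i * k \<le> s \<and> s < real (Suc i) * k \<longleftrightarrow> i = j" for i
      proof
        assume i: "real i * k \<le> s \<and> s < real (Suc i) * k"
        then have "real i * k < real (Suc j) * k" "real j * k < real (Suc i) * k" using j by linarith+
        then have "i < Suc j" "j < Suc i" using k by (simp_all only: mult_less_cancel_right_pos of_nat_less_iff)
        then show "i = j" by simp
      qed (use j in simp)
      have "g x = G ((h, w), real j * k) * indicator U s"
        unfolding g_def piece uniq using jn by (simp add: sum.delta)
      moreover have "\<bar>G ((h, w), s) - G ((h, w), real j * k)\<bar> < e / 4"
        using j k True s by (intro \<eta>(2) w) (auto simp: algebra_simps)
      ultimately show ?thesis using True e by (auto simp: x r_def indicator_def)
    next
      case False
      have "P i i x - P i (Suc i) x = 0" if "i < n" for i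
      proof -
        have "real (Suc i) * k \<le> real n * k" using that k by (intro mult_right_mono) auto
        then show ?thesis unfolding piece using False k by auto
      qed
      then have "g x = 0" by (simp add: g_def)
      then show ?thesis using B[OF that] B0 False e by (auto simp: x r_def indicator_def)
    qed
  qed
  with \<open>good g\<close> \<open>good r\<close> small
  show "\<exists>g r. good g \<and> good r \<and> (\<forall>x\<in>X. \<bar>G x * indicator U (snd x) - g x\<bar> \<le> r x) \<and> (LINT x|\<rho>. r x) < e"
    by blast
qed

end


section \<open>Continuous functions, rectangles and supertiles\<close>

context tiling
begin

text \<open>For v < \<mu> the circle times [0, v] is compact, which gives uniform continuity for
  each handedness; the smaller of the two moduli serves both.\<close>

lemma good_continuous:
  assumes f: "continuous_on X f" and bdd: "bounded (f ` X)"
  shows "good f"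
proof -
  obtain B where B: "\<And>x. x \<in> X \<Longrightarrow> \<bar>f x\<bar> \<le> B" using bdd by (auto simp: bounded_iff)
  have meas: "f \<in> borel_measurable \<rho>" using f by (rule measurable_continuous)
  have "good (\<lambda>x. f x * indicator {0..} (snd x))"
  proof (rule good_slices[OF _ upset_0 B])
    show "(\<lambda>x. f x * indicator {0..} (snd x)) \<in> borel_measurable \<rho>"
      using meas by (subst measurable_cong[of _ _ f]) (auto simp: mem_X)
    show "angular (\<lambda>w. f ((h, w), t))" if "0 \<le> t" "t < \<mu>" for h t
      by (intro angular_continuous continuous_on_compose2[OF f]) (use that in \<open>auto intro!: continuous_intros simp: mem_X\<close>)
    fix v e :: real assume v: "0 < v" "v < \<mu>" and e: "0 < e"
    have "\<exists>\<eta>>0. \<forall>w. norm w = 1 \<longrightarrow> (\<forall>s\<in>{0..v}. \<forall>t\<in>{0..v}. \<bar>s - t\<bar> < \<eta>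
        \<longrightarrow> \<bar>f ((h, w), s) - f ((h, w), t)\<bar> < e)" for h
    proof -
      have "continuous_on (sphere 0 1 \<times> {0..v}) (\<lambda>y. f ((h, fst y), snd y))"
        by (rule continuous_on_compose2[OF f]) (use v in \<open>auto intro!: continuous_intros simp: mem_X\<close>)
      then have "uniformly_continuous_on (sphere 0 1 \<times> {0..v}) (\<lambda>y. f ((h, fst y), snd y))"
        by (intro compact_uniformly_continuous compact_Times) auto
      then obtain \<eta> where \<eta>: "0 < \<eta>" "\<And>y z. y \<in> sphere 0 1 \<times> {0..v} \<Longrightarrow> z \<in> sphere 0 1 \<times> {0..v} \<Longrightarrow> dist z y < \<eta>
          \<Longrightarrow> dist (f ((h, fst z), snd z)) (f ((h, fst y), snd y)) < e"
        using e unfolding uniformly_continuous_on_def by metis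
      have "\<bar>f ((h, w), s) - f ((h, w), t)\<bar> < e" if "norm w = 1" "s \<in> {0..v}" "t \<in> {0..v}" "\<bar>s - t\<bar> < \<eta>" for w s t
        using \<eta>(2)[of "(w, t)" "(w, s)"] that by (simp add: dist_Pair_Pair dist_real_def)
      with \<eta>(1) show ?thesis by blast
    qed
    then obtain \<eta> where \<eta>: "\<And>h. 0 < \<eta> h" "\<And>h w s t. norm w = 1 \<Longrightarrow> s \<in> {0..v} \<Longrightarrow> t \<in> {0..v} \<Longrightarrow> \<bar>s - t\<bar> < \<eta> h
        \<Longrightarrow> \<bar>f ((h, w), s) - f ((h, w), t)\<bar> < e"
      by metis
    have "min (\<eta> True) (\<eta> False) \<le> \<eta> h" for h by (cases h) auto
    then have "\<bar>f ((h, w), s) - f ((h, w), t)\<bar> < e"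
      if "norm w = 1" "s \<in> {0..v}" "t \<in> {0..v}" "\<bar>s - t\<bar> < min (\<eta> True) (\<eta> False)" for h w s t
      using \<eta>(2)[OF that(1-3), of h] that(4) by (meson less_le_trans)
    then show "\<exists>\<eta>>0. \<forall>h w. norm w = 1 \<longrightarrow> (\<forall>s\<in>{0..v}. \<forall>t\<in>{0..v}. \<bar>s - t\<bar> < \<eta>
        \<longrightarrow> \<bar>f ((h, w), s) - f ((h, w), t)\<bar> < e)"
      using \<eta>(1) by (intro exI[of _ "min (\<eta> True) (\<eta> False)"]) auto
  qed
  then show ?thesis by (rule good_cong) (simp add: mem_X)
qed

lemma continuous_exp_size: "continuous_on T (\<lambda>x :: orientation \<times> real. exp (m * snd x))"
  by (intro continuous_intros)

lemma exp_size_bounds: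
  assumes "x \<in> X" "0 \<le> m"
  shows "0 < exp (m * snd x)" "exp (m * snd x) \<le> exp (m * \<mu>)"
proof -
  have "m * snd x \<le> m * \<mu>" using assms by (intro mult_left_mono) (auto simp: mem_X)
  then show "exp (m * snd x) \<le> exp (m * \<mu>)" by simp
qed simp

text \<open>The exponent m = 0 serves the area weights, and m = 2 serves the equal weights.\<close>

lemma good_continuous_exp:
  assumes f: "continuous_on X f" and bdd: "bounded (f ` X)" and m: "0 \<le> m"
  shows "good (\<lambda>x. f x * exp (m * snd x))"
proof (rule good_continuous)
  show "continuous_on X (\<lambda>x. f x * exp (m * snd x))"
    by (intro continuous_on_mult f continuous_exp_size)
  obtain B where B: "\<forall>x\<in>X. \<bar>f x\<bar> \<le> B" using bdd by (auto simp: bounded_iff)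
  have "norm (f x * exp (m * snd x)) \<le> B * exp (m * \<mu>)" if "x \<in> X" for x
    unfolding norm_mult using B that exp_size_bounds[OF that m] by (intro mult_mono) (auto intro: order_trans[OF abs_ge_zero])
  then show "bounded ((\<lambda>x. f x * exp (m * snd x)) ` X)" unfolding bounded_iff by blast
qed

lemma exp_Lipschitz:
  fixes s t m v :: real
  assumes "0 \<le> m" "0 \<le> v" "s \<in> {0..v}" "t \<in> {0..v}"
  shows "\<bar>exp (m * s) - exp (m * t)\<bar> \<le> exp (m * v) * m * \<bar>s - t\<bar>"
proof -
  have "norm (exp (m * s) - exp (m * t)) \<le> (exp (m * v) * m) * norm (s - t)"
  proof (rule field_differentiable_bound[of "{0..v}" "\<lambda>s. exp (m * s)" "\<lambda>s. exp (m * s) * m"])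
    show "((\<lambda>s. exp (m * s)) has_field_derivative exp (m * z) * m) (at z within {0..v})" for z
      by (auto intro!: derivative_eq_intros)
    show "norm (exp (m * z) * m) \<le> exp (m * v) * m" if "z \<in> {0..v}" for z
      using that assms by (auto simp: abs_mult intro!: mult_right_mono mult_left_mono)
  qed (use assms in auto)
  then show ?thesis by simp
qed

text \<open>The only jump in the size comes from J, which is the difference of two
  \<open>upset\<close>s: the sizes that reach some element of J, and those that exceed every
  element. This covers all choices of end points. The remaining factor G is Lipschitz in the size
  below v and has an arc as its angular part.\<close>

lemma good_rectangle_exp:
  assumes R: "is_rectangle a b c R" and m: "0 \<le> m"
  shows "good (\<lambda>x. indicator R x * exp (m * snd x))"
proof -
  obtain h I J where I: "is_interval (I :: real set)" and J: "is_interval (J :: real set)" "J \<subseteq> {0..<\<mu>}"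
    and R': "R = ({h} \<times> cis ` I) \<times> J"
    using R unfolding is_rectangle_def \<mu>_eq by blast
  obtain l r where lr: "l \<le> r" "r \<le> l + 2 * pi" "cis ` {l<..<r} \<subseteq> cis ` I" "cis ` I \<subseteq> cis ` {l..r}"
    using interval_arc[OF I] .
  define G where "G x = indicator {h} (fst (fst x)) * indicator (cis ` I) (snd (fst x)) * exp (m * snd x)"
    for x :: "orientation \<times> real"
  have slice: "good (\<lambda>x. G x * indicator U (snd x))" if U: "upset u U" for u U
  proof (rule good_slices[where B = "exp (m * \<mu>)", OF _ U])
    have "U \<in> sets borel" using upset_borel[of u U] U by (simp add: upset_def)
    then have "(\<lambda>s. exp (m * s) * indicator U s) \<in> borel_measurable borel"
      by (intro borel_measurable_times borel_measurable_indicator borel_measurable_continuous_onI continuous_intros)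
    moreover have "indicator (cis ` I) \<in> borel_measurable borel"
      using angular_arc(1)[OF lr] by (rule borel_measurable_indicator)
    ultimately show "(\<lambda>x. G x * indicator U (snd x)) \<in> borel_measurable \<rho>"
      unfolding G_def mult.assoc[of _ "exp (m * snd _)"] by (intro measurable_\<rho> measurable_base_product)
    show "\<bar>G x\<bar> \<le> exp (m * \<mu>)" if "x \<in> X" for x
      using exp_size_bounds[OF that m] by (simp add: G_def indicator_def)
    show "angular (\<lambda>w. G ((h', w), t))" for h' t
    proof -
      have "angular (\<lambda>w. indicator {h} h' * exp (m * t) * indicator (cis ` I) w)"
        using angular_arc(2)[OF lr] by (rule angular_scale)
      then show ?thesis by (rule angular_cong) (simp add: G_def)
    qed
    fix v e :: real assume v: "0 < v" "v < \<mu>" and e: "0 < e"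
    \<comment> \<open>\<open>exp (m * v) * m\<close> is a Lipschitz constant on [0, v]; the summand
      1 keeps the denominator positive for m = 0.\<close>
    define \<eta> where "\<eta> = e / (exp (m * v) * m + 1)"
    have pos: "0 < exp (m * v) * m + 1" using m by (simp add: add_nonneg_pos)
    have "\<bar>G ((h', w), s) - G ((h', w), t)\<bar> < e"
      if "s \<in> {0..v}" "t \<in> {0..v}" "\<bar>s - t\<bar> < \<eta>" for h' w s t
    proof -
      have "\<bar>G ((h', w), s) - G ((h', w), t)\<bar> \<le> \<bar>exp (m * s) - exp (m * t)\<bar>"
        by (simp add: G_def indicator_def)
      also have "\<dots> \<le> exp (m * v) * m * \<bar>s - t\<bar>" using that v m by (intro exp_Lipschitz) auto
      also have "\<dots> \<le> (exp (m * v) * m + 1) * \<bar>s - t\<bar>" by (intro mult_right_mono) auto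
      also have "\<dots> < (exp (m * v) * m + 1) * \<eta>" using that(3) pos by (rule mult_strict_left_mono)
      also have "\<dots> = e" using pos by (simp add: \<eta>_def)
      finally show ?thesis .
    qed
    moreover have "0 < \<eta>" using e pos by (simp add: \<eta>_def)
    ultimately show "\<exists>\<eta>>0. \<forall>h w. norm w = 1 \<longrightarrow> (\<forall>s\<in>{0..v}. \<forall>t\<in>{0..v}. \<bar>s - t\<bar> < \<eta>
        \<longrightarrow> \<bar>G ((h, w), s) - G ((h, w), t)\<bar> < e)" by blast
  qed
  show ?thesis
  proof (cases "J = {}")
    case True
    then show ?thesis using good_const[of 0] by (simp add: R')
  next
    case False
    define U1 where "U1 = {s. \<exists>j\<in>J. j \<le> s}"
    define U2 where "U2 = {s. \<forall>j\<in>J. j < s}"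
    have bdd: "bdd_below J" "bdd_above J" using J(2) by (auto intro!: bdd_belowI[of _ 0] bdd_aboveI[of _ \<mu>])
    have pos: "0 \<le> Inf J" using J(2) False by (intro cInf_greatest) auto
    have "Inf J \<le> Sup J" using bdd False by (meson all_not_in_conv cInf_lower cSup_upper order_trans)
    have "upset (Inf J) U1"
      unfolding upset_def
    proof (intro conjI subsetI pos)
      show "s \<in> U1" if "s \<in> {Inf J<..}" for s
        using that bdd False by (auto simp: U1_def cInf_less_iff intro: less_imp_le)
      show "s \<in> {Inf J..}" if "s \<in> U1" for s
        using that bdd by (auto simp: U1_def intro: order_trans[OF cInf_lower])
    qed
    moreover have "upset (Sup J) U2"
      unfolding upset_def
    proof (intro conjI subsetI)
      show "0 \<le> Sup J" using pos \<open>Inf J \<le> Sup J\<close> by simp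
      show "s \<in> U2" if "s \<in> {Sup J<..}" for s
        using that bdd by (auto simp: U2_def intro: le_less_trans[OF cSup_upper])
      show "s \<in> {Sup J..}" if "s \<in> U2" for s
        unfolding atLeast_iff
        by (rule cSup_least[OF False]) (use that in \<open>auto simp: U2_def intro: less_imp_le\<close>)
    qed
    ultimately have diff: "good (\<lambda>x. G x * indicator U1 (snd x) - G x * indicator U2 (snd x))"
      using slice by (intro good_diff) blast+
    have "s \<in> J \<longleftrightarrow> s \<in> U1 \<and> s \<notin> U2" for s
    proof
      assume "s \<in> U1 \<and> s \<notin> U2"
      then obtain i j where "i \<in> J" "i \<le> s" "j \<in> J" "s \<le> j" by (auto simp: U1_def U2_def not_less)
      then show "s \<in> J" using mem_is_interval_1_I[OF J(1), of i j s] by simp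
    qed (auto simp: U1_def U2_def)
    moreover have "U2 \<subseteq> U1" using False by (auto simp: U1_def U2_def intro: less_imp_le)
    ultimately have "indicator J s = (indicator U1 s - indicator U2 s :: real)" for s
      by (auto simp: indicator_def)
    then have "G x * indicator U1 (snd x) - G x * indicator U2 (snd x) = indicator R x * exp (m * snd x)" for x
      by (cases x; cases "fst x") (auto simp: R' G_def indicator_times right_diff_distrib[symmetric])
    with diff show ?thesis by simp
  qed
qed

lemma integral_exp_\<rho>:
  "(LINT x|\<rho>. exp (2 * snd x)) = 2 * c\<^sup>2 / (a\<^sup>2 * size_alpha a c + b\<^sup>2 * size_beta b c)" (is "_ = ?K")
proof -
  let ?f = "\<lambda>h x. indicator {h} (fst (fst x)) * 1 * exp (2 * snd x)"
  have exp: "(\<lambda>s :: real. exp (2 * s)) \<in> borel_measurable borel"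
    by (intro borel_measurable_continuous_onI continuous_intros)
  have one: "(LINT x|\<rho>. ?f h x) = 1 / 2 * ?K" for h
  proof -
    have "(LINT x|\<rho>. ?f h x) = (LINT w|circle_measure. indicator (sphere 0 1) w * 1)
        * (LINT s|lborel. indicator {0..<\<mu>} s * size_density s * exp (2 * s))"
      by (rule integral_\<rho>_product[where B = 1, OF _ exp _ integrable_size_density_exp]) simp_all
    moreover have "(LINT w|circle_measure. indicator (sphere 0 1) w * 1) = (1 / 2 :: real)"
      using integral_circle_harmonic[of 1 0] by simp
    ultimately show ?thesis by (simp only: integral_size_density_exp)
  qed
  have "integrable \<rho> (?f h)" for h
  proof (rule integrable_\<rho>[where B = "exp (2 * \<mu>)"])
    show "?f h \<in> borel_measurable \<rho>" using exp by (intro measurable_\<rho> measurable_base_product) auto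
    show "\<forall>x\<in>X. \<bar>?f h x\<bar> \<le> exp (2 * \<mu>)" using exp_size_bounds[of _ 2] by (simp add: indicator_def)
  qed
  note int = Bochner_Integration.integral_add[OF this this]
  have "(LINT x|\<rho>. exp (2 * snd x)) = (LINT x|\<rho>. ?f True x + ?f False x)"
    by (intro Bochner_Integration.integral_cong) (auto simp: indicator_def)
  then show ?thesis unfolding int one by simp
qed

text \<open>The averages are descents from x = t n minus the size of the initial tile. Since these
  sizes stay below \<mu>, x tends to infinity, and uniformity absorbs the arbitrary
  orientations.\<close>

lemma area_average_tendsto:
  assumes S: "supertile_sequence a b c S" and f: "good f"
  shows "(\<lambda>n. tile_area_average c f (S n)) \<longlonglongrightarrow> (LINT x|\<rho>. f x)"
proof -
  obtain \<tau> t where \<tau>: "\<And>n. is_tile a b c (\<tau> n)" "\<And>n. tile_size c (\<tau> n) \<in> {0..<\<mu>}"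
    and t: "filterlim t at_top sequentially" and inf: "\<And>n. inflates_to c (t n) {#\<tau> n#} (S n)"
    using S unfolding supertile_sequence_def \<mu>_eq by blast
  have "filterlim (\<lambda>n. t n - tile_size c (\<tau> n)) at_top sequentially"
  proof (rule filterlim_at_top_mono)
    show "filterlim (\<lambda>n. t n + (- \<mu>)) at_top sequentially"
      by (rule filterlim_compose[OF filterlim_add_const_at_top t])
    show "\<forall>\<^sub>F n in sequentially. t n + - \<mu> \<le> t n - tile_size c (\<tau> n)"
      using \<tau>(2) by (intro always_eventually) (auto intro: less_imp_le)
  qed
  then have x: "\<forall>\<^sub>F n in sequentially. Y \<le> t n - tile_size c (\<tau> n)" for Y
    by (simp add: filterlim_at_top)
  show ?thesis
  proof (rule tendstoI)
    fix e :: real assume "0 < e"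
    then obtain Y where Y: "\<And>x h w. Y \<le> x \<Longrightarrow> norm w = 1
        \<Longrightarrow> norm (descend (\<lambda>h w s. f ((h, w), s)) h w x - (LINT x|\<rho>. f x)) < e"
      using f unfolding good_def settles_def by blast
    show "\<forall>\<^sub>F n in sequentially. dist (tile_area_average c f (S n)) (LINT x|\<rho>. f x) < e"
      using x[of Y]
    proof eventually_elim
      case (elim n)
      show ?case
      proof (rule inflates_to_average[OF \<tau>(1)[of n] inf[of n]])
        fix h and w :: complex
        assume w: "norm w = 1" and avg: "\<And>f. tile_area_average c f (S n)
          = descend (\<lambda>h w s. f ((h, w), s)) h w (t n - tile_size c (\<tau> n))"
        show "dist (tile_area_average c f (S n)) (LINT x|\<rho>. f x) < e"
          unfolding avg dist_norm by (rule Y[OF elim w])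
      qed
    qed
  qed
qed

text \<open>Numerator and denominator converge as area-weighted averages. Their limits are a common
  constant times the \<nu>-integral of f and that constant itself, so the quotient is the
  \<nu>-integral.\<close>

lemma average_tendsto:
  assumes S: "supertile_sequence a b c S" and f: "f \<in> borel_measurable \<rho>"
    and good: "good (\<lambda>x. f x * exp (2 * snd x))"
  shows "(\<lambda>n. tile_average c f (S n)) \<longlonglongrightarrow> (LINT x|\<nu>. f x)"
proof -
  let ?K = "2 * c\<^sup>2 / (a\<^sup>2 * size_alpha a c + b\<^sup>2 * size_beta b c)"
  have K: "0 < ?K" using c_pos mean_pos' by simp
  have "good (\<lambda>x. 1 * exp (2 * snd x))" by (rule good_continuous_exp) (auto simp: bounded_iff)
  then have goode: "good (\<lambda>x. exp (2 * snd x))" by simp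
  have "(\<lambda>n. tile_area_average c (\<lambda>x. f x * exp (2 * snd x)) (S n) / tile_area_average c (\<lambda>x. exp (2 * snd x)) (S n))
      \<longlonglongrightarrow> (LINT x|\<rho>. f x * exp (2 * snd x)) / (LINT x|\<rho>. exp (2 * snd x))"
    using K by (intro tendsto_divide area_average_tendsto[OF S] good goode) (simp only: integral_exp_\<rho>)
  also have "(LINT x|\<rho>. f x * exp (2 * snd x)) / (LINT x|\<rho>. exp (2 * snd x)) = (LINT x|\<nu>. f x)"
    unfolding integral_\<nu>[OF f] integral_exp_\<rho> using K by (intro nonzero_mult_div_cancel_left) (rule less_imp_neq[symmetric])
  also have "(\<lambda>n. tile_area_average c (\<lambda>x. f x * exp (2 * snd x)) (S n) / tile_area_average c (\<lambda>x. exp (2 * snd x)) (S n))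
      = (\<lambda>n. tile_average c f (S n))"
  proof
    fix n
    obtain \<tau> t where T: "is_tile a b c \<tau>" "inflates_to c t {#\<tau>#} (S n)"
      using S unfolding supertile_sequence_def by blast
    from inflates_to_average[OF T] obtain h w where
      "\<And>f. tile_average c f (S n) = tile_area_average c (\<lambda>x. f x * exp (2 * snd x)) (S n)
        / tile_area_average c (\<lambda>x. exp (2 * snd x)) (S n)"
      by blast
    then show "tile_area_average c (\<lambda>x. f x * exp (2 * snd x)) (S n) / tile_area_average c (\<lambda>x. exp (2 * snd x)) (S n)
        = tile_average c f (S n)" by (rule sym)
  qed
  finally show ?thesis .
qed

end

theorem theorem9:
  fixes a b c :: real and S :: "nat \<Rightarrow> tile multiset"
  assumes "0 < a" and "0 < b" and "0 < c" and "a\<^sup>2 + b\<^sup>2 = c\<^sup>2"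
    and "size_alpha a c / size_beta b c \<notin> \<rat>"
    and "arctan (a / b) / pi \<notin> \<rat>"
    and "supertile_sequence a b c S"
  shows "(\<forall>f. continuous_on (tile_space a b c) f \<and> bounded (f ` tile_space a b c) \<longrightarrow>
            (\<lambda>n. tile_average c f (S n)) \<longlonglongrightarrow> (LINT x|tile_nu a b c. f x) \<and>
            (\<lambda>n. tile_area_average c f (S n)) \<longlonglongrightarrow> (LINT x|tile_rho a b c. f x)) \<and>
         (\<forall>R. is_rectangle a b c R \<longrightarrow>
            (\<lambda>n. tile_average c (indicator R) (S n)) \<longlonglongrightarrow> (LINT x|tile_nu a b c. indicator R x) \<and>
            (\<lambda>n. tile_area_average c (indicator R) (S n)) \<longlonglongrightarrow> (LINT x|tile_rho a b c. indicator R x))"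
proof -
  interpret tiling a b c using assms by unfold_locales
  have "(\<lambda>n. tile_average c f (S n)) \<longlonglongrightarrow> (LINT x|\<nu>. f x) \<and> (\<lambda>n. tile_area_average c f (S n)) \<longlonglongrightarrow> (LINT x|\<rho>. f x)"
    if *: "\<And>m. 0 \<le> m \<Longrightarrow> good (\<lambda>x. f x * exp (m * snd x))" for f
  proof
    have "good f" using *[of 0] by simp
    then show "(\<lambda>n. tile_area_average c f (S n)) \<longlonglongrightarrow> (LINT x|\<rho>. f x)"
      by (rule area_average_tendsto[OF assms(7)])
    show "(\<lambda>n. tile_average c f (S n)) \<longlonglongrightarrow> (LINT x|\<nu>. f x)"
      using \<open>good f\<close> *[of 2] by (intro average_tendsto[OF assms(7)]) (simp_all add: good_def)
  qed
  then show ?thesis using good_continuous_exp good_rectangle_exp by blast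
qed

end
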